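(* Let $F\colon\mathcal{D}\to\mathcal{D}$ be an endofunctor of a triangulated category $\mathcal{D}$ with a split generator $G$, and let $h_t(F)$ be the categorical entropy function of $F$. Then $t\mapsto h_t(F)$ is a real-valued convex function on $\mathbb{R}$ that satisfies $$t\cdot\tau^+(F)\le h_t(F)\le h_0(F)+t\cdot\tau^+(F)\quad\text{for } t\ge0,$$ $$t\cdot\tau^-(F)\le h_t(F)\le h_0(F)+t\cdot\tau^-(F)\quad\text{for } t\le0.$$ In particular, $\lim_{t\to\pm\infty}\frac{h_t(F)}{t}=\tau^\pm(F)\in\mathbb{R}$.
   Context: Conventions: $\mathbf{k}$ is a base field. All triangulated categories are $\mathbf{k}$-linear, $\mathbb{Z}$-graded, saturated, and of finite type, i.e. $\bigoplus_i\mathrm{Hom}_{\mathcal{D}}(E,E'[i])$ is finite-dimensional for all objects $E,E'$. All functors are $\mathbf{k}$-linear, triangulated, and not virtually zero (no power is the zero functor). Complexity function: for objects $E_1,E_2$ and $t\in\mathbb{R}$, $$\delta_t(E_1,E_2):=\inf\Big\{\sum_{k=1}^m e^{n_kt}\Big\}\in[0,\infty],$$ the infimum being over all sequences $0=A_0\to A_1\to\cdots\to A_m=E_2\oplus E'$ for some object $E'$, with $\mathrm{Cone}(A_{k-1}\to A_k)\cong E_1[n_k]$, $n_k\in\mathbb{Z}$; $\delta_t(E_1,E_2)=0$ if $E_2\cong0$ and $\delta_t(E_1,E_2)=\infty$ if $E_2$ is not in the thick triangulated subcategory generated by $E_1$. An object $G$ is a split generator if $\delta_t(G,E)<\infty$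 for all $E\in\mathcal{D}$. Categorical entropy function: $h_t(F):=\lim_{n\to\infty}\frac{\log\delta_t(G,F^nG)}{n}\in[-\infty,\infty)$, where $G$ is a split generator (the limit exists and is independent of $G$; it is also equal to $\lim_{n\to\infty}\frac1n\log\sum_{k\in\mathbb{Z}}\dim_{\mathbf{k}}\mathrm{Hom}(G,F^nG[-k])e^{kt}$). Shifting numbers: with $\epsilon^+(E_1,E_2):=\max\{k\in\mathbb{Z}:\mathrm{Hom}(E_1,E_2[-k])\neq0\}$ and $\epsilon^-(E_1,E_2):=\min\{k\in\mathbb{Z}:\mathrm{Hom}(E_1,E_2[-k])\neq0\}$, set $\tau^\pm(F):=\lim_{n\to\infty}\epsilon^\pm(G,F^nG)/n$ (the limits exist in $\mathbb{R}$ and are independent of $G$). *)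

theory Defs
  imports "HOL-Analysis.Analysis"
begin

section \<open>Linear categories\<close>

text \<open>
  Hom-spaces (and, further below, the graded pieces of the Hom-complexes of a dg category and of a
  dg bimodule) are realised as linear subspaces of one ambient vector space in which their sum is
  direct. Every small linear category is of this form (take the direct sum of all its Hom-spaces),
  and a family of linear maps between Hom-spaces is then the same thing as a single function on
  their union; so composition, functors and differentials need no object arguments.
\<close>

definition independent_family :: "'i set \<Rightarrow> ('i \<Rightarrow> 'v::ab_group_add set) \<Rightarrow> bool" where
  "independent_family I V \<longleftrightarrow>
     (\<forall>S x. finite S \<and> S \<subseteq> I \<and> (\<forall>i\<in>S. x i \<in> V i) \<and> (\<Sum>i\<in>S. x i) = 0 \<longrightarrow> (\<forall>i\<in>S. x i = 0))"

definition linear_map_on ::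
  "('k \<Rightarrow> 'v \<Rightarrow> 'v) \<Rightarrow> ('k \<Rightarrow> 'w \<Rightarrow> 'w) \<Rightarrow> 'v set \<Rightarrow> ('v::ab_group_add \<Rightarrow> 'w::ab_group_add) \<Rightarrow> bool" where
  "linear_map_on s1 s2 V f \<longleftrightarrow>
     (\<forall>x\<in>V. \<forall>y\<in>V. f (x + y) = f x + f y) \<and> (\<forall>c. \<forall>x\<in>V. f (s1 c x) = s2 c (f x))"

definition bilinear_map_on ::
  "('k \<Rightarrow> 'u \<Rightarrow> 'u) \<Rightarrow> ('k \<Rightarrow> 'v \<Rightarrow> 'v) \<Rightarrow> ('k \<Rightarrow> 'w \<Rightarrow> 'w) \<Rightarrow> 'u set \<Rightarrow> 'v set
     \<Rightarrow> ('u::ab_group_add \<Rightarrow> 'v::ab_group_add \<Rightarrow> 'w::ab_group_add) \<Rightarrow> bool" where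
  "bilinear_map_on s1 s2 s3 U V b \<longleftrightarrow>
     (\<forall>x\<in>U. linear_map_on s2 s3 V (b x)) \<and> (\<forall>y\<in>V. linear_map_on s1 s3 U (\<lambda>x. b x y))"

definition finite_dim_subspace :: "('k::field \<Rightarrow> 'v \<Rightarrow> 'v) \<Rightarrow> 'v::ab_group_add set \<Rightarrow> bool" where
  "finite_dim_subspace s V \<longleftrightarrow> module.subspace s V \<and> (\<exists>B. finite B \<and> V \<subseteq> module.span s B)"

record ('o, 'm, 'k) lin_cat =
  Obj :: "'o set"
  Hom :: "'o \<Rightarrow> 'o \<Rightarrow> 'm set"
  Comp :: "'m \<Rightarrow> 'm \<Rightarrow> 'm" (infixr "\<cdot>\<index>" 75)
  Ident :: "'o \<Rightarrow> 'm"
  Scale :: "'k \<Rightarrow> 'm \<Rightarrow> 'm"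

locale linear_category =
  fixes D :: "('o, 'm::ab_group_add, 'k::field, 'z) lin_cat_scheme" (structure)
  assumes vector_space_Scale: "vector_space (Scale D)"
    and subspace_Hom: "\<lbrakk>X \<in> Obj D; Y \<in> Obj D\<rbrakk> \<Longrightarrow> module.subspace (Scale D) (Hom D X Y)"
    and independent_Hom: "independent_family (Obj D \<times> Obj D) (\<lambda>(X, Y). Hom D X Y)"
    and Comp_closed: "\<lbrakk>X \<in> Obj D; Y \<in> Obj D; Z \<in> Obj D; g \<in> Hom D Y Z; f \<in> Hom D X Y\<rbrakk>
          \<Longrightarrow> g \<cdot> f \<in> Hom D X Z"
    and Comp_bilinear: "\<lbrakk>X \<in> Obj D; Y \<in> Obj D; Z \<in> Obj D\<rbrakk>
          \<Longrightarrow> bilinear_map_on (Scale D) (Scale D) (Scale D) (Hom D Y Z) (Hom D X Y) (Comp D)"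
    and Comp_assoc: "\<lbrakk>W \<in> Obj D; X \<in> Obj D; Y \<in> Obj D; Z \<in> Obj D;
            h \<in> Hom D Y Z; g \<in> Hom D X Y; f \<in> Hom D W X\<rbrakk> \<Longrightarrow> (h \<cdot> g) \<cdot> f = h \<cdot> (g \<cdot> f)"
    and Ident_closed: "X \<in> Obj D \<Longrightarrow> Ident D X \<in> Hom D X X"
    and Ident_left: "\<lbrakk>X \<in> Obj D; Y \<in> Obj D; f \<in> Hom D X Y\<rbrakk> \<Longrightarrow> Ident D Y \<cdot> f = f"
    and Ident_right: "\<lbrakk>X \<in> Obj D; Y \<in> Obj D; f \<in> Hom D X Y\<rbrakk> \<Longrightarrow> f \<cdot> Ident D X = f"

definition is_zero :: "('o, 'm::zero, 'k, 'z) lin_cat_scheme \<Rightarrow> 'o \<Rightarrow> bool" where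
  "is_zero D X \<longleftrightarrow> X \<in> Obj D \<and> (\<forall>Y\<in>Obj D. Hom D X Y = {0} \<and> Hom D Y X = {0})"

definition is_iso :: "('o, 'm, 'k, 'z) lin_cat_scheme \<Rightarrow> 'o \<Rightarrow> 'o \<Rightarrow> 'm \<Rightarrow> bool" where
  "is_iso D X Y f \<longleftrightarrow> f \<in> Hom D X Y \<and>
     (\<exists>g\<in>Hom D Y X. Comp D g f = Ident D X \<and> Comp D f g = Ident D Y)"

definition is_biproduct ::
  "('o, 'm::ab_group_add, 'k, 'z) lin_cat_scheme \<Rightarrow> 'o \<Rightarrow> 'o \<Rightarrow> 'o \<Rightarrow> bool" where
  "is_biproduct D X Y S \<longleftrightarrow> S \<in> Obj D \<and>
     (\<exists>i\<in>Hom D X S. \<exists>j\<in>Hom D Y S. \<exists>p\<in>Hom D S X. \<exists>q\<in>Hom D S Y.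
        Comp D p i = Ident D X \<and> Comp D q j = Ident D Y \<and> Comp D p j = 0 \<and> Comp D q i = 0 \<and>
        Comp D i p + Comp D j q = Ident D S)"

definition idempotent_complete :: "('o, 'm, 'k, 'z) lin_cat_scheme \<Rightarrow> bool" where
  "idempotent_complete D \<longleftrightarrow>
     (\<forall>X\<in>Obj D. \<forall>e\<in>Hom D X X. Comp D e e = e \<longrightarrow>
        (\<exists>Y\<in>Obj D. \<exists>r\<in>Hom D X Y. \<exists>i\<in>Hom D Y X. Comp D i r = e \<and> Comp D r i = Ident D Y))"


section \<open>Triangulated categories\<close>

text \<open>
  The shift functors form a strict action of the integers. \<open>Tri D X Y Z f g h\<close> says that
  the sequence X, Y, Z, X[1] with the maps f, g, h is a distinguished triangle.
\<close>

record ('o, 'm, 'k) tri_cat = "('o, 'm, 'k) lin_cat" +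
  Sh :: "int \<Rightarrow> 'o \<Rightarrow> 'o"
  ShM :: "int \<Rightarrow> 'm \<Rightarrow> 'm"
  Tri :: "'o \<Rightarrow> 'o \<Rightarrow> 'o \<Rightarrow> 'm \<Rightarrow> 'm \<Rightarrow> 'm \<Rightarrow> bool"

locale triangulated_category =
  linear_category D for D :: "('o, 'm::ab_group_add, 'k::field) tri_cat" (structure) +
  assumes zero_exists: "\<exists>X. is_zero D X"
    and biproduct_exists: "\<lbrakk>X \<in> Obj D; Y \<in> Obj D\<rbrakk> \<Longrightarrow> \<exists>S. is_biproduct D X Y S"
    and Sh_closed: "X \<in> Obj D \<Longrightarrow> Sh D n X \<in> Obj D"
    and Sh_0: "X \<in> Obj D \<Longrightarrow> Sh D 0 X = X"
    and Sh_add: "X \<in> Obj D \<Longrightarrow> Sh D (m + n) X = Sh D m (Sh D n X)"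
    and ShM_closed: "\<lbrakk>X \<in> Obj D; Y \<in> Obj D; f \<in> Hom D X Y\<rbrakk>
          \<Longrightarrow> ShM D n f \<in> Hom D (Sh D n X) (Sh D n Y)"
    and ShM_linear: "\<lbrakk>X \<in> Obj D; Y \<in> Obj D\<rbrakk>
          \<Longrightarrow> linear_map_on (Scale D) (Scale D) (Hom D X Y) (ShM D n)"
    and ShM_Ident: "X \<in> Obj D \<Longrightarrow> ShM D n (Ident D X) = Ident D (Sh D n X)"
    and ShM_Comp: "\<lbrakk>X \<in> Obj D; Y \<in> Obj D; Z \<in> Obj D; g \<in> Hom D Y Z; f \<in> Hom D X Y\<rbrakk>
          \<Longrightarrow> ShM D n (g \<cdot> f) = ShM D n g \<cdot> ShM D n f"
    and ShM_0: "\<lbrakk>X \<in> Obj D; Y \<in> Obj D; f \<in> Hom D X Y\<rbrakk> \<Longrightarrow> ShM D 0 f = f"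
    and ShM_add: "\<lbrakk>X \<in> Obj D; Y \<in> Obj D; f \<in> Hom D X Y\<rbrakk>
          \<Longrightarrow> ShM D (m + n) f = ShM D m (ShM D n f)"
    and Tri_typed: "Tri D X Y Z f g h \<Longrightarrow> X \<in> Obj D \<and> Y \<in> Obj D \<and> Z \<in> Obj D \<and>
          f \<in> Hom D X Y \<and> g \<in> Hom D Y Z \<and> h \<in> Hom D Z (Sh D 1 X)"
    and Tri_iso: "\<lbrakk>Tri D X Y Z f g h; X' \<in> Obj D; Y' \<in> Obj D; Z' \<in> Obj D;
            f' \<in> Hom D X' Y'; g' \<in> Hom D Y' Z'; h' \<in> Hom D Z' (Sh D 1 X');
            is_iso D X X' a; is_iso D Y Y' b; is_iso D Z Z' c;
            b \<cdot> f = f' \<cdot> a; c \<cdot> g = g' \<cdot> b; ShM D 1 a \<cdot> h = h' \<cdot> c\<rbrakk>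
          \<Longrightarrow> Tri D X' Y' Z' f' g' h'"
    and TR1_Ident: "\<lbrakk>X \<in> Obj D; is_zero D Z\<rbrakk> \<Longrightarrow> Tri D X X Z (Ident D X) 0 0"
    and TR1_cone: "\<lbrakk>X \<in> Obj D; Y \<in> Obj D; f \<in> Hom D X Y\<rbrakk> \<Longrightarrow> \<exists>Z g h. Tri D X Y Z f g h"
    and TR2: "\<lbrakk>X \<in> Obj D; Y \<in> Obj D; Z \<in> Obj D;
            f \<in> Hom D X Y; g \<in> Hom D Y Z; h \<in> Hom D Z (Sh D 1 X)\<rbrakk>
          \<Longrightarrow> Tri D X Y Z f g h \<longleftrightarrow> Tri D Y Z (Sh D 1 X) g h (- ShM D 1 f)"
    and TR3: "\<lbrakk>Tri D X Y Z f g h; Tri D X' Y' Z' f' g' h';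
            a \<in> Hom D X X'; b \<in> Hom D Y Y'; b \<cdot> f = f' \<cdot> a\<rbrakk>
          \<Longrightarrow> \<exists>c\<in>Hom D Z Z'. c \<cdot> g = g' \<cdot> b \<and> ShM D 1 a \<cdot> h = h' \<cdot> c"
    and TR4: "\<lbrakk>Tri D X Y Z' f a b; Tri D Y Z X' g c d; Tri D X Z Y' (g \<cdot> f) e u\<rbrakk>
          \<Longrightarrow> \<exists>p\<in>Hom D Z' Y'. \<exists>q\<in>Hom D Y' X'.
                Tri D Z' Y' X' p q (ShM D 1 a \<cdot> d) \<and>
                p \<cdot> a = e \<cdot> g \<and> u \<cdot> p = b \<and> q \<cdot> e = c \<and> d \<cdot> q = ShM D 1 f \<cdot> u"

definition finite_type :: "('o, 'm::ab_group_add, 'k::field) tri_cat \<Rightarrow> bool" where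
  "finite_type D \<longleftrightarrow> (\<forall>X\<in>Obj D. \<forall>Y\<in>Obj D.
     (\<forall>i. finite_dim_subspace (Scale D) (Hom D X (Sh D i Y))) \<and>
     finite {i. Hom D X (Sh D i Y) \<noteq> {0}})"


section \<open>Differential graded categories\<close>

definition koszul :: "int \<Rightarrow> 'v::ab_group_add \<Rightarrow> 'v" where
  "koszul n x = (if even n then x else - x)"

text \<open>Complexes are cohomologically graded.\<close>

definition cocycles :: "(int \<Rightarrow> 'v::zero set) \<Rightarrow> ('v \<Rightarrow> 'v) \<Rightarrow> int \<Rightarrow> 'v set" where
  "cocycles C d n = {x \<in> C n. d x = 0}"

definition coboundaries :: "(int \<Rightarrow> 'v set) \<Rightarrow> ('v \<Rightarrow> 'v) \<Rightarrow> int \<Rightarrow> 'v set" where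
  "coboundaries C d n = d ` C (n - 1)"

definition finite_cohomology ::
  "('k::field \<Rightarrow> 'v \<Rightarrow> 'v) \<Rightarrow> (int \<Rightarrow> 'v::ab_group_add set) \<Rightarrow> ('v \<Rightarrow> 'v) \<Rightarrow> bool" where
  "finite_cohomology s C d \<longleftrightarrow>
     (\<forall>n. \<exists>B. finite B \<and> cocycles C d n \<subseteq> module.span s (B \<union> coboundaries C d n)) \<and>
     finite {n. cocycles C d n \<noteq> coboundaries C d n}"

record ('a, 'v, 'k) dg_cat =
  DObj :: "'a set"
  DHom :: "'a \<Rightarrow> 'a \<Rightarrow> int \<Rightarrow> 'v set"
  DComp :: "'v \<Rightarrow> 'v \<Rightarrow> 'v" (infixr "\<odot>\<index>" 75)
  DIdent :: "'a \<Rightarrow> 'v"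
  DDiff :: "'v \<Rightarrow> 'v"
  DScale :: "'k \<Rightarrow> 'v \<Rightarrow> 'v"

locale dg_category =
  fixes A :: "('a, 'v::ab_group_add, 'k::field) dg_cat" (structure)
  assumes vector_space_DScale: "vector_space (DScale A)"
    and subspace_DHom: "\<lbrakk>X \<in> DObj A; Y \<in> DObj A\<rbrakk> \<Longrightarrow> module.subspace (DScale A) (DHom A X Y n)"
    and independent_DHom:
          "independent_family (DObj A \<times> DObj A \<times> UNIV) (\<lambda>(X, Y, n). DHom A X Y n)"
    and DComp_closed: "\<lbrakk>X \<in> DObj A; Y \<in> DObj A; Z \<in> DObj A; g \<in> DHom A Y Z m; f \<in> DHom A X Y n\<rbrakk>
          \<Longrightarrow> g \<odot> f \<in> DHom A X Z (m + n)"
    and DComp_bilinear: "\<lbrakk>X \<in> DObj A; Y \<in> DObj A; Z \<in> DObj A\<rbrakk>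
          \<Longrightarrow> bilinear_map_on (DScale A) (DScale A) (DScale A)
                 (DHom A Y Z m) (DHom A X Y n) (DComp A)"
    and DComp_assoc: "\<lbrakk>W \<in> DObj A; X \<in> DObj A; Y \<in> DObj A; Z \<in> DObj A;
            h \<in> DHom A Y Z l; g \<in> DHom A X Y m; f \<in> DHom A W X n\<rbrakk>
          \<Longrightarrow> (h \<odot> g) \<odot> f = h \<odot> (g \<odot> f)"
    and DIdent_closed: "X \<in> DObj A \<Longrightarrow> DIdent A X \<in> DHom A X X 0"
    and DIdent_left: "\<lbrakk>X \<in> DObj A; Y \<in> DObj A; f \<in> DHom A X Y n\<rbrakk> \<Longrightarrow> DIdent A Y \<odot> f = f"
    and DIdent_right: "\<lbrakk>X \<in> DObj A; Y \<in> DObj A; f \<in> DHom A X Y n\<rbrakk> \<Longrightarrow> f \<odot> DIdent A X = f"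
    and DDiff_closed: "\<lbrakk>X \<in> DObj A; Y \<in> DObj A; f \<in> DHom A X Y n\<rbrakk>
          \<Longrightarrow> DDiff A f \<in> DHom A X Y (n + 1)"
    and DDiff_linear: "\<lbrakk>X \<in> DObj A; Y \<in> DObj A\<rbrakk>
          \<Longrightarrow> linear_map_on (DScale A) (DScale A) (DHom A X Y n) (DDiff A)"
    and DDiff_DDiff: "\<lbrakk>X \<in> DObj A; Y \<in> DObj A; f \<in> DHom A X Y n\<rbrakk> \<Longrightarrow> DDiff A (DDiff A f) = 0"
    and DDiff_DComp: "\<lbrakk>X \<in> DObj A; Y \<in> DObj A; Z \<in> DObj A; g \<in> DHom A Y Z m; f \<in> DHom A X Y n\<rbrakk>
          \<Longrightarrow> DDiff A (g \<odot> f) = DDiff A g \<odot> f + koszul m (g \<odot> DDiff A f)"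

abbreviation DZ :: "('a, 'v::ab_group_add, 'k) dg_cat \<Rightarrow> 'a \<Rightarrow> 'a \<Rightarrow> int \<Rightarrow> 'v set" where
  "DZ A X Y n \<equiv> cocycles (DHom A X Y) (DDiff A) n"

abbreviation DB :: "('a, 'v::ab_group_add, 'k) dg_cat \<Rightarrow> 'a \<Rightarrow> 'a \<Rightarrow> int \<Rightarrow> 'v set" where
  "DB A X Y n \<equiv> coboundaries (DHom A X Y) (DDiff A) n"

text \<open>\<open>Y\<close> represents \<open>X[1]\<close>: the closed invertible \<open>s\<close> of degree -1 corresponds to the identity
  of \<open>X\<close> under \<open>Hom(X, X[1]) = Hom(X, X)[1]\<close>.\<close>

definition dg_shift ::
  "('a, 'v::ab_group_add, 'k) dg_cat \<Rightarrow> 'a \<Rightarrow> 'a \<Rightarrow> 'v \<Rightarrow> 'v \<Rightarrow> bool" where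
  "dg_shift A X Y s t \<longleftrightarrow> X \<in> DObj A \<and> Y \<in> DObj A \<and> s \<in> DZ A X Y (-1) \<and> t \<in> DZ A Y X 1 \<and>
     DComp A t s = DIdent A X \<and> DComp A s t = DIdent A Y"

text \<open>\<open>C\<close> represents the mapping cone of the closed degree 0 morphism \<open>f\<close>: as a graded object it is
  the sum of \<open>X[1]\<close> (inclusion \<open>j\<close>, projection \<open>p\<close>) and \<open>Y\<close> (inclusion \<open>i\<close>, projection \<open>q\<close>),
  and the last four equations prescribe its differential.\<close>

definition dg_cone ::
  "('a, 'v::ab_group_add, 'k) dg_cat \<Rightarrow> 'a \<Rightarrow> 'a \<Rightarrow> 'v \<Rightarrow> 'a \<Rightarrow> 'v \<Rightarrow> 'v \<Rightarrow> 'v \<Rightarrow> 'v \<Rightarrow> bool" where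
  "dg_cone A X Y f C i p j q \<longleftrightarrow>
     X \<in> DObj A \<and> Y \<in> DObj A \<and> C \<in> DObj A \<and> f \<in> DZ A X Y 0 \<and>
     i \<in> DHom A Y C 0 \<and> p \<in> DHom A C X 1 \<and> j \<in> DHom A X C (-1) \<and> q \<in> DHom A C Y 0 \<and>
     DComp A p j = DIdent A X \<and> DComp A q i = DIdent A Y \<and> DComp A p i = 0 \<and> DComp A q j = 0 \<and>
     DComp A j p + DComp A i q = DIdent A C \<and>
     DDiff A i = 0 \<and> DDiff A p = 0 \<and> DDiff A j = DComp A i f \<and> DDiff A q = - DComp A f p"

definition strongly_pretriangulated :: "('a, 'v::ab_group_add, 'k) dg_cat \<Rightarrow> bool" where
  "strongly_pretriangulated A \<longleftrightarrow>
     (\<forall>X\<in>DObj A. \<exists>Y s t. dg_shift A X Y s t) \<and>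
     (\<forall>Y\<in>DObj A. \<exists>X s t. dg_shift A X Y s t) \<and>
     (\<forall>X\<in>DObj A. \<forall>Y\<in>DObj A. \<forall>f\<in>DZ A X Y 0. \<exists>C i p j q. dg_cone A X Y f C i p j q)"

text \<open>
  An exact equivalence from the homotopy category \<open>H\<^sup>0(A)\<close> to \<open>D\<close>, given by a map \<open>\<phi>\<close> on objects and
  a map \<open>\<pi>\<close> on closed morphisms of degree 0 whose kernel consists of the coboundaries (so that the
  induced functor is fully faithful). The isomorphisms \<open>\<theta>\<close> identify the image of \<open>X[1]\<close> with the
  shift of the image of \<open>X\<close>.
\<close>

definition dg_enhancement ::
  "('o, 'm::ab_group_add, 'k::field) tri_cat \<Rightarrow> ('a, 'v::ab_group_add, 'k) dg_cat
     \<Rightarrow> ('a \<Rightarrow> 'o) \<Rightarrow> ('v \<Rightarrow> 'm) \<Rightarrow> bool" where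
  "dg_enhancement D A \<phi> \<pi> \<longleftrightarrow>
     dg_category A \<and> strongly_pretriangulated A \<and>
     (\<forall>X\<in>DObj A. \<phi> X \<in> Obj D) \<and>
     (\<forall>E\<in>Obj D. \<exists>X\<in>DObj A. \<exists>u. is_iso D (\<phi> X) E u) \<and>
     (\<forall>X\<in>DObj A. \<forall>Y\<in>DObj A.
        linear_map_on (DScale A) (Scale D) (DZ A X Y 0) \<pi> \<and>
        \<pi> ` DZ A X Y 0 = Hom D (\<phi> X) (\<phi> Y) \<and>
        (\<forall>f\<in>DZ A X Y 0. \<pi> f = 0 \<longleftrightarrow> f \<in> DB A X Y 0)) \<and>
     (\<forall>X\<in>DObj A. \<pi> (DIdent A X) = Ident D (\<phi> X)) \<and>
     (\<forall>X\<in>DObj A. \<forall>Y\<in>DObj A. \<forall>Z\<in>DObj A. \<forall>g\<in>DZ A Y Z 0. \<forall>f\<in>DZ A X Y 0.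
        \<pi> (DComp A g f) = Comp D (\<pi> g) (\<pi> f)) \<and>
     (\<exists>\<theta>.
        (\<forall>X Y s t. dg_shift A X Y s t \<longrightarrow> is_iso D (\<phi> Y) (Sh D 1 (\<phi> X)) (\<theta> X Y s)) \<and>
        (\<forall>X Y s t X' Y' s' t' f.
           dg_shift A X Y s t \<and> dg_shift A X' Y' s' t' \<and> f \<in> DZ A X X' 0 \<longrightarrow>
           Comp D (\<theta> X' Y' s') (\<pi> (DComp A s' (DComp A f t))) =
             Comp D (ShM D 1 (\<pi> f)) (\<theta> X Y s)) \<and>
        (\<forall>X Y f C i p j q X1 s t.
           dg_cone A X Y f C i p j q \<and> dg_shift A X X1 s t \<longrightarrow>
           Tri D (\<phi> X) (\<phi> Y) (\<phi> C) (\<pi> f) (\<pi> i) (Comp D (\<theta> X X1 s) (\<pi> (DComp A s p)))))"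


section \<open>Bimodules, smoothness, saturatedness\<close>

text \<open>
  A dg bimodule \<open>M\<close> over \<open>A\<close> assigns to \<open>X, Y\<close> a complex \<open>M(X, Y)\<close>, contravariantly in \<open>X\<close> and
  covariantly in \<open>Y\<close>.
\<close>

record ('a, 'v, 'w, 'k) dg_bimod =
  BHom :: "'a \<Rightarrow> 'a \<Rightarrow> int \<Rightarrow> 'w set"
  LAct :: "'v \<Rightarrow> 'w \<Rightarrow> 'w"
  RAct :: "'w \<Rightarrow> 'v \<Rightarrow> 'w"
  BDiff :: "'w \<Rightarrow> 'w"
  BScale :: "'k \<Rightarrow> 'w \<Rightarrow> 'w"

locale dg_bimodule =
  dg_category A for A :: "('a, 'v::ab_group_add, 'k::field) dg_cat" (structure) +
  fixes M :: "('a, 'v, 'w::ab_group_add, 'k) dg_bimod"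
  assumes vector_space_BScale: "vector_space (BScale M)"
    and subspace_BHom: "\<lbrakk>X \<in> DObj A; Y \<in> DObj A\<rbrakk> \<Longrightarrow> module.subspace (BScale M) (BHom M X Y n)"
    and independent_BHom:
          "independent_family (DObj A \<times> DObj A \<times> UNIV) (\<lambda>(X, Y, n). BHom M X Y n)"
    and LAct_closed: "\<lbrakk>X \<in> DObj A; Y \<in> DObj A; Z \<in> DObj A; g \<in> DHom A Y Z k; m \<in> BHom M X Y n\<rbrakk>
          \<Longrightarrow> LAct M g m \<in> BHom M X Z (k + n)"
    and RAct_closed: "\<lbrakk>W \<in> DObj A; X \<in> DObj A; Y \<in> DObj A; m \<in> BHom M X Y n; f \<in> DHom A W X k\<rbrakk>
          \<Longrightarrow> RAct M m f \<in> BHom M W Y (n + k)"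
    and LAct_bilinear: "\<lbrakk>X \<in> DObj A; Y \<in> DObj A; Z \<in> DObj A\<rbrakk>
          \<Longrightarrow> bilinear_map_on (DScale A) (BScale M) (BScale M)
                 (DHom A Y Z k) (BHom M X Y n) (LAct M)"
    and RAct_bilinear: "\<lbrakk>W \<in> DObj A; X \<in> DObj A; Y \<in> DObj A\<rbrakk>
          \<Longrightarrow> bilinear_map_on (BScale M) (DScale A) (BScale M)
                 (BHom M X Y n) (DHom A W X k) (RAct M)"
    and LAct_DComp: "\<lbrakk>X \<in> DObj A; Y \<in> DObj A; Y' \<in> DObj A; Y'' \<in> DObj A;
            h \<in> DHom A Y' Y'' l; g \<in> DHom A Y Y' k; m \<in> BHom M X Y n\<rbrakk>
          \<Longrightarrow> LAct M (h \<odot> g) m = LAct M h (LAct M g m)"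
    and RAct_DComp: "\<lbrakk>X'' \<in> DObj A; X' \<in> DObj A; X \<in> DObj A; Y \<in> DObj A;
            m \<in> BHom M X Y n; f \<in> DHom A X' X k; e \<in> DHom A X'' X' l\<rbrakk>
          \<Longrightarrow> RAct M m (f \<odot> e) = RAct M (RAct M m f) e"
    and LAct_RAct: "\<lbrakk>W \<in> DObj A; X \<in> DObj A; Y \<in> DObj A; Z \<in> DObj A;
            g \<in> DHom A Y Z k; m \<in> BHom M X Y n; f \<in> DHom A W X l\<rbrakk>
          \<Longrightarrow> RAct M (LAct M g m) f = LAct M g (RAct M m f)"
    and LAct_DIdent: "\<lbrakk>X \<in> DObj A; Y \<in> DObj A; m \<in> BHom M X Y n\<rbrakk> \<Longrightarrow> LAct M (DIdent A Y) m = m"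
    and RAct_DIdent: "\<lbrakk>X \<in> DObj A; Y \<in> DObj A; m \<in> BHom M X Y n\<rbrakk> \<Longrightarrow> RAct M m (DIdent A X) = m"
    and BDiff_closed: "\<lbrakk>X \<in> DObj A; Y \<in> DObj A; m \<in> BHom M X Y n\<rbrakk>
          \<Longrightarrow> BDiff M m \<in> BHom M X Y (n + 1)"
    and BDiff_linear: "\<lbrakk>X \<in> DObj A; Y \<in> DObj A\<rbrakk>
          \<Longrightarrow> linear_map_on (BScale M) (BScale M) (BHom M X Y n) (BDiff M)"
    and BDiff_BDiff: "\<lbrakk>X \<in> DObj A; Y \<in> DObj A; m \<in> BHom M X Y n\<rbrakk> \<Longrightarrow> BDiff M (BDiff M m) = 0"
    and BDiff_LAct: "\<lbrakk>X \<in> DObj A; Y \<in> DObj A; Z \<in> DObj A; g \<in> DHom A Y Z k; m \<in> BHom M X Y n\<rbrakk>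
          \<Longrightarrow> BDiff M (LAct M g m) = LAct M (DDiff A g) m + koszul k (LAct M g (BDiff M m))"
    and BDiff_RAct: "\<lbrakk>W \<in> DObj A; X \<in> DObj A; Y \<in> DObj A; m \<in> BHom M X Y n; f \<in> DHom A W X k\<rbrakk>
          \<Longrightarrow> BDiff M (RAct M m f) = RAct M (BDiff M m) f + koszul n (RAct M m (DDiff A f))"

definition diagonal_bimod :: "('a, 'v, 'k) dg_cat \<Rightarrow> ('a, 'v, 'v, 'k) dg_bimod" where
  "diagonal_bimod A =
     \<lparr>BHom = DHom A, LAct = DComp A, RAct = DComp A, BDiff = DDiff A, BScale = DScale A\<rparr>"

definition bimod_map ::
  "('a, 'v::ab_group_add, 'k::field) dg_cat \<Rightarrow> ('a, 'v, 'w::ab_group_add, 'k) dg_bimod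
     \<Rightarrow> ('a, 'v, 'x::ab_group_add, 'k) dg_bimod \<Rightarrow> ('w \<Rightarrow> 'x) \<Rightarrow> bool" where
  "bimod_map A M N \<psi> \<longleftrightarrow> dg_bimodule A M \<and> dg_bimodule A N \<and>
     (\<forall>X\<in>DObj A. \<forall>Y\<in>DObj A. \<forall>n.
        linear_map_on (BScale M) (BScale N) (BHom M X Y n) \<psi> \<and>
        (\<forall>m\<in>BHom M X Y n. \<psi> m \<in> BHom N X Y n \<and> \<psi> (BDiff M m) = BDiff N (\<psi> m) \<and>
           (\<forall>Z\<in>DObj A. \<forall>k. \<forall>g\<in>DHom A Y Z k. \<psi> (LAct M g m) = LAct N g (\<psi> m)) \<and>
           (\<forall>W\<in>DObj A. \<forall>k. \<forall>f\<in>DHom A W X k. \<psi> (RAct M m f) = RAct N (\<psi> m) f)))"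

abbreviation BZ ::
  "('a, 'v, 'w::ab_group_add, 'k) dg_bimod \<Rightarrow> 'a \<Rightarrow> 'a \<Rightarrow> int \<Rightarrow> 'w set" where
  "BZ M X Y n \<equiv> cocycles (BHom M X Y) (BDiff M) n"

abbreviation BB ::
  "('a, 'v, 'w::ab_group_add, 'k) dg_bimod \<Rightarrow> 'a \<Rightarrow> 'a \<Rightarrow> int \<Rightarrow> 'w set" where
  "BB M X Y n \<equiv> coboundaries (BHom M X Y) (BDiff M) n"

definition quasi_iso ::
  "('a, 'v::ab_group_add, 'k::field) dg_cat \<Rightarrow> ('a, 'v, 'w::ab_group_add, 'k) dg_bimod
     \<Rightarrow> ('a, 'v, 'x::ab_group_add, 'k) dg_bimod \<Rightarrow> ('w \<Rightarrow> 'x) \<Rightarrow> bool" where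
  "quasi_iso A M N \<psi> \<longleftrightarrow> bimod_map A M N \<psi> \<and>
     (\<forall>X\<in>DObj A. \<forall>Y\<in>DObj A. \<forall>n.
        (\<forall>z\<in>BZ M X Y n. \<psi> z \<in> BB N X Y n \<longrightarrow> z \<in> BB M X Y n) \<and>
        (\<forall>y\<in>BZ N X Y n. \<exists>z\<in>BZ M X Y n. y - \<psi> z \<in> BB N X Y n))"

definition short_exact ::
  "('a, 'v::ab_group_add, 'k::field) dg_cat \<Rightarrow> ('a, 'v, 'w::ab_group_add, 'k) dg_bimod
     \<Rightarrow> ('a, 'v, 'w, 'k) dg_bimod \<Rightarrow> ('a, 'v, 'w, 'k) dg_bimod \<Rightarrow> bool" where
  "short_exact A L M N \<longleftrightarrow> (\<exists>\<alpha> \<beta>. bimod_map A L M \<alpha> \<and> bimod_map A M N \<beta> \<and>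
     (\<forall>X\<in>DObj A. \<forall>Y\<in>DObj A. \<forall>n.
        inj_on \<alpha> (BHom L X Y n) \<and>
        \<alpha> ` BHom L X Y n = {m \<in> BHom M X Y n. \<beta> m = 0} \<and>
        \<beta> ` BHom M X Y n = BHom N X Y n))"

definition bimod_retract ::
  "('a, 'v::ab_group_add, 'k::field) dg_cat \<Rightarrow> ('a, 'v, 'w::ab_group_add, 'k) dg_bimod
     \<Rightarrow> ('a, 'v, 'w, 'k) dg_bimod \<Rightarrow> bool" where
  "bimod_retract A L M \<longleftrightarrow> (\<exists>\<alpha> \<rho>. bimod_map A L M \<alpha> \<and> bimod_map A M L \<rho> \<and>
     (\<forall>X\<in>DObj A. \<forall>Y\<in>DObj A. \<forall>n. \<forall>m\<in>BHom L X Y n. \<rho> (\<alpha> m) = m))"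

text \<open>
  \<open>P\<close> is the representable bimodule \<open>A(Y\<^sub>0, -) \<otimes> A(-, X\<^sub>0)\<close>, generated by the closed element \<open>e\<close> of
  degree \<open>n\<close>: the map sending \<open>g \<otimes> f\<close> to \<open>g e f\<close> is onto (first condition) and injective (second
  condition: a tensor is zero iff its coefficients along linearly independent \<open>g\<close> all vanish).
\<close>

definition representable_bimod ::
  "('a, 'v::ab_group_add, 'k::field) dg_cat \<Rightarrow> ('a, 'v, 'w::ab_group_add, 'k) dg_bimod
     \<Rightarrow> 'a \<Rightarrow> 'a \<Rightarrow> int \<Rightarrow> 'w \<Rightarrow> bool" where
  "representable_bimod A P X0 Y0 n e \<longleftrightarrow>
     dg_bimodule A P \<and> X0 \<in> DObj A \<and> Y0 \<in> DObj A \<and> e \<in> BZ P X0 Y0 n \<and>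
     (\<forall>U\<in>DObj A. \<forall>V\<in>DObj A.
        (\<forall>k. BHom P U V k \<subseteq> module.span (BScale P)
           {LAct P g (RAct P e f) | g f a b.
              g \<in> DHom A Y0 V a \<and> f \<in> DHom A U X0 b \<and> a + n + b = k}) \<and>
        (\<forall>S f. finite S \<and> S \<subseteq> (\<Union>a. DHom A Y0 V a) \<and> \<not> module.dependent (DScale A) S \<and>
           (\<forall>g\<in>S. f g \<in> (\<Union>b. DHom A U X0 b)) \<and> (\<Sum>g\<in>S. LAct P g (RAct P e (f g))) = 0 \<longrightarrow>
           (\<forall>g\<in>S. f g = 0)))"

text \<open>
  The class of perfect bimodules: the objects of the thick triangulated subcategory of the derived
  category of bimodules that is generated by the representable ones. Closure under the
  two-out-of-three rule for short exact sequences is closure under triangles (every triangle of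
  the derived category is isomorphic to one arising from a short exact sequence), and includes
  closure under shifts (via the contractible cone of the identity).
\<close>

inductive perfect_bimod ::
  "('a, 'v::ab_group_add, 'k::field) dg_cat \<Rightarrow> ('a, 'v, 'w::ab_group_add, 'k) dg_bimod \<Rightarrow> bool"
  for A :: "('a, 'v, 'k) dg_cat" where
  representable: "representable_bimod A P X0 Y0 n e \<Longrightarrow> perfect_bimod A P"
| qiso_right: "\<lbrakk>perfect_bimod A M; quasi_iso A M N \<psi>\<rbrakk> \<Longrightarrow> perfect_bimod A N"
| qiso_left: "\<lbrakk>perfect_bimod A N; quasi_iso A M N \<psi>\<rbrakk> \<Longrightarrow> perfect_bimod A M"
| exact_left: "\<lbrakk>short_exact A L M N; perfect_bimod A M; perfect_bimod A N\<rbrakk> \<Longrightarrow> perfect_bimod A L"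
| exact_middle: "\<lbrakk>short_exact A L M N; perfect_bimod A L; perfect_bimod A N\<rbrakk> \<Longrightarrow> perfect_bimod A M"
| exact_right: "\<lbrakk>short_exact A L M N; perfect_bimod A L; perfect_bimod A M\<rbrakk> \<Longrightarrow> perfect_bimod A N"
| retract: "\<lbrakk>perfect_bimod A M; bimod_retract A L M\<rbrakk> \<Longrightarrow> perfect_bimod A L"

text \<open>
  Smoothness: the diagonal bimodule is perfect. The type \<open>'w\<close> is the universe in which bimodules
  are formed; it has to be large enough for the usual constructions, and is arbitrary in the
  statement. A quasi-isomorphism from a perfect bimodule moves the diagonal bimodule there.
\<close>

definition smooth_dg ::
  "'w::ab_group_add itself \<Rightarrow> ('a, 'v::ab_group_add, 'k::field) dg_cat \<Rightarrow> bool" where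
  "smooth_dg _ A \<longleftrightarrow>
     (\<exists>(M :: ('a, 'v, 'w, 'k) dg_bimod) \<psi>. perfect_bimod A M \<and> quasi_iso A M (diagonal_bimod A) \<psi>)"

definition proper_dg :: "('a, 'v::ab_group_add, 'k::field) dg_cat \<Rightarrow> bool" where
  "proper_dg A \<longleftrightarrow>
     (\<forall>X\<in>DObj A. \<forall>Y\<in>DObj A. finite_cohomology (DScale A) (DHom A X Y) (DDiff A))"

text \<open>
  Saturated: idempotent complete, with a smooth and proper dg enhancement. The type arguments are
  the objects and morphisms of the enhancement and the universe of its bimodules.
\<close>

definition saturated ::
  "'a itself \<Rightarrow> 'v::ab_group_add itself \<Rightarrow> 'w::ab_group_add itself
     \<Rightarrow> ('o, 'm::ab_group_add, 'k::field) tri_cat \<Rightarrow> bool" where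
  "saturated _ _ _ D \<longleftrightarrow> idempotent_complete D \<and>
     (\<exists>(A :: ('a, 'v, 'k) dg_cat) \<phi> \<pi>.
        dg_enhancement D A \<phi> \<pi> \<and> proper_dg A \<and> smooth_dg TYPE('w) A)"


section \<open>Endofunctors\<close>

record ('o, 'm) endofunctor =
  FObj :: "'o \<Rightarrow> 'o"
  FMor :: "'m \<Rightarrow> 'm"

definition triangulated_endofunctor ::
  "('o, 'm::ab_group_add, 'k::field) tri_cat \<Rightarrow> ('o, 'm) endofunctor \<Rightarrow> bool" where
  "triangulated_endofunctor D F \<longleftrightarrow>
     (\<forall>X\<in>Obj D. FObj F X \<in> Obj D) \<and>
     (\<forall>X\<in>Obj D. \<forall>Y\<in>Obj D.
        linear_map_on (Scale D) (Scale D) (Hom D X Y) (FMor F) \<and>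
        (\<forall>f\<in>Hom D X Y. FMor F f \<in> Hom D (FObj F X) (FObj F Y))) \<and>
     (\<forall>X\<in>Obj D. FMor F (Ident D X) = Ident D (FObj F X)) \<and>
     (\<forall>X\<in>Obj D. \<forall>Y\<in>Obj D. \<forall>Z\<in>Obj D. \<forall>g\<in>Hom D Y Z. \<forall>f\<in>Hom D X Y.
        FMor F (Comp D g f) = Comp D (FMor F g) (FMor F f)) \<and>
     (\<exists>\<theta>.
        (\<forall>X\<in>Obj D. is_iso D (FObj F (Sh D 1 X)) (Sh D 1 (FObj F X)) (\<theta> X)) \<and>
        (\<forall>X\<in>Obj D. \<forall>Y\<in>Obj D. \<forall>f\<in>Hom D X Y.
           Comp D (\<theta> Y) (FMor F (ShM D 1 f)) = Comp D (ShM D 1 (FMor F f)) (\<theta> X)) \<and>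
        (\<forall>X Y Z f g h. Tri D X Y Z f g h \<longrightarrow>
           Tri D (FObj F X) (FObj F Y) (FObj F Z)
             (FMor F f) (FMor F g) (Comp D (\<theta> X) (FMor F h))))"

definition virtually_zero ::
  "('o, 'm::ab_group_add, 'k::field) tri_cat \<Rightarrow> ('o, 'm) endofunctor \<Rightarrow> bool" where
  "virtually_zero D F \<longleftrightarrow> (\<exists>n. \<forall>X\<in>Obj D. is_zero D ((FObj F ^^ n) X))"


section \<open>Complexity, entropy and shifting numbers\<close>

definition complexity_sums ::
  "('o, 'm::ab_group_add, 'k::field) tri_cat \<Rightarrow> real \<Rightarrow> 'o \<Rightarrow> 'o \<Rightarrow> ereal set" where
  "complexity_sums D t E1 E2 =
     {ereal (\<Sum>k<m. exp (real_of_int (\<nu> k) * t)) | m \<nu>.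
        \<exists>(A :: nat \<Rightarrow> 'o) E'. is_zero D (A 0) \<and> E' \<in> Obj D \<and> is_biproduct D E2 E' (A m) \<and>
          (\<forall>k<m. \<exists>f g h. Tri D (A k) (A (Suc k)) (Sh D (\<nu> k) E1) f g h)}"

text \<open>If \<open>E2\<close> is not in the thick subcategory generated by \<open>E1\<close> then the set is empty, and the
  infimum of the empty set is \<open>\<infinity>\<close> in type \<open>ereal\<close>.\<close>

definition complexity ::
  "('o, 'm::ab_group_add, 'k::field) tri_cat \<Rightarrow> real \<Rightarrow> 'o \<Rightarrow> 'o \<Rightarrow> ereal" where
  "complexity D t E1 E2 = (if is_zero D E2 then 0 else Inf (complexity_sums D t E1 E2))"

definition split_generator :: "('o, 'm::ab_group_add, 'k::field) tri_cat \<Rightarrow> 'o \<Rightarrow> bool" where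
  "split_generator D G \<longleftrightarrow> G \<in> Obj D \<and> (\<forall>t. \<forall>E\<in>Obj D. complexity D t G E < \<infinity>)"

definition ereal_log :: "ereal \<Rightarrow> ereal" where
  "ereal_log x = (if x = \<infinity> then \<infinity> else if x \<le> 0 then -\<infinity> else ereal (ln (real_of_ereal x)))"

definition cat_entropy ::
  "('o, 'm::ab_group_add, 'k::field) tri_cat \<Rightarrow> 'o \<Rightarrow> ('o, 'm) endofunctor \<Rightarrow> real \<Rightarrow> ereal" where
  "cat_entropy D G F t =
     lim (\<lambda>n. ereal_log (complexity D t G ((FObj F ^^ n) G)) / ereal (real n))"

definition eps_plus :: "('o, 'm::ab_group_add, 'k::field) tri_cat \<Rightarrow> 'o \<Rightarrow> 'o \<Rightarrow> int" where
  "eps_plus D E1 E2 = Max {k. Hom D E1 (Sh D (- k) E2) \<noteq> {0}}"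

definition eps_minus :: "('o, 'm::ab_group_add, 'k::field) tri_cat \<Rightarrow> 'o \<Rightarrow> 'o \<Rightarrow> int" where
  "eps_minus D E1 E2 = Min {k. Hom D E1 (Sh D (- k) E2) \<noteq> {0}}"

definition tau_plus ::
  "('o, 'm::ab_group_add, 'k::field) tri_cat \<Rightarrow> 'o \<Rightarrow> ('o, 'm) endofunctor \<Rightarrow> ereal" where
  "tau_plus D G F = lim (\<lambda>n. ereal (real_of_int (eps_plus D G ((FObj F ^^ n) G)) / real n))"

definition tau_minus ::
  "('o, 'm::ab_group_add, 'k::field) tri_cat \<Rightarrow> 'o \<Rightarrow> ('o, 'm) endofunctor \<Rightarrow> ereal" where
  "tau_minus D G F = lim (\<lambda>n. ereal (real_of_int (eps_minus D G ((FObj F ^^ n) G)) / real n))"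

end

theory Submission
  imports Defs
begin

text \<open>
  Call a morphism a \<open>G\<close>-ghost if it induces zero on \<open>Hom(G[n], -)\<close> for all \<open>n\<close>. Killing generators of
  the spaces \<open>Hom(G[n], E)\<close> by cones, and iterating, yields a chain of ghosts starting at \<open>E\<close> whose cones
  are built from as many shifts of \<open>G\<close> as the dimensions of these spaces prescribe. Smoothness bounds the length of such a chain:
  by induction over the perfect bimodules \<open>M\<close>, composites of sufficiently many ghosts act as zero on the
  cohomology of \<open>M(X, -)\<close>, and for the diagonal bimodule this says that the composite vanishes. A
  vanishing composite makes \<open>E\<close> a retract of an iterated extension of shifts \<open>G[n]\<close> with
  \<open>\<Sum> e\<^sup>n\<^sup>t \<le> c(t) P\<^sub>t(E)\<close>, where \<open>P\<^sub>t(E) = \<Sum>\<^sub>k dim Hom(G, E[-k]) e\<^sup>k\<^sup>t\<close>, and with every \<open>n\<close> at bounded distance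
  from some \<open>k\<close> with \<open>Hom(G, E[-k]) \<noteq> 0\<close>. Hence the complexity of \<open>F\<^sup>nG\<close> is \<open>P\<^sub>t(F\<^sup>nG)\<close> up to factors
  independent of \<open>n\<close>, the latter is submultiplicative in \<open>n\<close> and log-convex in \<open>t\<close> up to such factors,
  its exponents are additive up to a bounded error, and everything follows from Fekete's lemma.
\<close>

section \<open>Vector spaces and linear categories\<close>

text \<open>Split generation bounds the number of cones for each single object, but gives no control
  as the object varies, whereas the entropy needs constants that serve all iterates of
  \<open>F\<close> at once. Uniformity starts with the representable bimodules:
  \<open>A(Y0, -) \<otimes> A(-, X0)\<close> sees a chain of ghosts only through morphisms out of
  the one object \<open>Y0\<close>. This object is a retract of a finite extension of shifts of
  \<open>G\<close>, so chains as long as that extension already act as zero. The operations that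
  build perfect bimodules keep the required length finite; a short exact sequence adds two lengths.
  With the number of rounds fixed, a round of killing generators enlarges the Poincare sum by at
  most a factor that depends on \<open>t\<close> and on \<open>G\<close>, and spreads the exponents
  by at most a constant. This is the origin of \<open>c(t)\<close> and of the bounded distance. The
  same filtration serves every \<open>t\<close>, so growth and exponents can be read off from one
  construction.\<close>

lemma linear_map_on_0:
  assumes "linear_map_on s1 s2 V f" "0 \<in> V" shows "f 0 = 0"
proof -
  have "f (0 + 0) = f 0 + f 0"
    using assms unfolding linear_map_on_def by blast
  then show ?thesis by simp
qed

section \<open>Dimension estimates for maps that are linear on a subspace\<close>

context vector_space
begin

lemma linear_map_on_span:
  assumes lin: "linear_map_on scale scale V f" and V: "subspace V" and S: "S \<subseteq> V" and x: "x \<in> span S"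
  shows "f x \<in> span (f ` S)"
proof -
  have "x \<in> V \<and> f x \<in> span (f ` S)"
    using x
  proof (induct rule: span_induct_alt)
    case base
    show ?case
      using linear_map_on_0[OF lin subspace_0[OF V]] V by (simp add: subspace_0 span_zero)
  next
    case (step c x y)
    then have xV: "x \<in> V" using S by auto
    then have cx: "scale c x \<in> V" using V by (simp add: subspace_scale)
    have "f (scale c x + y) = scale c (f x) + f y"
      using lin xV cx step unfolding linear_map_on_def by auto
    then show ?case
      using step V cx by (auto intro!: span_add span_scale intro: span_base simp: subspace_add)
  qed
  then show ?thesis ..
qed

lemma finite_basis:
  assumes "finite T" "V \<subseteq> span T"
  obtains B where "finite B" "B \<subseteq> V" "independent B" "V \<subseteq> span B" "card B = dim V"
proof -
  obtain B where B: "B \<subseteq> V" "independent B" "V \<subseteq> span B" "card B = dim V"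
    using basis_exists[of V] .
  have "finite B"
    using independent_span_bound[OF assms(1) B(2)] B(1) assms(2) by blast
  with B show thesis by (rule_tac that)
qed

lemma dim_mono_finite:
  assumes "V \<subseteq> W" "finite T" "W \<subseteq> span T"
  shows "dim V \<le> dim W"
proof -
  obtain B where "finite B" "W \<subseteq> span B" "card B = dim W"
    using finite_basis[OF assms(2,3)] by metis
  then show ?thesis using dim_le_card[of V B] assms(1) by auto
qed

lemma dim_image_le_finite:
  assumes lin: "linear_map_on scale scale V f" and V: "subspace V" and "finite T" "V \<subseteq> span T"
  shows "dim (f ` V) \<le> dim V"
proof -
  obtain B where B: "finite B" "B \<subseteq> V" "V \<subseteq> span B" "card B = dim V"
    using finite_basis[OF assms(3,4)] by metis
  have "f ` V \<subseteq> span (f ` B)"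
    using linear_map_on_span[OF lin V B(2)] B(3) by auto
  then have "dim (f ` V) \<le> card (f ` B)" using dim_le_card B(1) by blast
  also have "\<dots> \<le> card B" using B(1) by (rule card_image_le)
  finally show ?thesis using B(4) by simp
qed

text \<open>Rank-nullity, kept as an inequality: preimages of a basis of the image together with a
  basis of the kernel span \<open>V\<close>.\<close>

lemma dim_le_kernel_plus:
  assumes lin: "linear_map_on scale scale V f" and V: "subspace V" and fV: "finite S" "V \<subseteq> span S"
    and W: "f ` V \<subseteq> W" and fW: "finite T" "W \<subseteq> span T"
  shows "dim V \<le> dim {x \<in> V. f x = 0} + dim W"
proof -
  let ?K = "{x \<in> V. f x = 0}"
  obtain B where B: "finite B" "B \<subseteq> ?K" "?K \<subseteq> span B" "card B = dim ?K"
    by (rule finite_basis[OF fV(1), of ?K]) (use fV(2) in auto)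
  obtain C where C: "finite C" "C \<subseteq> f ` V" "f ` V \<subseteq> span C" "card C = dim (f ` V)"
    by (rule finite_basis[OF fW(1), of "f ` V"]) (use W fW(2) in auto)
  obtain C' where C': "C' \<subseteq> V" "C = f ` C'" "inj_on f C'"
    using C(2) by (metis subset_image_inj)
  then have cC: "finite C'" "card C' = card C"
    using C(1) by (auto simp: card_image finite_image_iff)
  have "V \<subseteq> span (B \<union> C')"
  proof
    fix x assume x: "x \<in> V"
    then have "f x \<in> span (f ` C')" using C(3) C'(2) by auto
    then have "\<exists>y\<in>span C'. f y = f x"
    proof (induct rule: span_induct_alt)
      case base
      show ?case using linear_map_on_0[OF lin subspace_0[OF V]] span_zero by blast
    next
      case (step c u y)
      then obtain a b where ab: "a \<in> C'" "u = f a" "b \<in> span C'" "f b = y" by auto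
      have "b \<in> V" using ab(3) C'(1) V by (meson span_minimal subsetD)
      then have "f (scale c a + b) = scale c u + y"
        using lin ab C'(1) V unfolding linear_map_on_def by (auto simp: subset_iff subspace_scale)
      then show ?case using ab by (meson span_add span_base span_scale)
    qed
    then obtain y where y: "y \<in> span C'" "f y = f x" by blast
    have yV: "y \<in> V" using y(1) C'(1) V by (meson span_minimal subsetD)
    have mV: "scale (-1) y \<in> V" using subspace_scale[OF V yV] .
    have "f (x + scale (-1) y) = f x + f (scale (-1) y)"
      using lin x mV unfolding linear_map_on_def by blast
    moreover have "f (scale (-1) y) = scale (-1) (f y)"
      using lin yV unfolding linear_map_on_def by blast
    ultimately have "f (x + scale (-1) y) = f x + scale (-1) (f y)" by simp
    then have "f (x - y) = 0" using y(2) by simp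
    then have "x - y \<in> ?K" using x yV V by (simp add: subspace_diff)
    then have "x - y \<in> span B" using B(3) by auto
    then have "(x - y) + y \<in> span (B \<union> C')"
      using y(1) by (meson span_add span_mono subsetD sup_ge1 sup_ge2)
    then show "x \<in> span (B \<union> C')" by simp
  qed
  then have "dim V \<le> card (B \<union> C')" using dim_le_card B(1) cC by blast
  also have "\<dots> \<le> card B + card C'" by (rule card_Un_le)
  also have "\<dots> = dim ?K + dim (f ` V)" using B(4) C(4) cC by simp
  also have "dim (f ` V) \<le> dim W" using dim_mono_finite[OF W fW] .
  finally show ?thesis by simp
qed

end

section \<open>Calculus of typed morphisms in a linear category\<close>

sublocale linear_category \<subseteq> vs: vector_space "Scale D"
  by (rule vector_space_Scale)

context linear_category
begin

text \<open>Bundling the typing of a morphism with membership of its endpoints leaves one fact per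
  morphism to pass around.\<close>

definition arr :: "'m \<Rightarrow> 'o \<Rightarrow> 'o \<Rightarrow> bool" where
  "arr f X Y \<longleftrightarrow> X \<in> Obj D \<and> Y \<in> Obj D \<and> f \<in> Hom D X Y"

lemma arr_Obj: "arr f X Y \<Longrightarrow> X \<in> Obj D" "arr f X Y \<Longrightarrow> Y \<in> Obj D"
  by (auto simp: arr_def)

lemma arr_zero: "\<lbrakk>X \<in> Obj D; Y \<in> Obj D\<rbrakk> \<Longrightarrow> arr 0 X Y"
  unfolding arr_def using subspace_Hom vs.subspace_0 by blast

lemma arr_uminus: "arr f X Y \<Longrightarrow> arr (- f) X Y"
  unfolding arr_def using subspace_Hom vs.subspace_neg by blast

lemma arr_diff: "\<lbrakk>arr f X Y; arr g X Y\<rbrakk> \<Longrightarrow> arr (f - g) X Y"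
  unfolding arr_def using subspace_Hom vs.subspace_diff by blast

lemma arr_Ident: "X \<in> Obj D \<Longrightarrow> arr (Ident D X) X X"
  unfolding arr_def using Ident_closed by blast

lemma arr_Comp: "\<lbrakk>arr g Y Z; arr f X Y\<rbrakk> \<Longrightarrow> arr (g \<cdot> f) X Z"
  unfolding arr_def using Comp_closed by blast

lemma assoc: "\<lbrakk>arr h Y Z; arr g X Y; arr f W X\<rbrakk> \<Longrightarrow> (h \<cdot> g) \<cdot> f = h \<cdot> (g \<cdot> f)"
  unfolding arr_def using Comp_assoc by blast

lemma id_left: "arr f X Y \<Longrightarrow> Ident D Y \<cdot> f = f"
  unfolding arr_def using Ident_left by blast

lemma id_right: "arr f X Y \<Longrightarrow> f \<cdot> Ident D X = f"
  unfolding arr_def using Ident_right by blast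

lemma Comp_linear_right:
  assumes "X \<in> Obj D" "arr g Y Z"
  shows "linear_map_on (Scale D) (Scale D) (Hom D X Y) (\<lambda>x. g \<cdot> x)"
  using Comp_bilinear[of X Y Z] assms unfolding bilinear_map_on_def arr_def by simp

lemma Comp_linear_left:
  assumes "arr f X Y" "Z \<in> Obj D"
  shows "linear_map_on (Scale D) (Scale D) (Hom D Y Z) (\<lambda>x. x \<cdot> f)"
  using Comp_bilinear[of X Y Z] assms unfolding bilinear_map_on_def arr_def by simp

lemma linear_map_on_uminus:
  assumes "linear_map_on (Scale D) (Scale D) V f" "x \<in> V"
  shows "f (- x) = - f x"
proof -
  have "f (Scale D (-1) x) = Scale D (-1) (f x)"
    using assms unfolding linear_map_on_def by blast
  then show ?thesis by simp
qed

lemma Comp_add_right: "\<lbrakk>arr g Y Z; arr f X Y; arr f' X Y\<rbrakk> \<Longrightarrow> g \<cdot> (f + f') = g \<cdot> f + g \<cdot> f'"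
  using Comp_linear_right[of X g Y Z] unfolding linear_map_on_def arr_def by simp

lemma Comp_add_left: "\<lbrakk>arr g Y Z; arr g' Y Z; arr f X Y\<rbrakk> \<Longrightarrow> (g + g') \<cdot> f = g \<cdot> f + g' \<cdot> f"
  using Comp_linear_left[of f X Y Z] unfolding linear_map_on_def arr_def by simp

lemma Comp_uminus_right: "\<lbrakk>arr g Y Z; arr f X Y\<rbrakk> \<Longrightarrow> g \<cdot> (- f) = - (g \<cdot> f)"
  using linear_map_on_uminus[OF Comp_linear_right[of X g Y Z]] unfolding arr_def by simp

lemma Comp_uminus_left: "\<lbrakk>arr g Y Z; arr f X Y\<rbrakk> \<Longrightarrow> (- g) \<cdot> f = - (g \<cdot> f)"
  using linear_map_on_uminus[OF Comp_linear_left[of f X Y Z]] unfolding arr_def by simp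

lemma Comp_diff_right: "\<lbrakk>arr g Y Z; arr f X Y; arr f' X Y\<rbrakk> \<Longrightarrow> g \<cdot> (f - f') = g \<cdot> f - g \<cdot> f'"
  using Comp_add_right[of g Y Z f X "- f'"] by (simp add: arr_uminus Comp_uminus_right)

lemma Comp_diff_left: "\<lbrakk>arr g Y Z; arr g' Y Z; arr f X Y\<rbrakk> \<Longrightarrow> (g - g') \<cdot> f = g \<cdot> f - g' \<cdot> f"
  using Comp_add_left[of g Y Z "- g'" f X] by (simp add: arr_uminus Comp_uminus_left)

lemma Comp_0_right: "\<lbrakk>arr g Y Z; X \<in> Obj D\<rbrakk> \<Longrightarrow> g \<cdot> 0 = 0"
  using Comp_diff_right[of g Y Z 0 X 0] arr_zero[of X Y] by (simp add: arr_Obj)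

lemma Comp_0_left: "\<lbrakk>arr f X Y; Z \<in> Obj D\<rbrakk> \<Longrightarrow> 0 \<cdot> f = 0"
  using Comp_diff_left[of 0 Y Z 0 f X] arr_zero[of Y Z] by (simp add: arr_Obj)

lemma is_zero_arr: "\<lbrakk>is_zero D X; arr f X Y \<or> arr f Y X\<rbrakk> \<Longrightarrow> f = 0"
  unfolding is_zero_def arr_def by blast

lemma is_zero_iff: "is_zero D X \<longleftrightarrow> X \<in> Obj D \<and> Ident D X = 0"
proof
  assume "is_zero D X"
  then show "X \<in> Obj D \<and> Ident D X = 0"
    using is_zero_arr arr_Ident unfolding is_zero_def by blast
next
  assume X: "X \<in> Obj D \<and> Ident D X = 0"
  have "f = 0" if "arr f X Y" for f Y
    using id_right[OF that] Comp_0_right[OF that, of X] X by simp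
  moreover have "f = 0" if "arr f Y X" for f Y
    using id_left[OF that] Comp_0_left[OF that, of X] X by simp
  ultimately show "is_zero D X"
    unfolding is_zero_def using X arr_zero unfolding arr_def by blast
qed

lemma is_isoE:
  assumes "is_iso D X Y f" "X \<in> Obj D" "Y \<in> Obj D"
  obtains g where "arr f X Y" "arr g Y X" "g \<cdot> f = Ident D X" "f \<cdot> g = Ident D Y"
  using assms unfolding is_iso_def arr_def by blast

lemma is_isoI:
  "\<lbrakk>arr f X Y; arr g Y X; g \<cdot> f = Ident D X; f \<cdot> g = Ident D Y\<rbrakk> \<Longrightarrow> is_iso D X Y f"
  unfolding is_iso_def arr_def by blast

lemma is_iso_Ident: "X \<in> Obj D \<Longrightarrow> is_iso D X X (Ident D X)"
  using is_isoI arr_Ident id_left by blast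

lemma inverse_Comp:
  assumes "arr f X Y" "arr f' Y X" "arr g Y Z" "arr g' Z Y" "f' \<cdot> f = Ident D X" "g' \<cdot> g = Ident D Y"
  shows "(f' \<cdot> g') \<cdot> (g \<cdot> f) = Ident D X"
proof -
  have "(f' \<cdot> g') \<cdot> (g \<cdot> f) = f' \<cdot> (g' \<cdot> (g \<cdot> f))"
    using assms arr_Comp by (intro assoc[of _ Y X _ Z _ X]) auto
  also have "g' \<cdot> (g \<cdot> f) = (g' \<cdot> g) \<cdot> f"
    using assms assoc[of g' Z Y g Y f X] by simp
  also have "\<dots> = f"
    using assms id_left by simp
  finally show ?thesis
    using assms by simp
qed

lemma is_iso_Comp:
  assumes "is_iso D X Y f" "is_iso D Y Z g" and O: "X \<in> Obj D" "Y \<in> Obj D" "Z \<in> Obj D"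
  shows "is_iso D X Z (g \<cdot> f)"
proof -
  obtain f' where f: "arr f X Y" "arr f' Y X" "f' \<cdot> f = Ident D X" "f \<cdot> f' = Ident D Y"
    using is_isoE[OF assms(1) O(1,2)] .
  obtain g' where g: "arr g Y Z" "arr g' Z Y" "g' \<cdot> g = Ident D Y" "g \<cdot> g' = Ident D Z"
    using is_isoE[OF assms(2) O(2,3)] .
  show ?thesis
    using f g by (intro is_isoI[of _ _ _ "f' \<cdot> g'"] arr_Comp inverse_Comp) auto
qed

section \<open>Isomorphisms, retracts and complements\<close>

definition isomorphic :: "'o \<Rightarrow> 'o \<Rightarrow> bool" where
  "isomorphic X Y \<longleftrightarrow> X \<in> Obj D \<and> Y \<in> Obj D \<and> (\<exists>f. is_iso D X Y f)"

lemma isomorphic_refl: "X \<in> Obj D \<Longrightarrow> isomorphic X X"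
  unfolding isomorphic_def using is_iso_Ident by blast

lemma isomorphic_sym: "isomorphic X Y \<Longrightarrow> isomorphic Y X"
  unfolding isomorphic_def is_iso_def by blast

lemma isomorphic_trans: "\<lbrakk>isomorphic X Y; isomorphic Y Z\<rbrakk> \<Longrightarrow> isomorphic X Z"
  unfolding isomorphic_def using is_iso_Comp by blast

definition is_retract :: "'o \<Rightarrow> 'o \<Rightarrow> bool" where
  "is_retract X Y \<longleftrightarrow> (\<exists>i p. arr i X Y \<and> arr p Y X \<and> p \<cdot> i = Ident D X)"

lemma is_retract_isomorphic: "isomorphic X Y \<Longrightarrow> is_retract X Y"
  unfolding isomorphic_def is_iso_def is_retract_def arr_def by blast

lemma is_retract_trans: "\<lbrakk>is_retract X Y; is_retract Y Z\<rbrakk> \<Longrightarrow> is_retract X Z"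
  unfolding is_retract_def by (blast intro: arr_Comp inverse_Comp)

lemma is_retract_biproduct:
  assumes "is_biproduct D X Y S" "X \<in> Obj D" shows "is_retract X S"
  using assms unfolding is_biproduct_def is_retract_def arr_def by blast

text \<open>The complementary idempotent \<open>1 - i p\<close> splits, and its image is the second
  summand. Ghost arguments produce retracts while complexity is defined with direct sums; this
  passes from the former to the latter.\<close>

lemma biproduct_of_retract:
  assumes ic: "idempotent_complete D" and r: "is_retract X S"
  shows "\<exists>Y\<in>Obj D. is_biproduct D X Y S"
proof -
  obtain i p where ip: "arr i X S" "arr p S X" "p \<cdot> i = Ident D X"
    using r unfolding is_retract_def by blast
  define e where "e = Ident D S - i \<cdot> p"
  have O: "X \<in> Obj D" "S \<in> Obj D" using ip arr_Obj by blast+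
  have S: "arr (Ident D S) S S" using arr_Ident O by blast
  have ipA: "arr (i \<cdot> p) S S" using arr_Comp ip by blast
  have eA: "arr e S S" unfolding e_def using ipA S arr_diff by blast
  have pe: "p \<cdot> e = 0"
    unfolding e_def Comp_diff_right[OF ip(2) S ipA] assoc[OF ip(2,1,2), symmetric] ip(3)
      id_left[OF ip(2)] id_right[OF ip(2)] by simp
  have ei: "e \<cdot> i = 0"
    unfolding e_def Comp_diff_left[OF S ipA ip(1)] assoc[OF ip(1,2,1)] ip(3)
      id_left[OF ip(1)] id_right[OF ip(1)] by simp
  have "e \<cdot> e = (Ident D S - i \<cdot> p) \<cdot> e" by (simp add: e_def)
  also have "\<dots> = e - i \<cdot> (p \<cdot> e)"
    unfolding Comp_diff_left[OF S ipA eA] assoc[OF ip(1,2) eA] id_left[OF eA] ..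
  finally have "e \<cdot> e = e" using pe Comp_0_right[OF ip(1) O(2)] by simp
  then obtain Y r j where Y: "arr r S Y" "arr j Y S" "j \<cdot> r = e" "r \<cdot> j = Ident D Y"
    using ic eA unfolding idempotent_complete_def arr_def by blast
  \<comment> \<open>Writing \<open>j = (j r) j = e j\<close> transfers the vanishing of
    \<open>p e\<close> to \<open>p j\<close>; the same device gives \<open>r i = 0\<close>
    below.\<close>
  have "p \<cdot> j = p \<cdot> ((j \<cdot> r) \<cdot> j)"
    using Y assoc[OF Y(2,1,2)] id_right[OF Y(2)] by simp
  also have "\<dots> = (p \<cdot> e) \<cdot> j"
    using assoc[OF ip(2) eA Y(2)] Y(3) by simp
  finally have pj: "p \<cdot> j = 0" using pe Comp_0_left[OF Y(2) O(1)] by simp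
  have "r \<cdot> i = (r \<cdot> (j \<cdot> r)) \<cdot> i"
    using Y assoc[OF Y(1,2,1), symmetric] id_left[OF Y(1)] by simp
  also have "\<dots> = r \<cdot> (e \<cdot> i)"
    using assoc[OF Y(1) eA ip(1)] Y(3) by simp
  finally have ri: "r \<cdot> i = 0" using ei Comp_0_right[OF Y(1) O(1)] by simp
  have "i \<cdot> p + j \<cdot> r = Ident D S" using Y(3) by (simp add: e_def)
  then show ?thesis
    unfolding is_biproduct_def using Y(1,2,4) ip pj ri unfolding arr_def by blast
qed

end

section \<open>Triangles, filtrations and ghosts\<close>

abbreviation weight :: "real \<Rightarrow> int list \<Rightarrow> real" where
  "weight t ns \<equiv> (\<Sum>n\<leftarrow>ns. exp (real_of_int n * t))"

text \<open>Identity, composition and the class of admissible morphisms are parameters because the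
  notion is used twice: for ghosts in \<open>D\<close> and for their closed lifts in a dg
  category.\<close>

inductive chain ::
  "('o \<Rightarrow> 'm) \<Rightarrow> ('m \<Rightarrow> 'm \<Rightarrow> 'm) \<Rightarrow> 'o set \<Rightarrow> ('o \<Rightarrow> 'o \<Rightarrow> 'm \<Rightarrow> bool)
    \<Rightarrow> nat \<Rightarrow> 'o \<Rightarrow> 'o \<Rightarrow> 'm \<Rightarrow> bool"
  for idt c Ob P where
  chain_0: "X \<in> Ob \<Longrightarrow> chain idt c Ob P 0 X X (idt X)"
| chain_Suc: "\<lbrakk>chain idt c Ob P n X Y f; P Y Z g\<rbrakk> \<Longrightarrow> chain idt c Ob P (Suc n) X Z (c g f)"

context triangulated_category
begin

section \<open>Shifts, rotations and exactness of triangles\<close>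

lemma arr_Sh: "arr f X Y \<Longrightarrow> arr (ShM D n f) (Sh D n X) (Sh D n Y)"
  unfolding arr_def using Sh_closed ShM_closed by blast

lemma Sh_cancel [simp]:
  assumes "X \<in> Obj D"
  shows "Sh D (- n) (Sh D n X) = X" "Sh D n (Sh D (- n) X) = X"
  using Sh_add[OF assms, of "- n" n] Sh_add[OF assms, of n "- n"] Sh_0[OF assms] by simp_all

lemma ShM_cancel [simp]:
  assumes "arr f X Y"
  shows "ShM D (- n) (ShM D n f) = f" "ShM D n (ShM D (- n) f) = f"
  using assms ShM_add[of X Y f "- n" n] ShM_add[of X Y f n "- n"] ShM_0[of X Y f]
  unfolding arr_def by simp_all

lemma ShM_zero: "\<lbrakk>X \<in> Obj D; Y \<in> Obj D\<rbrakk> \<Longrightarrow> ShM D n 0 = 0"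
  using linear_map_on_0[OF ShM_linear] arr_zero unfolding arr_def by blast

lemma ShM_uminus: "arr f X Y \<Longrightarrow> ShM D n (- f) = - ShM D n f"
  using linear_map_on_uminus[OF ShM_linear] unfolding arr_def by blast

lemma ShM_comp: "\<lbrakk>arr g Y Z; arr f X Y\<rbrakk> \<Longrightarrow> ShM D n (g \<cdot> f) = ShM D n g \<cdot> ShM D n f"
  using ShM_Comp unfolding arr_def by blast

lemma is_zero_Sh: "is_zero D X \<Longrightarrow> is_zero D (Sh D n X)"
  using ShM_Ident ShM_zero Sh_closed unfolding is_zero_iff by metis

lemma Tri_arr:
  assumes "Tri D X Y Z f g h"
  shows "arr f X Y" "arr g Y Z" "arr h Z (Sh D 1 X)"
  using Tri_typed[OF assms] Sh_closed unfolding arr_def by blast+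

lemma Tri_rotate:
  assumes "Tri D X Y Z f g h" shows "Tri D Y Z (Sh D 1 X) g h (- ShM D 1 f)"
  using TR2[of X Y Z f g h] Tri_typed[OF assms] assms by blast

text \<open>TR2 read from right to left for a triangle starting at \<open>Z[-1]\<close>; the sign on
  the first map cancels the one that TR2 introduces.\<close>

lemma Tri_rotate_back:
  assumes t: "Tri D X Y Z f g h"
  shows "Tri D (Sh D (-1) Z) X Y (- ShM D (-1) h) f g"
proof -
  have a: "arr f X Y" "arr g Y Z" "arr h Z (Sh D 1 X)" using Tri_arr[OF t] .
  have O: "X \<in> Obj D" "Y \<in> Obj D" "Z \<in> Obj D" using arr_Obj[OF a(1)] arr_Obj[OF a(2)] by simp_all
  have k: "arr (ShM D (-1) h) (Sh D (-1) Z) X"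
    using arr_Sh[OF a(3), of "-1"] Sh_cancel(1)[OF O(1), of 1] by simp
  have "- ShM D 1 (- ShM D (-1) h) = h"
    using ShM_uminus[OF k] ShM_cancel(2)[OF a(3), of 1] by simp
  moreover have "Sh D 1 (Sh D (-1) Z) = Z" using Sh_cancel(2)[OF O(3), of 1] by simp
  ultimately show ?thesis
    using TR2[of "Sh D (-1) Z" X Y "- ShM D (-1) h" f g] t a arr_uminus[OF k] O
    unfolding arr_def by simp
qed

definition tri :: "'o \<Rightarrow> 'o \<Rightarrow> 'o \<Rightarrow> bool" where
  "tri X Y Z \<longleftrightarrow> (\<exists>f g h. Tri D X Y Z f g h)"

lemma tri_Obj:
  assumes "tri X Y Z" shows "X \<in> Obj D" "Y \<in> Obj D" "Z \<in> Obj D"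
  using assms Tri_typed unfolding tri_def by blast+

text \<open>Three rotations shift a triangle by one. The signs they produce do not matter, because
  \<open>tri\<close> forgets the maps.\<close>

lemma tri_shift:
  assumes t: "tri X Y Z"
  shows "tri (Sh D n X) (Sh D n Y) (Sh D n Z)"
proof -
  note O = tri_Obj[OF t]
  show ?thesis
  proof (induct n rule: int_induct[where k = 0])
    case base
    show ?case using t O by (simp add: Sh_0)
  next
    case (step1 i)
    then obtain f g h where "Tri D (Sh D i X) (Sh D i Y) (Sh D i Z) f g h"
      unfolding tri_def by blast
    then have "tri (Sh D 1 (Sh D i X)) (Sh D 1 (Sh D i Y)) (Sh D 1 (Sh D i Z))"
      unfolding tri_def by (blast dest: Tri_rotate)
    then show ?case using O by (simp add: Sh_add[symmetric] add.commute)
  next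
    case (step2 i)
    then obtain f g h where "Tri D (Sh D i X) (Sh D i Y) (Sh D i Z) f g h"
      unfolding tri_def by blast
    then have "tri (Sh D (-1) (Sh D i X)) (Sh D (-1) (Sh D i Y)) (Sh D (-1) (Sh D i Z))"
      unfolding tri_def by (blast dest: Tri_rotate_back)
    then show ?case using O by (simp add: Sh_add[symmetric])
  qed
qed

text \<open>A functor commutes with shifts only up to isomorphism, so the cones of a transported
  filtration must be replaced by isomorphic objects.\<close>

lemma tri_isomorphic:
  assumes t: "tri X Y Z" and Z: "isomorphic Z Z'"
  shows "tri X Y Z'"
proof -
  obtain f g h where fgh: "Tri D X Y Z f g h" using t unfolding tri_def by blast
  note a = Tri_arr[OF fgh]
  note O = tri_Obj[OF t]
  have ZO: "Z' \<in> Obj D" using Z unfolding isomorphic_def by blast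
  obtain c where c0: "is_iso D Z Z' c" using Z unfolding isomorphic_def by blast
  then obtain d where c: "arr c Z Z'" "arr d Z' Z" "d \<cdot> c = Ident D Z" "c \<cdot> d = Ident D Z'"
    using is_isoE O(3) ZO by blast
  have ca: "arr (c \<cdot> g) Y Z'" "arr (h \<cdot> d) Z' (Sh D 1 X)" using arr_Comp a c by blast+
  have hd: "(h \<cdot> d) \<cdot> c = h"
    using assoc[OF a(3) c(2,1)] c(3) id_right[OF a(3)] by simp
  have "Tri D X Y Z' f (c \<cdot> g) (h \<cdot> d)"
  proof (rule Tri_iso[OF fgh, where a = "Ident D X" and b = "Ident D Y" and c = c])
    show "Ident D Y \<cdot> f = f \<cdot> Ident D X" using id_left[OF a(1)] id_right[OF a(1)] by simp
    show "c \<cdot> g = (c \<cdot> g) \<cdot> Ident D Y" using id_right[OF ca(1)] by simp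
    show "ShM D 1 (Ident D X) \<cdot> h = (h \<cdot> d) \<cdot> c"
      using ShM_Ident[OF O(1)] id_left[OF a(3)] hd by simp
  qed (use a ca c0 O ZO is_iso_Ident in \<open>auto simp: arr_def\<close>)
  then show ?thesis unfolding tri_def by blast
qed

lemma Tri_zero:
  assumes X: "X \<in> Obj D" and Z: "is_zero D Z"
  shows "Tri D Z X X 0 (Ident D X) 0"
proof -
  have Z': "is_zero D (Sh D 1 Z)" "Z \<in> Obj D" using Z is_zero_Sh is_zero_iff by blast+
  have "Tri D X X (Sh D 1 Z) (Ident D X) 0 0" by (rule TR1_Ident[OF X Z'(1)])
  from Tri_rotate_back[OF this] show ?thesis
    using Z' X ShM_zero[of "Sh D 1 Z" "Sh D 1 X"] Sh_cancel(1)[of Z 1] Sh_closed by simp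
qed

text \<open>Comparison with the triangle of the identity of \<open>X\<close> factors
  \<open>g f\<close> through a zero object.\<close>

lemma Tri_Comp_zero:
  assumes t: "Tri D X Y Z f g h" shows "g \<cdot> f = 0"
proof -
  obtain N where N: "is_zero D N" using zero_exists by blast
  note a = Tri_arr[OF t]
  have X: "X \<in> Obj D" using arr_Obj[OF a(1)] by simp
  have "\<exists>c\<in>Hom D N Z. c \<cdot> 0 = g \<cdot> f \<and> ShM D 1 (Ident D X) \<cdot> 0 = h \<cdot> c"
    by (rule TR3[OF TR1_Ident[OF X N] t]) (use a X arr_Ident in \<open>auto simp: arr_def\<close>)
  then obtain c where c: "arr c N Z" "c \<cdot> 0 = g \<cdot> f"
    using is_zero_iff[of N] N arr_Obj[OF a(2)] unfolding arr_def by metis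
  then show ?thesis using Comp_0_right[OF c(1) X] by simp
qed

text \<open>Exactness of \<open>Hom(W, -)\<close> at \<open>Y\<close>: TR3 for the rotated triangles
  \<open>W -> 0 -> W[1]\<close> and \<open>Y -> Z -> X[1]\<close> yields a morphism
  \<open>W[1] -> X[1]\<close>, which is then shifted back.\<close>

lemma Tri_lift:
  assumes t: "Tri D X Y Z f g h" and x: "arr x W Y" "g \<cdot> x = 0"
  shows "\<exists>y. arr y W X \<and> x = f \<cdot> y"
proof -
  obtain N where N: "is_zero D N" using zero_exists by blast
  note a = Tri_arr[OF t]
  have O: "W \<in> Obj D" "N \<in> Obj D" "X \<in> Obj D" "Y \<in> Obj D" "Z \<in> Obj D"
    using arr_Obj[OF a(1)] arr_Obj[OF a(2)] arr_Obj[OF x(1)] N is_zero_iff by simp_all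
  have t1: "Tri D W N (Sh D 1 W) 0 0 (- ShM D 1 (Ident D W))"
    using Tri_rotate[OF TR1_Ident[OF O(1) N]] .
  have t2: "Tri D Y Z (Sh D 1 X) g h (- ShM D 1 f)" using Tri_rotate[OF t] .
  have NZ: "arr 0 N Z" using arr_zero O by blast
  have "\<exists>c\<in>Hom D (Sh D 1 W) (Sh D 1 X). c \<cdot> 0 = h \<cdot> 0 \<and>
      ShM D 1 x \<cdot> (- ShM D 1 (Ident D W)) = (- ShM D 1 f) \<cdot> c"
    by (rule TR3[OF t1 t2])
      (use x NZ Comp_0_left[OF arr_zero[OF O(1,2)] O(5)] in \<open>auto simp: arr_def\<close>)
  then obtain c where c: "arr c (Sh D 1 W) (Sh D 1 X)"
      "ShM D 1 x \<cdot> (- ShM D 1 (Ident D W)) = (- ShM D 1 f) \<cdot> c"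
    using O Sh_closed unfolding arr_def by blast
  have xs: "arr (ShM D 1 x) (Sh D 1 W) (Sh D 1 Y)" using arr_Sh x by blast
  have fs: "arr (ShM D 1 f) (Sh D 1 X) (Sh D 1 Y)" using arr_Sh a by blast
  have "ShM D 1 x \<cdot> (- ShM D 1 (Ident D W)) = - ShM D 1 x"
    using ShM_Ident[OF O(1)] Comp_uminus_right[OF xs arr_Ident] id_right[OF xs] Sh_closed[OF O(1)] by simp
  then have eq: "ShM D 1 x = ShM D 1 f \<cdot> c" using c Comp_uminus_left[OF fs c(1)] by simp
  have cs: "arr (ShM D (-1) c) W X"
    using arr_Sh[OF c(1), of "-1"] Sh_cancel(1)[OF O(1), of 1] Sh_cancel(1)[OF O(3), of 1] by simp
  have "x = ShM D (-1) (ShM D 1 f \<cdot> c)" using eq ShM_cancel(1)[OF x(1), of 1] by simp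
  also have "\<dots> = f \<cdot> ShM D (-1) c"
    using ShM_comp[OF fs c(1)] ShM_cancel(1)[OF a(1), of 1] by simp
  finally show ?thesis using cs by blast
qed

text \<open>Exactness of \<open>Hom(-, W)\<close> at \<open>Y\<close>, by mapping the given triangle
  to \<open>0 -> W -> W -> 0\<close>.\<close>

lemma Tri_extend:
  assumes t: "Tri D X Y Z f g h" and x: "arr x Y W" "x \<cdot> f = 0"
  shows "\<exists>y. arr y Z W \<and> x = y \<cdot> g"
proof -
  obtain N where N: "is_zero D N" using zero_exists by blast
  note a = Tri_arr[OF t]
  have O: "W \<in> Obj D" "N \<in> Obj D" "X \<in> Obj D" "Y \<in> Obj D" "Z \<in> Obj D"
    using arr_Obj[OF a(1)] arr_Obj[OF a(2)] arr_Obj[OF x(1)] N is_zero_iff by simp_all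
  have "\<exists>c\<in>Hom D Z W. c \<cdot> g = Ident D W \<cdot> x \<and> ShM D 1 0 \<cdot> h = 0 \<cdot> c"
    by (rule TR3[OF t Tri_zero[OF O(1) N]])
      (use x arr_zero[OF O(3,2)] Comp_0_left[OF arr_zero[OF O(3,2)] O(1)] in \<open>auto simp: arr_def\<close>)
  then show ?thesis using id_left[OF x(1)] O unfolding arr_def by metis
qed

section \<open>Filtrations by shifts of one object\<close>

text \<open>Only the shifts of the successive cones are recorded, the latest first. The intermediate
  objects are forgotten, since weights and dimension bounds depend on the shifts alone.\<close>

inductive filt :: "'o \<Rightarrow> int list \<Rightarrow> 'o \<Rightarrow> bool" for E where
  filt_zero: "is_zero D Z \<Longrightarrow> filt E [] Z"
| filt_cone: "\<lbrakk>filt E ns A; tri A B (Sh D n E)\<rbrakk> \<Longrightarrow> filt E (n # ns) B"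

lemma filt_shift:
  assumes "E \<in> Obj D" "filt E ns B"
  shows "filt E (map (\<lambda>n. k + n) ns) (Sh D k B)"
  using assms(2)
proof (induct rule: filt.induct)
  case (filt_zero Z)
  then show ?case by (simp add: filt.filt_zero is_zero_Sh)
next
  case (filt_cone ns A B n)
  have "tri (Sh D k A) (Sh D k B) (Sh D (k + n) E)"
    using tri_shift[OF filt_cone(3), of k] Sh_add[OF assms(1), of k n] by simp
  then show ?case using filt.filt_cone filt_cone by simp
qed

lemma is_retract_Sh:
  assumes "is_retract X Y" shows "is_retract (Sh D k X) (Sh D k Y)"
proof -
  obtain i p where ip: "arr i X Y" "arr p Y X" "p \<cdot> i = Ident D X"
    using assms unfolding is_retract_def by blast
  have "ShM D k p \<cdot> ShM D k i = Ident D (Sh D k X)"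
    using ShM_comp[OF ip(2,1), of k] ip(3) ShM_Ident[of X] arr_Obj[OF ip(1)] by simp
  then show ?thesis unfolding is_retract_def using ip arr_Sh by blast
qed

text \<open>The octahedral axiom for \<open>a f\<close>: the old and the new cone differ by the cone
  of \<open>a\<close>. As \<open>a\<close> is the second map of a triangle starting at
  \<open>G[n]\<close>, that cone is \<open>G[n + 1]\<close>.\<close>

lemma cone_step:
  assumes t: "Tri D E E' C f g h" and C: "filt G ns C"
    and y: "Tri D (Sh D n G) E' E'' y a b" and G: "G \<in> Obj D"
  shows "\<exists>C' g' h'. Tri D E E'' C' (a \<cdot> f) g' h' \<and> filt G ((n + 1) # ns) C'"
proof -
  have ta: "Tri D E' E'' (Sh D 1 (Sh D n G)) a b (- ShM D 1 y)" using Tri_rotate[OF y] .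
  note a = Tri_arr[OF t] Tri_arr[OF ta]
  have "arr (a \<cdot> f) E E''" using a arr_Comp by blast
  then obtain C' e u where tc: "Tri D E E'' C' (a \<cdot> f) e u"
    using TR1_cone unfolding arr_def by blast
  have "tri C C' (Sh D 1 (Sh D n G))"
    using TR4[OF t ta tc] unfolding tri_def by blast
  then have "tri C C' (Sh D (n + 1) G)" using Sh_add[OF G, of 1 n] by (simp add: add.commute)
  then show ?thesis using tc filt_cone[OF C] by blast
qed

text \<open>When the first map vanishes, the identity of \<open>X[1]\<close> lifts through
  \<open>Z -> X[1]\<close>. In this way a vanishing composite of ghosts makes its source a retract
  of the shifted cone.\<close>

lemma Tri_zero_retract:
  assumes t: "Tri D X Y Z 0 g h"
  shows "is_retract X (Sh D (-1) Z)"
proof -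
  note a = Tri_arr[OF t]
  have O: "X \<in> Obj D" "Y \<in> Obj D" "Z \<in> Obj D" using arr_Obj[OF a(1)] arr_Obj[OF a(2)] by simp_all
  let ?X = "Sh D 1 X"
  have t2: "Tri D Z ?X (Sh D 1 Y) h (- ShM D 1 0) (- ShM D 1 g)"
    using Tri_rotate[OF Tri_rotate[OF t]] .
  have I: "arr (Ident D ?X) ?X ?X" using arr_Ident Sh_closed O by blast
  have "(- ShM D 1 0) \<cdot> Ident D ?X = 0"
    using ShM_zero[OF O(1,2)] Comp_0_left[OF I] Sh_closed O by simp
  then obtain s where s: "arr s ?X Z" "Ident D ?X = h \<cdot> s"
    using Tri_lift[OF t2 I] by blast
  have "is_retract ?X Z" unfolding is_retract_def using s a(3) by metis
  from is_retract_Sh[OF this, of "-1"] show ?thesis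
    using Sh_cancel(1)[OF O(1), of 1] by simp
qed

section \<open>Ghosts and the ghost lemma\<close>

definition ghost :: "'o \<Rightarrow> 'o \<Rightarrow> 'o \<Rightarrow> 'm \<Rightarrow> bool" where
  "ghost G X Y f \<longleftrightarrow> arr f X Y \<and> (\<forall>n x. arr x (Sh D n G) X \<longrightarrow> f \<cdot> x = 0)"

abbreviation ghosts :: "'o \<Rightarrow> nat \<Rightarrow> 'o \<Rightarrow> 'o \<Rightarrow> 'm \<Rightarrow> bool" where
  "ghosts G \<equiv> chain (Ident D) (Comp D) (Obj D) (ghost G)"

lemma ghosts_arr: "ghosts G n X Y f \<Longrightarrow> arr f X Y"
  by (induct rule: chain.induct) (auto simp: arr_Ident ghost_def intro: arr_Comp)

text \<open>The ghost lemma: each ghost uses up one cone. The earlier ghosts kill the restriction of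
  \<open>x\<close> to the lower filtration step, so their composite with \<open>x\<close> factors
  through the top cone \<open>G[n]\<close>, where the last ghost vanishes.\<close>

lemma ghosts_filt_zero:
  assumes B: "filt G ns B" and f: "ghosts G (length ns) X Y f" and x: "arr x B X"
  shows "f \<cdot> x = 0"
  using assms
proof (induct arbitrary: X Y f x rule: filt.induct)
  case (filt_zero Z)
  have "x = 0" using is_zero_arr filt_zero by blast
  then show ?case using Comp_0_right ghosts_arr filt_zero arr_Obj by blast
next
  case (filt_cone ns A B n)
  obtain u v w where t: "Tri D A B (Sh D n G) u v w" using filt_cone(3) unfolding tri_def by blast
  note a = Tri_arr[OF t]
  have "ghosts G (Suc (length ns)) X Y f" using filt_cone(4) by simp
  then obtain W g e where f: "f = e \<cdot> g" "ghosts G (length ns) X W g" "ghost G W Y e"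
    by cases blast
  have ga: "arr g X W" "arr e W Y" using f ghosts_arr unfolding ghost_def by blast+
  have "g \<cdot> (x \<cdot> u) = 0" using filt_cone(2)[OF f(2)] arr_Comp[OF filt_cone(5) a(1)] by blast
  then have "(g \<cdot> x) \<cdot> u = 0" using assoc[OF ga(1) filt_cone(5) a(1)] by simp
  then obtain y where y: "arr y (Sh D n G) W" "g \<cdot> x = y \<cdot> v"
    using Tri_extend[OF t arr_Comp[OF ga(1) filt_cone(5)]] by blast
  have "f \<cdot> x = e \<cdot> (g \<cdot> x)" using f(1) assoc[OF ga(2,1) filt_cone(5)] by simp
  also have "\<dots> = (e \<cdot> y) \<cdot> v" using y assoc[OF ga(2) y(1) a(2)] by simp
  also have "e \<cdot> y = 0" using f(3) y(1) unfolding ghost_def by blast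
  also have "0 \<cdot> v = 0" using Comp_0_left[OF a(2)] arr_Obj[OF ga(2)] by blast
  finally show ?case .
qed

lemma ghosts_retract_zero:
  assumes B: "filt G ns B" and U: "is_retract U B" and f: "ghosts G (length ns) X Y f" and x: "arr x U X"
  shows "f \<cdot> x = 0"
proof -
  obtain i p where ip: "arr i U B" "arr p B U" "p \<cdot> i = Ident D U"
    using U unfolding is_retract_def by blast
  note fa = ghosts_arr[OF f]
  have "f \<cdot> x = f \<cdot> (x \<cdot> (p \<cdot> i))" using ip id_right[OF x] by simp
  also have "\<dots> = f \<cdot> ((x \<cdot> p) \<cdot> i)" using assoc[OF x ip(2,1)] by simp
  also have "\<dots> = (f \<cdot> (x \<cdot> p)) \<cdot> i" using assoc[OF fa arr_Comp[OF x ip(2)] ip(1)] by simp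
  also have "f \<cdot> (x \<cdot> p) = 0" using ghosts_filt_zero[OF B f arr_Comp[OF x ip(2)]] .
  also have "0 \<cdot> i = 0" using Comp_0_left[OF ip(1)] arr_Obj[OF fa] by blast
  finally show ?thesis .
qed

end

section \<open>Dimensions of Hom-spaces\<close>

locale generated_category = triangulated_category D
  for D :: "('o, 'm::ab_group_add, 'k::field) tri_cat" (structure) +
  fixes G :: 'o
  assumes G: "G \<in> Obj D"
    and finite_type: "finite_type D"
    and generates: "E \<in> Obj D \<Longrightarrow> \<exists>ns B. filt G ns B \<and> is_retract E B"
begin

text \<open>The space \<open>Hom(G[k], E)\<close> stands for \<open>Hom(G, E[-k])\<close>, so that no triangle has to be shifted.\<close>

definition hdim :: "'o \<Rightarrow> int \<Rightarrow> nat" where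
  "hdim E k = vs.dim (Hom D (Sh D k G) E)"

definition supp :: "'o \<Rightarrow> int set" where
  "supp E = {k. Hom D (Sh D k G) E \<noteq> {0}}"

definition poinc :: "real \<Rightarrow> 'o \<Rightarrow> real" where
  "poinc t E = (\<Sum>k\<in>supp E. real (hdim E k) * exp (real_of_int k * t))"

lemma Sh_G [simp]: "Sh D k G \<in> Obj D"
  using G Sh_closed by blast

lemma ShM_image:
  assumes "X \<in> Obj D" "Y \<in> Obj D"
  shows "ShM D n ` Hom D X Y = Hom D (Sh D n X) (Sh D n Y)"
proof
  show "ShM D n ` Hom D X Y \<subseteq> Hom D (Sh D n X) (Sh D n Y)"
    using ShM_closed assms by blast
  show "Hom D (Sh D n X) (Sh D n Y) \<subseteq> ShM D n ` Hom D X Y"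
  proof
    fix f assume "f \<in> Hom D (Sh D n X) (Sh D n Y)"
    then have f: "arr f (Sh D n X) (Sh D n Y)" using assms Sh_closed unfolding arr_def by blast
    have "arr (ShM D (- n) f) X Y" using arr_Sh[OF f, of "- n"] assms by simp
    moreover have "f = ShM D n (ShM D (- n) f)" using f by simp
    ultimately show "f \<in> ShM D n ` Hom D X Y" unfolding arr_def by blast
  qed
qed

lemma Hom_Sh_trivial_iff:
  assumes "E \<in> Obj D"
  shows "Hom D (Sh D k G) E = {0} \<longleftrightarrow> Hom D G (Sh D (- k) E) = {0}"
proof -
  have 1: "Hom D G (Sh D (- k) E) = ShM D (- k) ` Hom D (Sh D k G) E"
    using ShM_image[of "Sh D k G" E "- k"] assms G by simp
  have 2: "Hom D (Sh D k G) E = ShM D k ` Hom D G (Sh D (- k) E)"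
    using ShM_image[of G "Sh D (- k) E" k] assms G Sh_closed by simp
  show ?thesis
    using 1 2 ShM_zero[of "Sh D k G" E "- k"] ShM_zero[of G "Sh D (- k) E" k] assms G Sh_closed
    by (metis Sh_G image_empty image_insert)
qed

lemma supp_eq: "E \<in> Obj D \<Longrightarrow> supp E = {k. Hom D G (Sh D (- k) E) \<noteq> {0}}"
  by (auto simp: supp_def Hom_Sh_trivial_iff)

lemma finite_supp:
  assumes "E \<in> Obj D" shows "finite (supp E)"
proof -
  have "finite {i. Hom D G (Sh D i E) \<noteq> {0}}"
    using finite_type G assms unfolding finite_type_def by blast
  then have "finite (uminus ` {i. Hom D G (Sh D i E) \<noteq> {0}})" by simp
  moreover have "supp E \<subseteq> uminus ` {i. Hom D G (Sh D i E) \<noteq> {0}}"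
    unfolding supp_eq[OF assms] by (force simp: image_iff)
  ultimately show ?thesis using finite_subset by blast
qed

lemma finite_dim_Hom:
  assumes "X \<in> Obj D" "Y \<in> Obj D"
  obtains B where "finite B" "Hom D X Y \<subseteq> vs.span B"
proof -
  have "finite_dim_subspace (Scale D) (Hom D X (Sh D 0 Y))"
    using finite_type assms unfolding finite_type_def by blast
  then show thesis using that Sh_0[OF assms(2)] unfolding finite_dim_subspace_def by auto
qed

lemma hdim_zero: "k \<notin> supp E \<Longrightarrow> hdim E k = 0"
  using vs.dim_le_card[of "{0}" "{}"] unfolding hdim_def supp_def by simp

lemma hdim_pos:
  assumes "E \<in> Obj D" "k \<in> supp E" shows "0 < hdim E k"
proof (rule ccontr)
  assume z: "\<not> ?thesis"
  obtain T where T: "finite T" "Hom D (Sh D k G) E \<subseteq> vs.span T"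
    using finite_dim_Hom[OF Sh_G assms(1)] .
  obtain B where B: "finite B" "Hom D (Sh D k G) E \<subseteq> vs.span B" "card B = vs.dim (Hom D (Sh D k G) E)"
    using vs.finite_basis[OF T] .
  then have "B = {}" using z unfolding hdim_def by simp
  then have "Hom D (Sh D k G) E \<subseteq> {0}" using B(2) by simp
  moreover have "0 \<in> Hom D (Sh D k G) E" using arr_zero[OF Sh_G assms(1)] unfolding arr_def by blast
  ultimately show False using assms(2) unfolding supp_def by blast
qed

lemma poinc_superset:
  assumes "finite S" "supp E \<subseteq> S"
  shows "poinc t E = (\<Sum>k\<in>S. real (hdim E k) * exp (real_of_int k * t))"
  unfolding poinc_def by (rule sum.mono_neutral_left[OF assms]) (simp add: hdim_zero)

lemma poinc_nonneg: "0 \<le> poinc t E"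
  unfolding poinc_def by (intro sum_nonneg) simp

lemma poinc_ge:
  assumes "E \<in> Obj D" "k \<in> supp E" shows "exp (real_of_int k * t) \<le> poinc t E"
proof -
  have "1 * exp (real_of_int k * t) \<le> real (hdim E k) * exp (real_of_int k * t)"
    using hdim_pos[OF assms] by (intro mult_right_mono) auto
  also have "\<dots> \<le> poinc t E"
    unfolding poinc_def using finite_supp[OF assms(1)] assms(2) by (intro member_le_sum) auto
  finally show ?thesis by simp
qed

lemma poinc_le_sum:
  assumes "\<And>k. hdim E k \<le> hdim A k + hdim C k" "A \<in> Obj D" "C \<in> Obj D" "E \<in> Obj D"
  shows "poinc t E \<le> poinc t A + poinc t C"
proof -
  let ?S = "supp E \<union> supp A \<union> supp C"
  have f: "finite ?S" using finite_supp assms by blast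
  have s: "supp E \<subseteq> ?S" "supp A \<subseteq> ?S" "supp C \<subseteq> ?S" by auto
  have "poinc t E = (\<Sum>k\<in>?S. real (hdim E k) * exp (real_of_int k * t))"
    by (rule poinc_superset[OF f]) auto
  also have "\<dots> \<le> (\<Sum>k\<in>?S. real (hdim A k + hdim C k) * exp (real_of_int k * t))"
    using assms(1) by (intro sum_mono mult_right_mono) (auto simp del: of_nat_add)
  also have "\<dots> = poinc t A + poinc t C"
    using poinc_superset[OF f s(2), of t] poinc_superset[OF f s(3), of t]
    by (simp add: sum.distrib distrib_right)
  finally show ?thesis .
qed

lemma hdim_le_kernel:
  assumes g: "arr g Y Z"
  shows "hdim Y k \<le> vs.dim {x \<in> Hom D (Sh D k G) Y. g \<cdot> x = 0} + hdim Z k"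
proof -
  note O = arr_Obj[OF g]
  obtain S where S: "finite S" "Hom D (Sh D k G) Y \<subseteq> vs.span S"
    using finite_dim_Hom[OF Sh_G O(1)] .
  obtain T where T: "finite T" "Hom D (Sh D k G) Z \<subseteq> vs.span T"
    using finite_dim_Hom[OF Sh_G O(2)] .
  show ?thesis
    unfolding hdim_def
  proof (rule vs.dim_le_kernel_plus[OF Comp_linear_right[OF Sh_G g] _ S _ T])
    show "vs.subspace (Hom D (Sh D k G) Y)" using subspace_Hom O by simp
    show "(\<lambda>x. g \<cdot> x) ` Hom D (Sh D k G) Y \<subseteq> Hom D (Sh D k G) Z"
      using g arr_Comp Sh_G unfolding arr_def by blast
  qed
qed

lemma hdim_le_injective:
  assumes g: "arr g Y Z" and inj: "\<And>x. \<lbrakk>arr x (Sh D k G) Y; g \<cdot> x = 0\<rbrakk> \<Longrightarrow> x = 0"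
  shows "hdim Y k \<le> hdim Z k"
proof -
  have "{x \<in> Hom D (Sh D k G) Y. g \<cdot> x = 0} \<subseteq> {0}"
    using inj arr_Obj(1)[OF g] unfolding arr_def by auto
  then have "vs.dim {x \<in> Hom D (Sh D k G) Y. g \<cdot> x = 0} \<le> 0"
    using vs.dim_le_card[of _ "{}"] by force
  then show ?thesis using hdim_le_kernel[OF g, of k] by simp
qed

text \<open>Exactness at the middle term: the kernel of composition with \<open>g\<close> is
  contained in the image of \<open>Hom(G[k], X)\<close>, and what remains maps injectively to
  \<open>Hom(G[k], Z)\<close>.\<close>

lemma hdim_triangle:
  assumes t: "Tri D X Y Z f g h"
  shows "hdim Y k \<le> hdim X k + hdim Z k"
proof -
  note a = Tri_arr[OF t]
  have O: "X \<in> Obj D" "Y \<in> Obj D" using arr_Obj[OF a(1)] by simp_all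
  obtain S where S: "finite S" "Hom D (Sh D k G) X \<subseteq> vs.span S"
    using finite_dim_Hom[OF Sh_G O(1)] .
  obtain T where T: "finite T" "Hom D (Sh D k G) Y \<subseteq> vs.span T"
    using finite_dim_Hom[OF Sh_G O(2)] .
  have "{x \<in> Hom D (Sh D k G) Y. g \<cdot> x = 0} \<subseteq> (\<lambda>x. f \<cdot> x) ` Hom D (Sh D k G) X"
    using Tri_lift[OF t, of _ "Sh D k G"] O unfolding arr_def by auto
  moreover have fim: "(\<lambda>x. f \<cdot> x) ` Hom D (Sh D k G) X \<subseteq> Hom D (Sh D k G) Y"
    using a(1) arr_Comp Sh_G unfolding arr_def by blast
  ultimately have "vs.dim {x \<in> Hom D (Sh D k G) Y. g \<cdot> x = 0} \<le> vs.dim ((\<lambda>x. f \<cdot> x) ` Hom D (Sh D k G) X)"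
    using T by (intro vs.dim_mono_finite[of _ _ T]) auto
  also have "\<dots> \<le> hdim X k"
    unfolding hdim_def using subspace_Hom O S
    by (intro vs.dim_image_le_finite[OF Comp_linear_right[OF Sh_G a(1)], where T = S]) auto
  finally show ?thesis using hdim_le_kernel[OF a(2), of k] by simp
qed

lemma hdim_Sh:
  assumes "E \<in> Obj D" shows "hdim (Sh D n E) k = hdim E (k - n)"
proof -
  have le: "hdim (Sh D n E) k \<le> hdim E (k - n)" if E: "E \<in> Obj D" for E n k
  proof -
    have im: "Hom D (Sh D k G) (Sh D n E) = ShM D n ` Hom D (Sh D (k - n) G) E"
      using ShM_image[of "Sh D (k - n) G" E n] E Sh_add[OF G, of n "k - n"] by simp
    obtain S where S: "finite S" "Hom D (Sh D (k - n) G) E \<subseteq> vs.span S"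
      using finite_dim_Hom[OF Sh_G E] .
    show ?thesis
      unfolding hdim_def im using E subspace_Hom S
      by (intro vs.dim_image_le_finite[OF ShM_linear, where T = S]) auto
  qed
  \<comment> \<open>The same estimate for the inverse shift supplies the reverse inequality.\<close>
  have "hdim E (k - n) = hdim (Sh D (- n) (Sh D n E)) (k - n)" using assms by simp
  also have "\<dots> \<le> hdim (Sh D n E) (k - n - (- n))" using le Sh_closed[OF assms] by blast
  finally show ?thesis using le[OF assms, of n k] by simp
qed

lemma supp_iff: "E \<in> Obj D \<Longrightarrow> k \<in> supp E \<longleftrightarrow> hdim E k \<noteq> 0"
  using hdim_pos hdim_zero by fastforce

lemma supp_Sh: "E \<in> Obj D \<Longrightarrow> supp (Sh D n E) = (\<lambda>k. k + n) ` supp E"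
  by (auto simp: supp_iff hdim_Sh Sh_closed image_iff intro!: bexI[of _ "_ - n"])

lemma poinc_Sh:
  assumes "E \<in> Obj D" shows "poinc t (Sh D n E) = exp (real_of_int n * t) * poinc t E"
  unfolding poinc_def supp_Sh[OF assms]
  by (subst sum.reindex)
     (auto simp: inj_on_def hdim_Sh assms sum_distrib_left distrib_right exp_add intro!: sum.cong)

lemma poinc_mono:
  assumes le: "\<And>k. hdim E k \<le> hdim B k" and O: "E \<in> Obj D" "B \<in> Obj D"
  shows "poinc t E \<le> poinc t B" and "supp E \<subseteq> supp B"
proof -
  show s: "supp E \<subseteq> supp B"
  proof
    fix k assume "k \<in> supp E"
    then show "k \<in> supp B" using le[of k] O by (simp add: supp_iff)
  qed
  have "poinc t E = (\<Sum>k\<in>supp B. real (hdim E k) * exp (real_of_int k * t))"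
    by (rule poinc_superset[OF finite_supp[OF O(2)] s])
  also have "\<dots> \<le> poinc t B"
    unfolding poinc_def using le by (intro sum_mono mult_right_mono) auto
  finally show "poinc t E \<le> poinc t B" .
qed

lemma poinc_retract:
  assumes "is_retract E B" shows "poinc t E \<le> poinc t B" and "supp E \<subseteq> supp B"
proof -
  obtain i p where ip: "arr i E B" "arr p B E" "p \<cdot> i = Ident D E"
    using assms unfolding is_retract_def by blast
  note O = arr_Obj[OF ip(1)]
  have le: "hdim E k \<le> hdim B k" for k
  proof (rule hdim_le_injective[OF ip(1)])
    fix x assume x: "arr x (Sh D k G) E" "i \<cdot> x = 0"
    have "x = (p \<cdot> i) \<cdot> x" using ip(3) id_left[OF x(1)] by simp
    also have "\<dots> = p \<cdot> (i \<cdot> x)" using assoc[OF ip(2,1) x(1)] .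
    finally show "x = 0" using x(2) Comp_0_right[OF ip(2), of "Sh D k G"] by simp
  qed
  show "poinc t E \<le> poinc t B" "supp E \<subseteq> supp B" using poinc_mono[OF le O] .
qed

text \<open>Subadditivity of dimensions, one cone at a time. The filtering object \<open>E\<close>
  is arbitrary because the lemma is applied both to \<open>G\<close> and to the iterates of
  \<open>F\<close> on \<open>G\<close>.\<close>

lemma poinc_filt:
  assumes E: "E \<in> Obj D" and B: "filt E ns B"
  shows "poinc t B \<le> weight t ns * poinc t E"
    and "k \<in> supp B \<Longrightarrow> \<exists>n\<in>set ns. k - n \<in> supp E"
proof -
  have "poinc t B \<le> weight t ns * poinc t E
    \<and> (\<forall>k\<in>supp B. \<exists>n\<in>set ns. k - n \<in> supp E)"
    using B
  proof (induct rule: filt.induct)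
    case (filt_zero Z)
    have "supp Z = {}" using filt_zero unfolding supp_def is_zero_def by (simp add: Sh_G)
    then show ?case by (simp add: poinc_def)
  next
    case (filt_cone ns A B n)
    note O = tri_Obj[OF filt_cone(3)]
    obtain f g h where t: "Tri D A B (Sh D n E) f g h" using filt_cone(3) unfolding tri_def by blast
    have le: "hdim B k \<le> hdim A k + hdim (Sh D n E) k" for k using hdim_triangle[OF t] .
    have "poinc t B \<le> poinc t A + poinc t (Sh D n E)"
      using poinc_le_sum[OF le] O by blast
    then have 1: "poinc t B \<le> weight t (n # ns) * poinc t E"
      using filt_cone(2) poinc_Sh[OF E] by (simp add: algebra_simps)
    have 2: "\<exists>m\<in>set (n # ns). k - m \<in> supp E" if "k \<in> supp B" for k
    proof (cases "k \<in> supp A")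
      case True
      then show ?thesis using filt_cone(2) by auto
    next
      case False
      then have "hdim (Sh D n E) k \<noteq> 0" using that le[of k] O by (simp add: supp_iff)
      then show ?thesis using hdim_Sh[OF E] supp_iff[OF E] by auto
    qed
    show ?case using 1 2 by blast
  qed
  then show "poinc t B \<le> weight t ns * poinc t E"
    and "k \<in> supp B \<Longrightarrow> \<exists>n\<in>set ns. k - n \<in> supp E" by blast+
qed

section \<open>Killing generators\<close>

text \<open>Bases of the finitely many nonzero spaces \<open>Hom(G[k], E)\<close>, tagged with their
  degrees and concatenated. A list is convenient because the generators are killed one after the
  other and each contributes one weight.\<close>

lemma generators:
  assumes E: "E \<in> Obj D"
  shows "\<exists>xs. (\<forall>(n, x)\<in>set xs. n \<in> supp E \<and> arr x (Sh D n G) E)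
    \<and> (\<forall>t. (\<Sum>(n, x)\<leftarrow>xs. exp (real_of_int n * t)) = poinc t E)
    \<and> (\<forall>n. Hom D (Sh D n G) E \<subseteq> vs.span {x. (n, x) \<in> set xs})"
proof -
  have "\<exists>l. set l \<subseteq> Hom D (Sh D k G) E \<and> Hom D (Sh D k G) E \<subseteq> vs.span (set l) \<and> length l = hdim E k" for k
  proof -
    obtain T where T: "finite T" "Hom D (Sh D k G) E \<subseteq> vs.span T"
      using finite_dim_Hom[OF Sh_G E] .
    obtain B where B: "finite B" "B \<subseteq> Hom D (Sh D k G) E" "Hom D (Sh D k G) E \<subseteq> vs.span B"
        "card B = vs.dim (Hom D (Sh D k G) E)"
      using vs.finite_basis[OF T] .
    obtain l where "set l = B" "distinct l" using finite_distinct_list[OF B(1)] by blast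
    then show ?thesis using B distinct_card unfolding hdim_def by fastforce
  qed
  then obtain L where L: "\<And>k. set (L k) \<subseteq> Hom D (Sh D k G) E"
      "\<And>k. Hom D (Sh D k G) E \<subseteq> vs.span (set (L k))" "\<And>k. length (L k) = hdim E k"
    by metis
  obtain ks where ks: "set ks = supp E" "distinct ks"
    using finite_distinct_list[OF finite_supp[OF E]] by blast
  define xs where "xs = concat (map (\<lambda>k. map (Pair k) (L k)) ks)"
  have mem: "(n, x) \<in> set xs \<longleftrightarrow> n \<in> supp E \<and> x \<in> set (L n)" for n x
    unfolding xs_def using ks by auto
  have "(\<Sum>(n, x)\<leftarrow>xs. exp (real_of_int n * t)) = poinc t E" for t
  proof -
    have "(\<Sum>(n, x)\<leftarrow>concat (map (\<lambda>k. map (Pair k) (L k)) ks'). exp (real_of_int n * t))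
        = (\<Sum>k\<leftarrow>ks'. real (hdim E k) * exp (real_of_int k * t))" for ks'
      by (induct ks') (simp_all add: o_def sum_list_triv L(3))
    then show ?thesis
      unfolding xs_def poinc_def using ks by (simp add: sum_list_distinct_conv_sum_set)
  qed
  moreover have "Hom D (Sh D n G) E \<subseteq> vs.span {x. (n, x) \<in> set xs}" for n
  proof (cases "n \<in> supp E")
    case True
    then show ?thesis using L(2)[of n] by (simp add: mem)
  next
    case False
    then show ?thesis unfolding supp_def using vs.span_zero by auto
  qed
  moreover have "\<forall>(n, x)\<in>set xs. n \<in> supp E \<and> arr x (Sh D n G) E"
    using mem L(1) E unfolding arr_def by auto
  ultimately show ?thesis by blast
qed

text \<open>Two triangles are carried along. The one over \<open>E0\<close> continues the resolution
  already begun; the one over \<open>E\<close> has a cone \<open>C2\<close> made of the new cells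
  alone, and it is \<open>C2\<close> that later bounds the size of \<open>E'\<close>.\<close>

lemma kill_generators:
  assumes "Tri D E0 E C f g h" "filt G ns C" "\<forall>(n, x)\<in>set xs. arr x (Sh D n G) E"
  shows "\<exists>E' a C1 g1 h1 C2 g2 h2.
     Tri D E0 E' C1 (a \<cdot> f) g1 h1 \<and> filt G (map (\<lambda>(n, x). n + 1) xs @ ns) C1 \<and>
     Tri D E E' C2 a g2 h2 \<and> filt G (map (\<lambda>(n, x). n + 1) xs) C2 \<and>
     (\<forall>(n, x)\<in>set xs. a \<cdot> x = 0)"
  using assms(3)
proof (induct xs)
  case Nil
  note a = Tri_arr[OF assms(1)]
  obtain N where N: "is_zero D N" using zero_exists by blast
  have "Tri D E E N (Ident D E) 0 0" using TR1_Ident[OF _ N] arr_Obj[OF a(1)] by blast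
  moreover have "Tri D E0 E C (Ident D E \<cdot> f) g h" using assms(1) id_left[OF a(1)] by simp
  ultimately show ?case using assms(2) filt_zero[OF N, of G]
    unfolding list.map append_Nil list.set by blast
next
  case (Cons p xs)
  obtain n x where p: "p = (n, x)" by (cases p)
  have x: "arr x (Sh D n G) E" using Cons(2) p by simp
  obtain E' a C1 g1 h1 C2 g2 h2 where IH:
     "Tri D E0 E' C1 (a \<cdot> f) g1 h1" "filt G (map (\<lambda>(n, x). n + 1) xs @ ns) C1"
     "Tri D E E' C2 a g2 h2" "filt G (map (\<lambda>(n, x). n + 1) xs) C2"
     "\<forall>(n, x)\<in>set xs. a \<cdot> x = 0"
    using Cons(1) Cons(2) by auto
  have aa: "arr a E E'" using Tri_arr[OF IH(3)] by blast
  have fa: "arr f E0 E" using Tri_arr[OF assms(1)] by blast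
  \<comment> \<open>The earlier cones have replaced \<open>E\<close> by \<open>E'\<close>, so the
    next generator is pushed forward along \<open>a\<close> before it is killed.\<close>
  have y: "arr (a \<cdot> x) (Sh D n G) E'" using arr_Comp[OF aa x] .
  then obtain E'' b c where t: "Tri D (Sh D n G) E' E'' (a \<cdot> x) b c"
    using TR1_cone unfolding arr_def by blast
  have ba: "arr b E' E''" using Tri_arr[OF t] by blast
  have "b \<cdot> (a \<cdot> f) = (b \<cdot> a) \<cdot> f" using assoc[OF ba aa fa] by simp
  then obtain C1' g1' h1' where
    "Tri D E0 E'' C1' ((b \<cdot> a) \<cdot> f) g1' h1'" "filt G ((n + 1) # map (\<lambda>(n, x). n + 1) xs @ ns) C1'"
    using cone_step[OF IH(1,2) t G] by auto
  moreover obtain C2' g2' h2' where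
    "Tri D E E'' C2' (b \<cdot> a) g2' h2'" "filt G ((n + 1) # map (\<lambda>(n, x). n + 1) xs) C2'"
    using cone_step[OF IH(3,4) t G] by blast
  moreover have "(b \<cdot> a) \<cdot> x = 0"
    using Tri_Comp_zero[OF t] assoc[OF ba aa x] by simp
  moreover have "(b \<cdot> a) \<cdot> z = 0" if "(m, z) \<in> set xs" for m z
  proof -
    have z: "arr z (Sh D m G) E" "a \<cdot> z = 0" using that Cons(2) IH(5) by auto
    have "(b \<cdot> a) \<cdot> z = b \<cdot> (a \<cdot> z)" using assoc[OF ba aa z(1)] .
    then show ?thesis using z(2) Comp_0_right[OF ba Sh_G] by simp
  qed
  ultimately show ?case using p by fastforce
qed

end

context generated_category
begin

lemma ghostI:
  assumes a: "arr a E E'" and gen: "\<And>n. Hom D (Sh D n G) E \<subseteq> vs.span {x. (n, x) \<in> set xs}"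
    and xs: "\<forall>(n, x)\<in>set xs. arr x (Sh D n G) E" and kill: "\<forall>(n, x)\<in>set xs. a \<cdot> x = 0"
  shows "ghost G E E' a"
  unfolding ghost_def
proof (intro conjI allI impI)
  fix n x assume x: "arr x (Sh D n G) E"
  let ?S = "{x. (n, x) \<in> set xs}"
  have "a \<cdot> x \<in> vs.span ((\<lambda>x. a \<cdot> x) ` ?S)"
  proof (rule vs.linear_map_on_span[OF Comp_linear_right[OF Sh_G a]])
    show "vs.subspace (Hom D (Sh D n G) E)" using subspace_Hom arr_Obj[OF a] by simp
    show "?S \<subseteq> Hom D (Sh D n G) E" using xs unfolding arr_def by auto
    show "x \<in> vs.span ?S" using x gen unfolding arr_def by blast
  qed
  also have "\<dots> \<subseteq> vs.span {0}" using kill by (intro vs.span_mono) auto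
  finally show "a \<cdot> x = 0" by simp
qed (rule a)

text \<open>Composition with \<open>g\<close> is injective on \<open>Hom(G[k], E')\<close>: by
  exactness an element of its kernel factors through the ghost \<open>a\<close>, hence
  vanishes.\<close>

lemma poinc_ghost:
  assumes t: "Tri D E E' C a g h" and a: "ghost G E E' a"
  shows "poinc t E' \<le> poinc t C" and "supp E' \<subseteq> supp C"
proof -
  note ar = Tri_arr[OF t]
  have O: "E' \<in> Obj D" "C \<in> Obj D" using arr_Obj[OF ar(2)] by simp_all
  have le: "hdim E' k \<le> hdim C k" for k
  proof (rule hdim_le_injective[OF ar(2)])
    fix x assume x: "arr x (Sh D k G) E'" "g \<cdot> x = 0"
    then obtain y where "arr y (Sh D k G) E" "x = a \<cdot> y" using Tri_lift[OF t] by blast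
    then show "x = 0" using a unfolding ghost_def by blast
  qed
  show "poinc t E' \<le> poinc t C" "supp E' \<subseteq> supp C" using poinc_mono[OF le O] .
qed

section \<open>Resolutions with uniform bounds\<close>

text \<open>The state after \<open>j\<close> rounds. Besides the cone, the current target
  \<open>E'\<close> is bounded as well, because its generators become the cells of the next
  round.\<close>

definition resolution :: "nat \<Rightarrow> (real \<Rightarrow> real) \<Rightarrow> int \<Rightarrow> 'o \<Rightarrow> bool" where
  "resolution j c K E \<longleftrightarrow> (\<exists>E' f C g h ns. Tri D E E' C f g h \<and> filt G ns C \<and> ghosts G j E E' f
     \<and> (\<forall>t. weight t ns \<le> c t * poinc t E)
     \<and> (\<forall>t. poinc t E' \<le> c t * poinc t E)
     \<and> (\<forall>n\<in>set ns. \<exists>k\<in>supp E. \<bar>n - k\<bar> \<le> K)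
     \<and> (\<forall>n\<in>supp E'. \<exists>k\<in>supp E. \<bar>n - k\<bar> \<le> K))"

text \<open>The new cells sit one degree above generators of \<open>Hom(G[n], E1)\<close>, so their
  weight is \<open>exp t * poinc t E1\<close>; with the old cells this needs the factor
  \<open>1 + exp t\<close>. The new target is no larger than the cone of the new cells, which needs
  \<open>exp t * poinc t G\<close>. The factor is the sum of both. New cells move by one degree, and
  the support of their cone by at most \<open>M\<close> more, whence
  \<open>K + M + 1\<close>.\<close>

lemma resolution_step:
  assumes E: "E \<in> Obj D" and r: "resolution j c K E" and c: "\<And>t. 0 \<le> c t"
    and M: "\<forall>k\<in>supp G. \<bar>k\<bar> \<le> M" and M0: "0 \<le> M"
  shows "resolution (Suc j) (\<lambda>t. c t * (1 + exp t + exp t * poinc t G)) (K + M + 1) E"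
proof -
  obtain E1 f C g h ns where 1: "Tri D E E1 C f g h" "filt G ns C" "ghosts G j E E1 f"
     "\<And>t. weight t ns \<le> c t * poinc t E"
     "\<And>t. poinc t E1 \<le> c t * poinc t E"
     "\<And>n. n\<in>set ns \<Longrightarrow> \<exists>k\<in>supp E. \<bar>n - k\<bar> \<le> K"
     "\<And>n. n\<in>supp E1 \<Longrightarrow> \<exists>k\<in>supp E. \<bar>n - k\<bar> \<le> K"
    using r unfolding resolution_def by blast
  have E1: "E1 \<in> Obj D" using ghosts_arr[OF 1(3)] arr_Obj by blast
  obtain xs where xs: "\<forall>(n, x)\<in>set xs. n \<in> supp E1 \<and> arr x (Sh D n G) E1"
      "\<And>t. (\<Sum>(n, x)\<leftarrow>xs. exp (real_of_int n * t)) = poinc t E1"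
      "\<And>n. Hom D (Sh D n G) E1 \<subseteq> vs.span {x. (n, x) \<in> set xs}"
    using generators[OF E1] by blast
  have xs': "\<forall>(n, x)\<in>set xs. arr x (Sh D n G) E1" using xs(1) by auto
  define ms where "ms = map (\<lambda>(n, x). n + 1) xs"
  obtain E2 a C1 g1 h1 C2 g2 h2 where 2:
     "Tri D E E2 C1 (a \<cdot> f) g1 h1" "filt G (ms @ ns) C1"
     "Tri D E1 E2 C2 a g2 h2" "filt G ms C2" "\<forall>(n, x)\<in>set xs. a \<cdot> x = 0"
    using kill_generators[OF 1(1,2) xs'] unfolding ms_def by blast
  have a: "ghost G E1 E2 a" using ghostI[OF Tri_arr(1)[OF 2(3)] xs(3) xs' 2(5)] .
  have sum_ms: "weight t ms = exp t * poinc t E1" for t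
    unfolding ms_def xs(2)[symmetric]
    by (induct xs) (auto simp: distrib_right distrib_left exp_add algebra_simps)
  have ms: "\<exists>k\<in>supp E. \<bar>n - k\<bar> \<le> K + 1" if n: "n \<in> set ms" for n
  proof -
    obtain m where "m \<in> supp E1" "n = m + 1" using n xs(1) unfolding ms_def by auto
    moreover obtain k where "k \<in> supp E" "\<bar>m - k\<bar> \<le> K" using 1(7) calculation by blast
    ultimately show ?thesis by (intro bexI[of _ k]) auto
  qed
  have P0: "0 \<le> poinc t G" "0 \<le> poinc t E" "0 \<le> c t" for t using poinc_nonneg c by auto
  have s1: "weight t (ms @ ns) \<le> c t * (1 + exp t + exp t * poinc t G) * poinc t E" for t
  proof -
    have "weight t (ms @ ns) \<le> exp t * (c t * poinc t E) + c t * poinc t E"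
      using 1(4,5)[of t] by (simp add: sum_ms mult_left_mono add_mono)
    also have "\<dots> \<le> exp t * (c t * poinc t E) + c t * poinc t E + exp t * poinc t G * (c t * poinc t E)"
      using P0[of t] by simp
    finally show ?thesis by (simp add: algebra_simps)
  qed
  have s2: "poinc t E2 \<le> c t * (1 + exp t + exp t * poinc t G) * poinc t E" for t
  proof -
    have "poinc t E2 \<le> poinc t C2" using poinc_ghost(1)[OF 2(3) a] .
    also have "\<dots> \<le> weight t ms * poinc t G"
      using poinc_filt(1)[OF G 2(4)] .
    also have "\<dots> \<le> exp t * (c t * poinc t E) * poinc t G"
      unfolding sum_ms using 1(5) P0 by (intro mult_right_mono mult_left_mono) auto
    also have "\<dots> \<le> exp t * (c t * poinc t E) * poinc t G + (c t * poinc t E + exp t * (c t * poinc t E))"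
      using P0[of t] by simp
    finally show ?thesis by (simp add: algebra_simps)
  qed
  have s3: "\<exists>k\<in>supp E. \<bar>n - k\<bar> \<le> K + M + 1" if "n \<in> set (ms @ ns)" for n
  proof -
    have "\<exists>k\<in>supp E. \<bar>n - k\<bar> \<le> K + 1 \<or> \<bar>n - k\<bar> \<le> K"
      using that ms[of n] 1(6)[of n] by auto
    then obtain k where "k \<in> supp E" "\<bar>n - k\<bar> \<le> K + 1 \<or> \<bar>n - k\<bar> \<le> K" by blast
    then show ?thesis using M0 by (intro bexI[of _ k]) auto
  qed
  have s4: "\<exists>k\<in>supp E. \<bar>n - k\<bar> \<le> K + M + 1" if n: "n \<in> supp E2" for n
  proof -
    have "n \<in> supp C2" using n poinc_ghost(2)[OF 2(3) a] by blast
    then obtain m where m: "m \<in> set ms" "n - m \<in> supp G" using poinc_filt(2)[OF G 2(4)] by blast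
    then have "\<bar>n - m\<bar> \<le> M" using M by blast
    moreover obtain k where "k \<in> supp E" "\<bar>m - k\<bar> \<le> K + 1" using ms m by blast
    ultimately show ?thesis by (intro bexI[of _ k]) auto
  qed
  have "ghosts G (Suc j) E E2 (a \<cdot> f)" using chain_Suc[OF 1(3), OF a] .
  then show ?thesis
    unfolding resolution_def using 2(1,2) s1 s2 s3 s4 by blast
qed

lemma resolution_exists:
  "\<exists>c K. (\<forall>t. 0 < c t) \<and> (\<forall>E\<in>Obj D. resolution j c K E)"
proof (induct j)
  case 0
  obtain N where N: "is_zero D N" using zero_exists by blast
  have "resolution 0 (\<lambda>t. 1) 0 E" if E: "E \<in> Obj D" for E
  proof -
    have "ghosts G 0 E E (Ident D E)" using chain_0[OF E] .
    moreover have "\<forall>n\<in>supp E. \<exists>k\<in>supp E. \<bar>n - k\<bar> \<le> 0" by force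
    ultimately show ?thesis
      unfolding resolution_def
      using TR1_Ident[OF E N] filt_zero[OF N, of G] poinc_nonneg
      by (intro exI[of _ E] exI[of _ "Ident D E"] exI[of _ N] exI[of _ 0] exI[of _ "[]"]) simp
  qed
  then show ?case by (intro exI[of _ "\<lambda>t. 1"] exI[of _ 0]) auto
next
  case (Suc j)
  then obtain c K where cK: "\<And>t. 0 < c t" "\<And>E. E \<in> Obj D \<Longrightarrow> resolution j c K E" by blast
  have fin: "finite (abs ` supp G)" using finite_supp[OF G] by simp
  \<comment> \<open>Inserting \<open>0\<close> makes the maximum exist and be nonnegative even for
    an empty support.\<close>
  define M where "M = Max (insert 0 (abs ` supp G))"
  have M: "\<forall>k\<in>supp G. \<bar>k\<bar> \<le> M" "0 \<le> M"
    unfolding M_def using fin by (auto intro!: Max_ge)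
  have "0 < c t * (1 + exp t + exp t * poinc t G)" for t
    using cK(1)[of t] poinc_nonneg[of t G] by (simp add: add_pos_nonneg)
  moreover have "0 \<le> c t" for t using cK(1)[of t] by simp
  ultimately show ?case
    using resolution_step[OF _ cK(2) _ M]
    by (intro exI[of _ "\<lambda>t. c t * (1 + exp t + exp t * poinc t G)"] exI[of _ "K + M + 1"]) blast
qed

text \<open>After \<open>J\<close> rounds the map out of \<open>E\<close> is zero, so
  \<open>E\<close> is a retract of the cone shifted by \<open>-1\<close>. That shift accounts for
  the factor \<open>exp (- t)\<close> and for replacing \<open>K\<close> by
  \<open>K + 1\<close>.\<close>

lemma uniform_filtration:
  assumes ghosts: "\<And>X Y f. ghosts G J X Y f \<Longrightarrow> f = 0"
  shows "\<exists>c K. (\<forall>t. 0 < c t) \<and> (\<forall>E\<in>Obj D. \<exists>ns B. filt G ns B \<and> is_retract E B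
     \<and> (\<forall>t. weight t ns \<le> c t * poinc t E)
     \<and> (\<forall>n\<in>set ns. \<exists>k\<in>supp E. \<bar>n - k\<bar> \<le> K))"
proof -
  obtain c K where cK: "\<And>t. 0 < c t" "\<And>E. E \<in> Obj D \<Longrightarrow> resolution J c K E"
    using resolution_exists by blast
  define c' where "c' t = exp (- t) * c t" for t
  have "\<exists>ns B. filt G ns B \<and> is_retract E B
     \<and> (\<forall>t. weight t ns \<le> c' t * poinc t E)
     \<and> (\<forall>n\<in>set ns. \<exists>k\<in>supp E. \<bar>n - k\<bar> \<le> K + 1)" if E: "E \<in> Obj D" for E
  proof -
    obtain E' f C g h ns where 1: "Tri D E E' C f g h" "filt G ns C" "ghosts G J E E' f"
     "\<And>t. weight t ns \<le> c t * poinc t E"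
     "\<And>n. n\<in>set ns \<Longrightarrow> \<exists>k\<in>supp E. \<bar>n - k\<bar> \<le> K"
      using cK(2)[OF E] unfolding resolution_def by blast
    have "f = 0" using ghosts 1(3) by blast
    then have r: "is_retract E (Sh D (-1) C)" using Tri_zero_retract 1(1) by blast
    have "(\<Sum>n\<leftarrow>map (\<lambda>n. -1 + n) ns. exp (real_of_int n * t)) = exp (- t) * weight t ns" for t
      by (induct ns) (auto simp: left_diff_distrib exp_diff exp_minus field_simps)
    then have "(\<Sum>n\<leftarrow>map (\<lambda>n. -1 + n) ns. exp (real_of_int n * t)) \<le> c' t * poinc t E" for t
      using 1(4)[of t] by (simp add: c'_def mult.assoc)
    moreover have "\<exists>k\<in>supp E. \<bar>n - k\<bar> \<le> K + 1" if n: "n \<in> set (map (\<lambda>n. -1 + n) ns)" for n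
    proof -
      obtain k where "k \<in> supp E" "\<bar>n + 1 - k\<bar> \<le> K" using n 1(5) by fastforce
      then show ?thesis by (intro bexI[of _ k]) auto
    qed
    ultimately show ?thesis using r filt_shift[OF G 1(2), of "-1"] by blast
  qed
  moreover have "0 < c' t" for t using cK(1) by (simp add: c'_def)
  ultimately show ?thesis by blast
qed

end

section \<open>Complexes of vector spaces\<close>

lemma linear_map_on_diff:
  assumes "linear_map_on s1 s2 V f" "x - y \<in> V" "y \<in> V" shows "f (x - y) = f x - f y"
proof -
  have "f ((x - y) + y) = f (x - y) + f y" using assms unfolding linear_map_on_def by blast
  then show ?thesis by (simp add: algebra_simps)
qed

context vector_space
begin

lemma linear_map_on_sum:
  assumes lin: "linear_map_on scale s V f" and V: "subspace V" and x: "\<And>i. i \<in> S \<Longrightarrow> x i \<in> V"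
  shows "f (\<Sum>i\<in>S. x i) = (\<Sum>i\<in>S. f (x i))"
  using x
proof (induct S rule: infinite_finite_induct)
  case (insert i S)
  then have "(\<Sum>i\<in>S. x i) \<in> V" using V by (intro subspace_sum) auto
  then have "f (x i + (\<Sum>i\<in>S. x i)) = f (x i) + f (\<Sum>i\<in>S. x i)"
    using lin insert(4)[of i] unfolding linear_map_on_def by blast
  then show ?case using insert by simp
qed (use linear_map_on_0[OF lin subspace_0[OF V]] in auto)

section \<open>Bases adapted to direct sums and to differentials\<close>

text \<open>Group a vanishing combination by index. Each group lies in one \<open>V i\<close>, so it
  vanishes by directness of the sum, and then its coefficients vanish by independence of
  \<open>T i\<close>.\<close>

lemma independent_Union_family:
  assumes fam: "independent_family I V" and V: "\<And>i. i \<in> I \<Longrightarrow> subspace (V i)"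
    and T: "\<And>i. i \<in> I \<Longrightarrow> T i \<subseteq> V i" "\<And>i. i \<in> I \<Longrightarrow> independent (T i)"
  shows "independent (\<Union>i\<in>I. T i)"
  unfolding independent_explicit_module
proof (intro allI impI)
  fix t u v assume t: "finite t" "t \<subseteq> (\<Union>i\<in>I. T i)" and 0: "(\<Sum>v\<in>t. scale (u v) v) = 0" and v: "v \<in> t"
  have "\<forall>w\<in>t. \<exists>i\<in>I. w \<in> T i" using t(2) by blast
  then obtain idx where idx: "\<And>w. w \<in> t \<Longrightarrow> idx w \<in> I \<and> w \<in> T (idx w)" by metis
  define x where "x i = (\<Sum>w\<in>{w \<in> t. idx w = i}. scale (u w) w)" for i
  have xV: "x i \<in> V i" if "i \<in> idx ` t" for i
    unfolding x_def
  proof (rule subspace_sum)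
    show "subspace (V i)" using that idx V by blast
    fix w assume "w \<in> {w \<in> t. idx w = i}"
    then show "scale (u w) w \<in> V i" using idx T(1) V subspace_scale by blast
  qed
  have "(\<Sum>i\<in>idx ` t. x i) = (\<Sum>w\<in>t. scale (u w) w)"
    unfolding x_def using t(1) by (rule sum.image_gen[symmetric])
  then have "finite (idx ` t) \<and> idx ` t \<subseteq> I \<and> (\<forall>i\<in>idx ` t. x i \<in> V i) \<and> (\<Sum>i\<in>idx ` t. x i) = 0"
    using xV t(1) idx 0 by auto
  then have "\<forall>i\<in>idx ` t. x i = 0"
    using fam unfolding independent_family_def by blast
  then have "(\<Sum>w\<in>{w \<in> t. idx w = idx v}. scale (u w) w) = 0" using v unfolding x_def by blast
  then show "u v = 0"
    using independentD[of "T (idx v)" "{w \<in> t. idx w = idx v}" u v] T(2) t(1) idx v by force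
qed

lemma independent_Un_disjoint:
  assumes S: "independent S" and T: "independent T" and ST: "\<And>x. \<lbrakk>x \<in> span S; x \<in> span T\<rbrakk> \<Longrightarrow> x = 0"
  shows "independent (S \<union> T)"
  unfolding independent_explicit_module
proof (intro allI impI)
  fix t u v assume t: "finite t" "t \<subseteq> S \<union> T" and 0: "(\<Sum>v\<in>t. scale (u v) v) = 0" and v: "v \<in> t"
  let ?x = "\<Sum>v\<in>t \<inter> S. scale (u v) v" and ?y = "\<Sum>v\<in>t - S. scale (u v) v"
  have xy: "?x + ?y = 0" using sum.Int_Diff[OF t(1), of "\<lambda>v. scale (u v) v" S] 0 by simp
  have x: "?x \<in> span S" by (intro span_sum span_scale span_base) auto
  have y: "?y \<in> span T" using t(2) by (intro span_sum span_scale span_base) auto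
  have "?x = - ?y" using xy by (simp add: eq_neg_iff_add_eq_0)
  then have "?x \<in> span T" using span_neg[OF y] by simp
  then have x0: "?x = 0" using ST x by blast
  then have y0: "?y = 0" using xy by simp
  show "u v = 0"
  proof (cases "v \<in> S")
    case True
    then show ?thesis using independentD[OF S _ _ x0] t(1) v by blast
  next
    case False
    then show ?thesis using independentD[OF T _ _ y0] t v by blast
  qed
qed

text \<open>Coordinates with respect to \<open>B\<close> are unique, so those of \<open>x\<close>
  are supported both in \<open>S\<close> and in \<open>T\<close>.\<close>

lemma independent_span_disjoint:
  assumes B: "independent B" and S: "S \<subseteq> B" "T \<subseteq> B" "S \<inter> T = {}" and x: "x \<in> span S" "x \<in> span T"
  shows "x = 0"
proof -
  have "representation B x = representation S x" "representation B x = representation T x"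
    using representation_extend[OF B x(1) S(1)] representation_extend[OF B x(2) S(2)] by simp_all
  then have "representation B x v = 0" for v
    using representation_ne_zero[of S x v] representation_ne_zero[of T x v] S(3) by auto
  moreover have "x \<in> span B" using x S(1) span_mono by blast
  ultimately show ?thesis using sum_nonzero_representation_eq[OF B, of x] by simp
qed

text \<open>Over a field every complex splits: \<open>K a\<close> spans a complement of the
  cocycles, on which \<open>d\<close> is injective, the image of \<open>K (a - 1)\<close> spans the
  coboundaries, and \<open>H a\<close> represents the cohomology.\<close>

lemma adapted_basis:
  fixes C :: "int \<Rightarrow> 'b set"
  assumes C: "\<And>a. subspace (C a)" and lin: "\<And>a. linear_map_on scale scale (C a) d"
    and d: "\<And>a x. x \<in> C a \<Longrightarrow> d x \<in> C (a + 1)" and dd: "\<And>a x. x \<in> C a \<Longrightarrow> d (d x) = 0"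
  obtains K H where "\<And>a. K a \<subseteq> C a" "\<And>a. H a \<subseteq> C a" "\<And>a x. x \<in> H a \<Longrightarrow> d x = 0"
    "\<And>a. inj_on d (K a)" "\<And>a. H a \<inter> K a = {}" "\<And>a. d ` K (a - 1) \<inter> (H a \<union> K a) = {}"
    "\<And>a. independent (K a \<union> H a \<union> d ` K (a - 1))" "\<And>a. C a \<subseteq> span (K a \<union> H a \<union> d ` K (a - 1))"
proof -
  define Z where "Z a = {x \<in> C a. d x = 0}" for a
  have Zs: "subspace (Z a)" for a
    unfolding Z_def subspace_def
  proof (intro conjI ballI allI)
    show "0 \<in> {x \<in> C a. d x = 0}" using linear_map_on_0[OF lin] subspace_0[OF C] by blast
    show "x + y \<in> {x \<in> C a. d x = 0}" if "x \<in> {x \<in> C a. d x = 0}" "y \<in> {x \<in> C a. d x = 0}" for x y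
      using that lin[of a] subspace_add[OF C] unfolding linear_map_on_def by simp
    show "scale c x \<in> {x \<in> C a. d x = 0}" if "x \<in> {x \<in> C a. d x = 0}" for c x
      using that lin[of a] subspace_scale[OF C] unfolding linear_map_on_def by simp
  qed
  have "\<exists>B0 B. B0 \<subseteq> Z a \<and> Z a \<subseteq> span B0 \<and> B0 \<subseteq> B \<and> B \<subseteq> C a \<and> independent B \<and> C a \<subseteq> span B" for a
  proof -
    obtain B0 where B0: "B0 \<subseteq> Z a" "independent B0" "Z a \<subseteq> span B0"
      using maximal_independent_subset[of "Z a"] by metis
    have "B0 \<subseteq> C a" using B0(1) unfolding Z_def by blast
    from maximal_independent_subset_extend[OF this B0(2)] show ?thesis using B0 by metis
  qed
  then obtain B0 B where B: "\<And>a. B0 a \<subseteq> Z a" "\<And>a. Z a \<subseteq> span (B0 a)" "\<And>a. B0 a \<subseteq> B a"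
      "\<And>a. B a \<subseteq> C a" "\<And>a. independent (B a)" "\<And>a. C a \<subseteq> span (B a)"
    by metis
  define K where "K a = B a - B0 a" for a
  have KC: "K a \<subseteq> C a" for a using B(4) unfolding K_def by blast
  have sKC: "span (K a) \<subseteq> C a" for a using span_minimal[OF KC C] .
  have K0: "x = 0" if "x \<in> span (K a)" "d x = 0" for a x
  proof (rule independent_span_disjoint[OF B(5)[of a] _ B(3)[of a] _ that(1)])
    show "x \<in> span (B0 a)" using that sKC B(2) unfolding Z_def by blast
  qed (auto simp: K_def)
  have Ki: "independent (K a)" for a using independent_mono[OF B(5)] unfolding K_def by blast
  have inj: "inj_on d (span (K a))" for a
  proof (rule inj_onI)
    fix x y assume xy: "x \<in> span (K a)" "y \<in> span (K a)" "d x = d y"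
    then have "x - y \<in> span (K a)" by (simp add: span_diff)
    moreover have "d (x - y) = d x - d y"
      using linear_map_on_diff[OF lin[of a]] calculation xy sKC by blast
    ultimately show "x = y" using K0[of "x - y"] xy(3) by simp
  qed
  have injK: "inj_on d (K a)" for a using inj_on_subset[OF inj] span_superset by blast
  have dK: "independent (d ` K a)" for a
    unfolding independent_explicit_module
  proof (intro allI impI)
    fix t u v assume t: "finite t" "t \<subseteq> d ` K a" and 0: "(\<Sum>v\<in>t. scale (u v) v) = 0" and v: "v \<in> t"
    obtain t' where t': "t' \<subseteq> K a" "t = d ` t'" using t(2) by (meson subset_imageE)
    have it: "inj_on d t'" using inj_on_subset[OF injK t'(1)] .
    have ft: "finite t'" using t(1) t'(2) it by (simp add: finite_image_iff)
    define x where "x = (\<Sum>c\<in>t'. scale (u (d c)) c)"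
    have "d x = (\<Sum>c\<in>t'. d (scale (u (d c)) c))"
      unfolding x_def using t'(1) KC C subspace_scale by (intro linear_map_on_sum[OF lin[of a] C]) blast
    also have "\<dots> = (\<Sum>c\<in>t'. scale (u (d c)) (d c))"
      using lin[of a] t'(1) KC[of a] unfolding linear_map_on_def by (intro sum.cong) blast+
    also have "\<dots> = 0" using 0 unfolding t'(2) by (simp add: sum.reindex[OF it])
    finally have "d x = 0" .
    moreover have "x \<in> span (K a)"
      unfolding x_def using t'(1) by (intro span_sum span_scale span_base) auto
    ultimately have "x = 0" using K0 by blast
    then show "u v = 0"
      using independentD[OF Ki ft t'(1), of "\<lambda>c. u (d c)"] v t'(2) unfolding x_def by blast
  qed
  \<comment> \<open>A second basis of the cocycles, this time extending the image of
    \<open>K (a - 1)\<close>. It takes the place of \<open>B0\<close>, which served to find the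
    complement \<open>K\<close>.\<close>
  have "\<exists>Zb. d ` K (a - 1) \<subseteq> Zb \<and> Zb \<subseteq> Z a \<and> independent Zb \<and> Z a \<subseteq> span Zb" for a
  proof -
    have "d ` K (a - 1) \<subseteq> Z a" using KC[of "a - 1"] d[of _ "a - 1"] dd[of _ "a - 1"] unfolding Z_def by auto
    from maximal_independent_subset_extend[OF this dK] show ?thesis by metis
  qed
  then obtain Zb where Zb: "\<And>a. d ` K (a - 1) \<subseteq> Zb a" "\<And>a. Zb a \<subseteq> Z a" "\<And>a. independent (Zb a)"
      "\<And>a. Z a \<subseteq> span (Zb a)"
    by metis
  define H where "H a = Zb a - d ` K (a - 1)" for a
  have eq: "K a \<union> H a \<union> d ` K (a - 1) = K a \<union> Zb a" for a using Zb(1) unfolding H_def by blast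
  have KZ: "x = 0" if "x \<in> span (K a)" "x \<in> span (Zb a)" for x a
    using K0[OF that(1)] span_minimal[OF Zb(2) Zs, of a] that(2) unfolding Z_def by blast
  have disj: "K a \<inter> Zb a = {}" for a
  proof (rule ccontr)
    assume "K a \<inter> Zb a \<noteq> {}"
    then obtain x where x: "x \<in> K a" "x \<in> Zb a" by blast
    then have "x = 0" using KZ span_base by blast
    then show False using x(1) Ki dependent_zero by blast
  qed
  show thesis
  proof (rule that[of K H])
    show "K a \<subseteq> C a" for a by (rule KC)
    show "H a \<subseteq> C a" for a using Zb(2) unfolding H_def Z_def by blast
    show "d x = 0" if "x \<in> H a" for a x using that Zb(2) unfolding H_def Z_def by blast
    show "inj_on d (K a)" for a by (rule injK)
    show "H a \<inter> K a = {}" for a using disj unfolding H_def by blast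
    show "d ` K (a - 1) \<inter> (H a \<union> K a) = {}" for a using disj[of a] Zb(1)[of a] unfolding H_def by blast
    show "independent (K a \<union> H a \<union> d ` K (a - 1))" for a
      unfolding eq by (rule independent_Un_disjoint[OF Ki Zb(3) KZ])
    show "C a \<subseteq> span (K a \<union> H a \<union> d ` K (a - 1))" for a
    proof -
      have "B a \<subseteq> span (K a \<union> Zb a)"
      proof
        fix x assume "x \<in> B a"
        show "x \<in> span (K a \<union> Zb a)"
        proof (cases "x \<in> B0 a")
          case True
          then have "x \<in> span (Zb a)" using B(1) Zb(4) by blast
          then show ?thesis using span_mono[of "Zb a" "K a \<union> Zb a"] by blast
        next
          case False
          then have "x \<in> K a \<union> Zb a" using \<open>x \<in> B a\<close> unfolding K_def by blast
          then show ?thesis by (rule span_base)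
        qed
      qed
      then have "span (B a) \<subseteq> span (K a \<union> Zb a)" by (rule span_minimal[OF _ subspace_span])
      then show ?thesis unfolding eq using B(6) by blast
    qed
  qed
qed

end

section \<open>Cohomology of dg bimodules\<close>

lemma koszul_0 [simp]: "koszul 0 x = x" "koszul n 0 = 0" "koszul n (koszul m x) = koszul (m + n) x"
  by (auto simp: koszul_def)

lemma koszul_eq_0_iff [simp]: "koszul n x = 0 \<longleftrightarrow> x = 0"
  by (simp add: koszul_def)

sublocale dg_category \<subseteq> dv: vector_space "DScale A"
  by (rule vector_space_DScale)

sublocale dg_bimodule \<subseteq> bv: vector_space "BScale M"
  by (rule vector_space_BScale)

context dg_category
begin

definition cocyc :: "'v \<Rightarrow> 'a \<Rightarrow> 'a \<Rightarrow> bool" where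
  "cocyc f X Y \<longleftrightarrow> X \<in> DObj A \<and> Y \<in> DObj A \<and> f \<in> DZ A X Y 0"

lemma DHom_zero: "\<lbrakk>X \<in> DObj A; Y \<in> DObj A\<rbrakk> \<Longrightarrow> 0 \<in> DHom A X Y n"
  using subspace_DHom dv.subspace_0 by blast

lemma DComp_zero:
  assumes "X \<in> DObj A" "Y \<in> DObj A" "Z \<in> DObj A"
  shows "g \<in> DHom A Y Z n \<Longrightarrow> g \<odot> 0 = 0" and "f \<in> DHom A X Y n \<Longrightarrow> 0 \<odot> f = 0"
  using linear_map_on_0[of _ _ "DHom A X Y n" "\<lambda>x. g \<odot> x"] linear_map_on_0[of _ _ "DHom A Y Z n" "\<lambda>x. x \<odot> f"]
    DComp_bilinear[OF assms] DHom_zero assms unfolding bilinear_map_on_def by metis+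

lemma DDiff_DIdent:
  assumes "X \<in> DObj A" shows "DDiff A (DIdent A X) = 0"
proof -
  have 1: "DDiff A (DIdent A X) \<in> DHom A X X 1"
    using DDiff_closed[OF assms assms DIdent_closed[OF assms]] by simp
  have "DDiff A (DIdent A X) = DDiff A (DIdent A X \<odot> DIdent A X)"
    using DIdent_left[OF assms assms DIdent_closed[OF assms]] by simp
  also have "\<dots> = DDiff A (DIdent A X) + DDiff A (DIdent A X)"
    using DDiff_DComp[OF assms assms assms DIdent_closed[OF assms] DIdent_closed[OF assms]]
      DIdent_left[OF assms assms 1] DIdent_right[OF assms assms 1] by simp
  finally show ?thesis by simp
qed

lemma cocyc_DIdent: "X \<in> DObj A \<Longrightarrow> cocyc (DIdent A X) X X"
  unfolding cocyc_def cocycles_def using DDiff_DIdent DIdent_closed by simp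

lemma cocyc_DComp:
  assumes "cocyc g Y Z" "cocyc f X Y" shows "cocyc (g \<odot> f) X Z"
proof -
  have o: "X \<in> DObj A" "Y \<in> DObj A" "Z \<in> DObj A" and f: "f \<in> DHom A X Y 0" "DDiff A f = 0"
    and g: "g \<in> DHom A Y Z 0" "DDiff A g = 0"
    using assms unfolding cocyc_def cocycles_def by auto
  have "g \<odot> f \<in> DHom A X Z 0" using DComp_closed[OF o g(1) f(1)] by simp
  moreover have "DDiff A (g \<odot> f) = 0"
    using DDiff_DComp[OF o g(1) f(1)] f g DComp_zero[OF o] by simp
  ultimately show ?thesis unfolding cocyc_def cocycles_def using o by simp
qed

end

context dg_bimodule
begin

lemma LAct_linear:
  assumes "X \<in> DObj A" "cocyc f Y Z"
  shows "linear_map_on (BScale M) (BScale M) (BHom M X Y n) (LAct M f)"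
  using LAct_bilinear[of X Y Z 0 n] assms unfolding bilinear_map_on_def cocyc_def cocycles_def by simp

text \<open>For closed \<open>f\<close> of degree 0 the Leibniz rule loses the term with the
  differential of \<open>f\<close>, and its sign is trivial. So \<open>f\<close> acts by chain maps,
  hence on cohomology.\<close>

lemma LAct_cocyc:
  assumes X: "X \<in> DObj A" and f: "cocyc f Y Z" and m: "m \<in> BHom M X Y n"
  shows "LAct M f m \<in> BHom M X Z n" "BDiff M (LAct M f m) = LAct M f (BDiff M m)"
proof -
  have o: "Y \<in> DObj A" "Z \<in> DObj A" and f': "f \<in> DHom A Y Z 0" "DDiff A f = 0"
    using f unfolding cocyc_def cocycles_def by auto
  show "LAct M f m \<in> BHom M X Z n" using LAct_closed[OF X o f'(1) m] by simp
  have "linear_map_on (DScale A) (BScale M) (DHom A Y Z 0) (\<lambda>x. LAct M x m)"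
    using LAct_bilinear[OF X o, of 0 n] m unfolding bilinear_map_on_def by blast
  then have "LAct M 0 m = 0" using linear_map_on_0[of _ _ _ "\<lambda>x. LAct M x m"] DHom_zero[OF o] by blast
  then show "BDiff M (LAct M f m) = LAct M f (BDiff M m)"
    using BDiff_LAct[OF X o f'(1) m] f'(2) by simp
qed

lemma LAct_cocyc_BZ:
  assumes "X \<in> DObj A" "cocyc f Y Z" "m \<in> BZ M X Y n"
  shows "LAct M f m \<in> BZ M X Z n"
proof -
  have "0 \<in> BHom M X Y (n + 1)"
    using assms subspace_BHom bv.subspace_0 unfolding cocyc_def by blast
  then have "LAct M f 0 = 0" using linear_map_on_0[OF LAct_linear[OF assms(1,2)]] by blast
  moreover have "m \<in> BHom M X Y n" "BDiff M m = 0" using assms(3) unfolding cocycles_def by auto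
  ultimately show ?thesis using LAct_cocyc[OF assms(1,2)] unfolding cocycles_def by simp
qed

lemma BHom_diff:
  "\<lbrakk>X \<in> DObj A; Y \<in> DObj A; m \<in> BHom M X Y n; m' \<in> BHom M X Y n\<rbrakk> \<Longrightarrow> m - m' \<in> BHom M X Y n"
  using subspace_BHom bv.subspace_diff by blast

lemma BHom_add:
  "\<lbrakk>X \<in> DObj A; Y \<in> DObj A; m \<in> BHom M X Y n; m' \<in> BHom M X Y n\<rbrakk> \<Longrightarrow> m + m' \<in> BHom M X Y n"
  using subspace_BHom bv.subspace_add by blast

lemma BDiff_add:
  "\<lbrakk>X \<in> DObj A; Y \<in> DObj A; m \<in> BHom M X Y n; m' \<in> BHom M X Y n\<rbrakk>
    \<Longrightarrow> BDiff M (m + m') = BDiff M m + BDiff M m'"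
  using BDiff_linear[of X Y n] unfolding linear_map_on_def by blast

lemma BDiff_diff:
  "\<lbrakk>X \<in> DObj A; Y \<in> DObj A; m \<in> BHom M X Y n; m' \<in> BHom M X Y n\<rbrakk>
    \<Longrightarrow> BDiff M (m - m') = BDiff M m - BDiff M m'"
  using linear_map_on_diff[OF BDiff_linear[of X Y n]] BHom_diff by blast

lemma LAct_diff:
  "\<lbrakk>X \<in> DObj A; cocyc f Y Z; m \<in> BHom M X Y n; m' \<in> BHom M X Y n\<rbrakk>
    \<Longrightarrow> LAct M f (m - m') = LAct M f m - LAct M f m'"
  using linear_map_on_diff[OF LAct_linear[of X f Y Z n]] BHom_diff unfolding cocyc_def by blast

lemma BB_I: "\<lbrakk>w \<in> BHom M X Y (n - 1); m = BDiff M w\<rbrakk> \<Longrightarrow> m \<in> BB M X Y n"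
  unfolding coboundaries_def by blast

lemma BB_E:
  assumes "m \<in> BB M X Y n"
  obtains w where "w \<in> BHom M X Y (n - 1)" "m = BDiff M w"
  using assms unfolding coboundaries_def by blast

end

locale bimodule_map =
  M: dg_bimodule A M + N: dg_bimodule A N
  for A :: "('a, 'v::ab_group_add, 'k::field) dg_cat" and M :: "('a, 'v, 'w::ab_group_add, 'k) dg_bimod"
    and N :: "('a, 'v, 'x::ab_group_add, 'k) dg_bimod" +
  fixes \<psi>
  assumes bimod_map: "bimod_map A M N \<psi>"
begin

lemma linear: "\<lbrakk>X \<in> DObj A; Y \<in> DObj A\<rbrakk> \<Longrightarrow> linear_map_on (BScale M) (BScale N) (BHom M X Y n) \<psi>"
  using bimod_map unfolding bimod_map_def by blast

lemma closed: "\<lbrakk>X \<in> DObj A; Y \<in> DObj A; m \<in> BHom M X Y n\<rbrakk> \<Longrightarrow> \<psi> m \<in> BHom N X Y n"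
  using bimod_map unfolding bimod_map_def by blast

lemma diff: "\<lbrakk>X \<in> DObj A; Y \<in> DObj A; m \<in> BHom M X Y n; m' \<in> BHom M X Y n\<rbrakk> \<Longrightarrow> \<psi> (m - m') = \<psi> m - \<psi> m'"
  using linear_map_on_diff[OF linear] M.BHom_diff by blast

lemma BDiff: "\<lbrakk>X \<in> DObj A; Y \<in> DObj A; m \<in> BHom M X Y n\<rbrakk> \<Longrightarrow> \<psi> (BDiff M m) = BDiff N (\<psi> m)"
  using bimod_map unfolding bimod_map_def by blast

lemma LAct: "\<lbrakk>X \<in> DObj A; M.cocyc f Y Z; m \<in> BHom M X Y n\<rbrakk> \<Longrightarrow> \<psi> (LAct M f m) = LAct N f (\<psi> m)"
  using bimod_map unfolding bimod_map_def M.cocyc_def cocycles_def by blast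

lemma BZ:
  assumes "X \<in> DObj A" "Y \<in> DObj A" "m \<in> BZ M X Y n" shows "\<psi> m \<in> BZ N X Y n"
proof -
  have "0 \<in> BHom M X Y n" using assms M.subspace_BHom M.bv.subspace_0 by blast
  then have "\<psi> 0 = 0" using linear_map_on_0[OF linear] assms by blast
  then show ?thesis using BDiff[of X Y m n] closed assms unfolding cocycles_def by simp
qed

end

lemma bimodule_mapI: "bimod_map A M N \<psi> \<Longrightarrow> bimodule_map A M N \<psi>"
  unfolding bimodule_map_def bimodule_map_axioms_def bimod_map_def by blast

section \<open>Chains acting as zero on cohomology\<close>

text \<open>\<open>S\<close> is kept abstract; it will be the class of closed morphisms whose images
  in \<open>D\<close> are ghosts.\<close>

locale dg_category_with_class = dg_category A
  for A :: "('a, 'v::ab_group_add, 'k::field) dg_cat" (structure) +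
  fixes S :: "'a \<Rightarrow> 'a \<Rightarrow> 'v \<Rightarrow> bool"
  assumes S_cocyc: "S X Y f \<Longrightarrow> cocyc f X Y"
begin

abbreviation S_chain :: "nat \<Rightarrow> 'a \<Rightarrow> 'a \<Rightarrow> 'v \<Rightarrow> bool" where
  "S_chain \<equiv> chain (DIdent A) (DComp A) (DObj A) S"

lemma S_chain_cocyc: "S_chain n X Y f \<Longrightarrow> cocyc f X Y"
  by (induct rule: chain.induct) (auto simp: cocyc_DIdent intro: cocyc_DComp S_cocyc)

text \<open>Cuts a chain so that, for an exact sequence, its first part can be spent on one bimodule
  and the rest on another.\<close>

lemma S_chain_split:
  assumes "S_chain (a + b) X Z f"
  shows "\<exists>Y f1 f2. S_chain a X Y f1 \<and> S_chain b Y Z f2 \<and> f = f2 \<odot> f1"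
  using assms
proof (induct b arbitrary: Z f)
  case 0
  have "cocyc f X Z" using S_chain_cocyc 0 by simp
  then have "Z \<in> DObj A" "f = DIdent A Z \<odot> f"
    using DIdent_left[of X Z f 0] unfolding cocyc_def cocycles_def by auto
  moreover have "S_chain 0 Z Z (DIdent A Z)" using chain_0 calculation by metis
  ultimately show ?case using 0 by auto
next
  case (Suc b)
  then have "S_chain (Suc (a + b)) X Z f" by simp
  then obtain W f' g where f: "f = g \<odot> f'" "S_chain (a + b) X W f'" "S W Z g"
    by cases blast
  obtain Y f1 f2 where IH: "S_chain a X Y f1" "S_chain b Y W f2" "f' = f2 \<odot> f1"
    using Suc(1)[OF f(2)] by blast
  have "cocyc f1 X Y" "cocyc f2 Y W" "cocyc g W Z" using S_chain_cocyc S_cocyc IH f by blast+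
  then have "f = (g \<odot> f2) \<odot> f1"
    using DComp_assoc[of X Y W Z g 0 f2 0 f1 0] f(1) IH(3) unfolding cocyc_def cocycles_def by auto
  then show ?case using IH(1) chain_Suc[OF IH(2) f(3)] by blast
qed

text \<open>In cohomological terms: the maps from \<open>H^n M(X, Y)\<close> to
  \<open>H^n M(X, Z)\<close> induced by chains of length \<open>J\<close> are zero, with one
  \<open>J\<close> for all objects and degrees.\<close>

definition killed :: "nat \<Rightarrow> ('a, 'v, 'w::ab_group_add, 'k) dg_bimod \<Rightarrow> bool" where
  "killed J M \<longleftrightarrow> (\<forall>X Y Z f n z. X \<in> DObj A \<longrightarrow> S_chain J Y Z f \<longrightarrow> z \<in> BZ M X Y n \<longrightarrow>
     LAct M f z \<in> BB M X Z n)"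

lemma killedI:
  "(\<And>X Y Z f n z. \<lbrakk>X \<in> DObj A; Y \<in> DObj A; Z \<in> DObj A; cocyc f Y Z; S_chain J Y Z f; z \<in> BZ M X Y n\<rbrakk>
     \<Longrightarrow> LAct M f z \<in> BB M X Z n) \<Longrightarrow> killed J M"
  unfolding killed_def using S_chain_cocyc unfolding cocyc_def by blast

lemma killedD:
  "\<lbrakk>killed J M; X \<in> DObj A; S_chain J Y Z f; z \<in> BZ M X Y n\<rbrakk> \<Longrightarrow> LAct M f z \<in> BB M X Z n"
  unfolding killed_def by blast

text \<open>Surjectivity on cohomology: a cocycle of \<open>N\<close> is the image of a cocycle of
  \<open>M\<close> plus a coboundary, and the chain sends both parts to coboundaries.\<close>

lemma killed_quasi_iso_right:
  assumes q: "quasi_iso A M N \<psi>" and k: "killed J M"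
  shows "killed J N"
proof (rule killedI)
  interpret bimodule_map A M N \<psi> using q bimodule_mapI unfolding quasi_iso_def by blast
  fix X Y Z f n z
  assume X: "X \<in> DObj A" and YZ: "Y \<in> DObj A" "Z \<in> DObj A" and f: "cocyc f Y Z" and c: "S_chain J Y Z f"
    and z: "z \<in> BZ N X Y n"
  then obtain y where y: "y \<in> BZ M X Y n" "z - \<psi> y \<in> BB N X Y n"
    using q unfolding quasi_iso_def by blast
  obtain w where w: "w \<in> BHom N X Y (n - 1)" "z - \<psi> y = BDiff N w" using N.BB_E[OF y(2)] .
  obtain v where v: "v \<in> BHom M X Z (n - 1)" "LAct M f y = BDiff M v"
    using M.BB_E[OF killedD[OF k X c y(1)]] .
  have m: "y \<in> BHom M X Y n" "z \<in> BHom N X Y n" using y(1) z unfolding cocycles_def by auto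
  have "LAct N f z - LAct N f (\<psi> y) = LAct N f (BDiff N w)"
    using N.LAct_diff[OF X f m(2) closed[OF X YZ(1) m(1)]] w(2) by simp
  also have "\<dots> = BDiff N (LAct N f w)" using N.LAct_cocyc[OF X f w(1)] by simp
  finally have "LAct N f z = BDiff N (LAct N f w) + \<psi> (LAct M f y)"
    using LAct[OF X f m(1)] by (simp add: algebra_simps)
  also have "\<psi> (LAct M f y) = BDiff N (\<psi> v)" using v BDiff[OF X YZ(2) v(1)] by simp
  also have "BDiff N (LAct N f w) + BDiff N (\<psi> v) = BDiff N (LAct N f w + \<psi> v)"
    using N.BDiff_add[OF X YZ(2) N.LAct_cocyc(1)[OF X f w(1)] closed[OF X YZ(2) v(1)]] by simp
  finally show "LAct N f z \<in> BB N X Z n"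
    using N.BB_I N.BHom_add[OF X YZ(2) N.LAct_cocyc(1)[OF X f w(1)] closed[OF X YZ(2) v(1)]] by blast
qed

text \<open>Injectivity on cohomology lets the question be decided after applying
  \<open>\<psi>\<close>.\<close>

lemma killed_quasi_iso_left:
  assumes q: "quasi_iso A M N \<psi>" and k: "killed J N"
  shows "killed J M"
proof (rule killedI)
  interpret bimodule_map A M N \<psi> using q bimodule_mapI unfolding quasi_iso_def by blast
  fix X Y Z f n z
  assume X: "X \<in> DObj A" and YZ: "Y \<in> DObj A" "Z \<in> DObj A" and f: "cocyc f Y Z" and c: "S_chain J Y Z f"
    and z: "z \<in> BZ M X Y n"
  have "z \<in> BHom M X Y n" using z unfolding cocycles_def by auto
  then have "\<psi> (LAct M f z) \<in> BB N X Z n"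
    using killedD[OF k X c BZ[OF X YZ(1) z]] LAct[OF X f] by simp
  then show "LAct M f z \<in> BB M X Z n"
    using q M.LAct_cocyc_BZ[OF X f z] X YZ unfolding quasi_iso_def by blast
qed

lemma killed_retract:
  assumes r: "bimod_retract A L M" and k: "killed J M"
  shows "killed J L"
proof (rule killedI)
  obtain \<alpha> \<rho> where ar: "bimod_map A L M \<alpha>" "bimod_map A M L \<rho>"
    and id: "\<And>X Y n m. \<lbrakk>X\<in>DObj A; Y\<in>DObj A; m\<in>BHom L X Y n\<rbrakk> \<Longrightarrow> \<rho> (\<alpha> m) = m"
    using r unfolding bimod_retract_def by blast
  interpret \<alpha>: bimodule_map A L M \<alpha> using ar(1) by (rule bimodule_mapI)
  interpret \<rho>: bimodule_map A M L \<rho> using ar(2) by (rule bimodule_mapI)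
  fix X Y Z f n z
  assume X: "X \<in> DObj A" and YZ: "Y \<in> DObj A" "Z \<in> DObj A" and f: "cocyc f Y Z" and c: "S_chain J Y Z f"
    and z: "z \<in> BZ L X Y n"
  have m: "z \<in> BHom L X Y n" using z unfolding cocycles_def by auto
  obtain w where w: "w \<in> BHom M X Z (n - 1)" "LAct M f (\<alpha> z) = BDiff M w"
    using \<alpha>.N.BB_E[OF killedD[OF k X c \<alpha>.BZ[OF X YZ(1) z]]] .
  have "LAct L f z = \<rho> (\<alpha> (LAct L f z))" using id[OF X YZ(2) \<alpha>.M.LAct_cocyc(1)[OF X f m]] by simp
  also have "\<dots> = \<rho> (BDiff M w)" using \<alpha>.LAct[OF X f m] w(2) by simp
  also have "\<dots> = BDiff L (\<rho> w)" using \<rho>.BDiff[OF X YZ(2) w(1)] .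
  finally show "LAct L f z \<in> BB L X Z n"
    using \<alpha>.M.BB_I \<rho>.closed[OF X YZ(2) w(1)] by blast
qed

text \<open>The long exact cohomology sequence, carried out on elements. The first part of the chain
  kills the image of the class in the next term, so the class then comes from the preceding term,
  where the second part kills it. Lengths therefore add, the summand used first being written
  first.\<close>

lemma killed_short_exact:
  fixes L M N :: "('a, 'v, 'w::ab_group_add, 'k) dg_bimod"
  assumes s: "short_exact A L M N"
  shows "\<lbrakk>killed J M; killed J' N\<rbrakk> \<Longrightarrow> killed (J + J') L"
    and "\<lbrakk>killed J L; killed J' N\<rbrakk> \<Longrightarrow> killed (J' + J) M"
    and "\<lbrakk>killed J L; killed J' M\<rbrakk> \<Longrightarrow> killed (J + J') N"
proof -
  obtain \<alpha> \<beta> where ab: "bimod_map A L M \<alpha>" "bimod_map A M N \<beta>"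
    and ex: "\<forall>X\<in>DObj A. \<forall>Y\<in>DObj A. \<forall>n. inj_on \<alpha> (BHom L X Y n) \<and>
        \<alpha> ` BHom L X Y n = {m \<in> BHom M X Y n. \<beta> m = 0} \<and> \<beta> ` BHom M X Y n = BHom N X Y n"
    using s unfolding short_exact_def by (elim exE conjE)
  have inj: "inj_on \<alpha> (BHom L X Y n)"
    and ker: "\<alpha> ` BHom L X Y n = {m \<in> BHom M X Y n. \<beta> m = 0}"
    and sur: "\<beta> ` BHom M X Y n = BHom N X Y n" if "X \<in> DObj A" "Y \<in> DObj A" for X Y n
    using ex that by simp_all
  interpret \<alpha>: bimodule_map A L M \<alpha> using ab(1) by (rule bimodule_mapI)
  interpret \<beta>: bimodule_map A M N \<beta> using ab(2) by (rule bimodule_mapI)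
  have \<beta>\<alpha>: "\<beta> (\<alpha> l) = 0" if "X\<in>DObj A" "Y\<in>DObj A" "l \<in> BHom L X Y n" for X Y l n
  proof -
    have "\<alpha> l \<in> \<alpha> ` BHom L X Y n" using that(3) by simp
    then show ?thesis unfolding ker[OF that(1,2)] by simp
  qed
  have lift: "\<exists>l\<in>BHom L X Y n. \<alpha> l = m" if "X\<in>DObj A" "Y\<in>DObj A" "m \<in> BHom M X Y n" "\<beta> m = 0" for X Y m n
  proof -
    have "m \<in> \<alpha> ` BHom L X Y n" unfolding ker[OF that(1,2)] using that(3,4) by simp
    then show ?thesis by blast
  qed
  have surE: "\<exists>v\<in>BHom M X Y n. \<beta> v = w" if "X\<in>DObj A" "Y\<in>DObj A" "w \<in> BHom N X Y n" for X Y w n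
    using that(3) unfolding sur[OF that(1,2), symmetric] by blast
  have zZ: "z \<in> BHom Q X Y n" "BDiff Q z = 0" if "z \<in> BZ Q X Y n" for Q :: "('a, 'v, 'w, 'k) dg_bimod" and z X Y n
    using that unfolding cocycles_def by auto
  have lift_closed: "l \<in> BZ L X Y n" if o: "X\<in>DObj A" "Y\<in>DObj A" and l: "l \<in> BHom L X Y n" and "BDiff M (\<alpha> l) = 0"
    for X Y l n
  proof -
    have "\<alpha> (BDiff L l) = 0" using \<alpha>.BDiff[OF o l] that by simp
    moreover have "0 \<in> BHom L X Y (n + 1)" "\<alpha> 0 = 0"
      using \<alpha>.M.subspace_BHom[OF o] \<alpha>.M.bv.subspace_0 linear_map_on_0[OF \<alpha>.linear[OF o]] by blast+
    ultimately have "BDiff L l = 0"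
      using inj[OF o, of "n + 1"] \<alpha>.M.BDiff_closed[OF o l] unfolding inj_on_def by metis
    then show ?thesis using l unfolding cocycles_def by blast
  qed
  have split: "\<exists>W f1 f2. S_chain a Y W f1 \<and> S_chain b W Z f2 \<and> cocyc f1 Y W \<and> cocyc f2 W Z \<and> W \<in> DObj A
      \<and> (\<forall>(Q :: ('a, 'v, 'w, 'k) dg_bimod) X n z. dg_bimodule A Q \<longrightarrow> X \<in> DObj A \<longrightarrow> z \<in> BHom Q X Y n \<longrightarrow>
        LAct Q f z = LAct Q f2 (LAct Q f1 z))"
    if "S_chain (a + b) Y Z f" for a b Y Z f
  proof -
    obtain W f1 f2 where 1: "S_chain a Y W f1" "S_chain b W Z f2" "f = f2 \<odot> f1"
      using S_chain_split[OF \<open>S_chain (a + b) Y Z f\<close>] by blast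
    note c = S_chain_cocyc[OF 1(1)] S_chain_cocyc[OF 1(2)]
    have "LAct Q f z = LAct Q f2 (LAct Q f1 z)" if "dg_bimodule A Q" "X \<in> DObj A" "z \<in> BHom Q X Y n"
      for Q :: "('a, 'v, 'w, 'k) dg_bimod" and X n z
      using dg_bimodule.LAct_DComp[OF that(1,2), of Y W Z f2 0 f1 0 z n] c 1(3) that(3)
      unfolding cocyc_def cocycles_def by blast
    then show ?thesis using 1 c unfolding cocyc_def by blast
  qed
  note bim = \<alpha>.M.dg_bimodule_axioms \<alpha>.N.dg_bimodule_axioms \<beta>.N.dg_bimodule_axioms
  show "killed (J + J') L" if k: "killed J M" "killed J' N"
  proof (rule killedI)
    fix X Y Z f n z
    assume X: "X \<in> DObj A" and YZ: "Y \<in> DObj A" "Z \<in> DObj A" and c: "S_chain (J + J') Y Z f"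
      and z: "z \<in> BZ L X Y n"
    note zH = zZ[OF z]
    obtain W f1 f2 where f: "S_chain J Y W f1" "S_chain J' W Z f2" "cocyc f1 Y W" "cocyc f2 W Z" "W \<in> DObj A"
        "LAct L f z = LAct L f2 (LAct L f1 z)"
      using split[OF c] bim(1) X zH by blast
    obtain m where m: "m \<in> BHom M X W (n - 1)" "LAct M f1 (\<alpha> z) = BDiff M m"
      using \<alpha>.N.BB_E[OF killedD[OF k(1) X f(1) \<alpha>.BZ[OF X YZ(1) z]]] .
    have f1z: "LAct L f1 z \<in> BHom L X W n" using \<alpha>.M.LAct_cocyc(1)[OF X f(3) zH(1)] .
    have dm: "BDiff M m = \<alpha> (LAct L f1 z)" using \<alpha>.LAct[OF X f(3) zH(1)] m(2) by simp
    have "BDiff N (\<beta> m) = 0" using \<beta>.BDiff[OF X f(5) m(1)] dm \<beta>\<alpha>[OF X f(5) f1z] by simp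
    \<comment> \<open>The connecting morphism read backwards: \<open>f1 z\<close> is the connecting
      image of the class of \<open>\<beta> m\<close>, and the rest of the chain kills that
      class.\<close>
    then have "\<beta> m \<in> BZ N X W (n - 1)" using \<beta>.closed[OF X f(5) m(1)] unfolding cocycles_def by simp
    from \<beta>.N.BB_E[OF killedD[OF k(2) X f(2) this]]
    obtain w where w: "w \<in> BHom N X Z (n - 1 - 1)" "LAct N f2 (\<beta> m) = BDiff N w" .
    obtain v where v: "v \<in> BHom M X Z (n - 1 - 1)" "\<beta> v = w" using surE[OF X YZ(2)] w(1) by blast
    have f2m: "LAct M f2 m \<in> BHom M X Z (n - 1)" using \<alpha>.N.LAct_cocyc(1)[OF X f(4) m(1)] .
    have dv: "BDiff M v \<in> BHom M X Z (n - 1)" using \<alpha>.N.BDiff_closed[OF X YZ(2) v(1)] by simp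
    have "\<beta> (LAct M f2 m - BDiff M v) = 0"
      using \<beta>.diff[OF X YZ(2) f2m dv] \<beta>.LAct[OF X f(4) m(1)] \<beta>.BDiff[OF X YZ(2) v(1)] v(2) w(2) by simp
    then obtain l where l: "l \<in> BHom L X Z (n - 1)" "\<alpha> l = LAct M f2 m - BDiff M v"
      using lift[OF X YZ(2) \<alpha>.N.BHom_diff[OF X YZ(2) f2m dv]] by blast
    have "\<alpha> (BDiff L l) = BDiff M (LAct M f2 m)"
      using \<alpha>.BDiff[OF X YZ(2) l(1)] l(2) \<alpha>.N.BDiff_diff[OF X YZ(2) f2m dv] \<alpha>.N.BDiff_BDiff[OF X YZ(2) v(1)] by simp
    also have "\<dots> = \<alpha> (LAct L f2 (LAct L f1 z))"
      using \<alpha>.N.LAct_cocyc(2)[OF X f(4) m(1)] dm \<alpha>.LAct[OF X f(4) f1z] by simp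
    finally have "BDiff L l = LAct L f2 (LAct L f1 z)"
      using inj[OF X YZ(2), of n] \<alpha>.M.BDiff_closed[OF X YZ(2) l(1)] \<alpha>.M.LAct_cocyc(1)[OF X f(4) f1z]
      unfolding inj_on_def by simp
    then show "LAct L f z \<in> BB L X Z n" using \<alpha>.M.BB_I[OF l(1)] f(6) by simp
  qed
  show "killed (J' + J) M" if k: "killed J L" "killed J' N"
  proof (rule killedI)
    fix X Y Z f n z
    assume X: "X \<in> DObj A" and YZ: "Y \<in> DObj A" "Z \<in> DObj A" and c: "S_chain (J' + J) Y Z f"
      and z: "z \<in> BZ M X Y n"
    note zH = zZ[OF z]
    obtain W f1 f2 where f: "S_chain J' Y W f1" "S_chain J W Z f2" "cocyc f1 Y W" "cocyc f2 W Z" "W \<in> DObj A"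
        "LAct M f z = LAct M f2 (LAct M f1 z)"
      using split[OF c] bim(2) X zH by blast
    obtain w where w: "w \<in> BHom N X W (n - 1)" "LAct N f1 (\<beta> z) = BDiff N w"
      using \<beta>.N.BB_E[OF killedD[OF k(2) X f(1) \<beta>.BZ[OF X YZ(1) z]]] .
    obtain v where v: "v \<in> BHom M X W (n - 1)" "\<beta> v = w" using surE[OF X f(5)] w(1) by blast
    have f1z: "LAct M f1 z \<in> BHom M X W n" using \<alpha>.N.LAct_cocyc(1)[OF X f(3) zH(1)] .
    have df1z: "BDiff M (LAct M f1 z) = 0" using \<alpha>.N.LAct_cocyc_BZ[OF X f(3) z] unfolding cocycles_def by blast
    have dv: "BDiff M v \<in> BHom M X W n" using \<alpha>.N.BDiff_closed[OF X f(5) v(1)] by simp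
    \<comment> \<open>Subtracting a coboundary makes the image in \<open>N\<close> vanish exactly,
      not just up to a coboundary, so that the element comes from \<open>L\<close>.\<close>
    have "\<beta> (LAct M f1 z - BDiff M v) = 0"
      using \<beta>.diff[OF X f(5) f1z dv] \<beta>.LAct[OF X f(3) zH(1)] \<beta>.BDiff[OF X f(5) v(1)] v(2) w(2) by simp
    then obtain l where l: "l \<in> BHom L X W n" "\<alpha> l = LAct M f1 z - BDiff M v"
      using lift[OF X f(5) \<alpha>.N.BHom_diff[OF X f(5) f1z dv]] by blast
    have "BDiff M (\<alpha> l) = 0"
      using l(2) \<alpha>.N.BDiff_diff[OF X f(5) f1z dv] df1z \<alpha>.N.BDiff_BDiff[OF X f(5) v(1)] by simp
    then have lZ: "l \<in> BZ L X W n" using lift_closed[OF X f(5) l(1)] by blast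
    obtain l' where l': "l' \<in> BHom L X Z (n - 1)" "LAct L f2 l = BDiff L l'"
      using \<alpha>.M.BB_E[OF killedD[OF k(1) X f(2) lZ]] .
    have f2v: "LAct M f2 v \<in> BHom M X Z (n - 1)" using \<alpha>.N.LAct_cocyc(1)[OF X f(4) v(1)] .
    have al': "\<alpha> l' \<in> BHom M X Z (n - 1)" using \<alpha>.closed[OF X YZ(2) l'(1)] .
    have "LAct M f2 (LAct M f1 z) - LAct M f2 (BDiff M v) = LAct M f2 (\<alpha> l)"
      using \<alpha>.N.LAct_diff[OF X f(4) f1z dv] l(2) by simp
    also have "\<dots> = BDiff M (\<alpha> l')"
      using \<alpha>.LAct[OF X f(4) l(1)] l'(2) \<alpha>.BDiff[OF X YZ(2) l'(1)] by simp
    finally have "LAct M f2 (LAct M f1 z) = BDiff M (\<alpha> l') + BDiff M (LAct M f2 v)"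
      using \<alpha>.N.LAct_cocyc(2)[OF X f(4) v(1)] by (simp add: algebra_simps)
    also have "\<dots> = BDiff M (\<alpha> l' + LAct M f2 v)" using \<alpha>.N.BDiff_add[OF X YZ(2) al' f2v] by simp
    finally show "LAct M f z \<in> BB M X Z n"
      using \<alpha>.N.BB_I[OF \<alpha>.N.BHom_add[OF X YZ(2) al' f2v]] f(6) by simp
  qed
  show "killed (J + J') N" if k: "killed J L" "killed J' M"
  proof (rule killedI)
    fix X Y Z f n z
    assume X: "X \<in> DObj A" and YZ: "Y \<in> DObj A" "Z \<in> DObj A" and c: "S_chain (J + J') Y Z f"
      and z: "z \<in> BZ N X Y n"
    note zH = zZ[OF z]
    obtain W f1 f2 where f: "S_chain J Y W f1" "S_chain J' W Z f2" "cocyc f1 Y W" "cocyc f2 W Z" "W \<in> DObj A"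
        "LAct N f z = LAct N f2 (LAct N f1 z)"
      using split[OF c] bim(3) X zH by blast
    obtain m where m: "m \<in> BHom M X Y n" "\<beta> m = z" using surE[OF X YZ(1)] zH(1) by blast
    have dm: "BDiff M m \<in> BHom M X Y (n + 1)" using \<alpha>.N.BDiff_closed[OF X YZ(1) m(1)] .
    have "\<beta> (BDiff M m) = 0" using \<beta>.BDiff[OF X YZ(1) m(1)] m(2) zH(2) by simp
    \<comment> \<open>\<open>l\<close> represents the image of \<open>z\<close> under the connecting
      morphism, which raises the degree by one.\<close>
    then obtain l where l: "l \<in> BHom L X Y (n + 1)" "\<alpha> l = BDiff M m"
      using lift[OF X YZ(1) dm] by blast
    have "BDiff M (\<alpha> l) = 0" using l(2) \<alpha>.N.BDiff_BDiff[OF X YZ(1) m(1)] by simp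
    then have lZ: "l \<in> BZ L X Y (n + 1)" using lift_closed[OF X YZ(1) l(1)] by blast
    obtain l' where "l' \<in> BHom L X W (n + 1 - 1)" and l'2: "LAct L f1 l = BDiff L l'"
      using \<alpha>.M.BB_E[OF killedD[OF k(1) X f(1) lZ]] .
    then have l': "l' \<in> BHom L X W n" by simp
    have f1m: "LAct M f1 m \<in> BHom M X W n" using \<alpha>.N.LAct_cocyc(1)[OF X f(3) m(1)] .
    have al': "\<alpha> l' \<in> BHom M X W n" using \<alpha>.closed[OF X f(5) l'] .
    have "BDiff M (LAct M f1 m) = BDiff M (\<alpha> l')"
      using \<alpha>.N.LAct_cocyc(2)[OF X f(3) m(1)] l(2) \<alpha>.LAct[OF X f(3) l(1)] l'2 \<alpha>.BDiff[OF X f(5) l'] by simp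
    then have "BDiff M (LAct M f1 m - \<alpha> l') = 0" using \<alpha>.N.BDiff_diff[OF X f(5) f1m al'] by simp
    then have "LAct M f1 m - \<alpha> l' \<in> BZ M X W n"
      using \<alpha>.N.BHom_diff[OF X f(5) f1m al'] unfolding cocycles_def by simp
    from \<alpha>.N.BB_E[OF killedD[OF k(2) X f(2) this]]
    obtain m' where m': "m' \<in> BHom M X Z (n - 1)" "LAct M f2 (LAct M f1 m - \<alpha> l') = BDiff M m'" .
    have "\<beta> (LAct M f1 m - \<alpha> l') = LAct N f1 z"
      using \<beta>.diff[OF X f(5) f1m al'] \<beta>\<alpha>[OF X f(5) l'] \<beta>.LAct[OF X f(3) m(1)] m(2) by simp
    then have "LAct N f2 (LAct N f1 z) = \<beta> (BDiff M m')"
      using \<beta>.LAct[OF X f(4) \<alpha>.N.BHom_diff[OF X f(5) f1m al']] m'(2) by simp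
    also have "\<dots> = BDiff N (\<beta> m')" using \<beta>.BDiff[OF X YZ(2) m'(1)] .
    finally show "LAct N f z \<in> BB N X Z n"
      using \<beta>.N.BB_I[OF \<beta>.closed[OF X YZ(2) m'(1)]] f(6) by simp
  qed
qed

end

context dg_bimodule
begin

lemma LAct_linear_right:
  "\<lbrakk>X \<in> DObj A; Y \<in> DObj A; Z \<in> DObj A; g \<in> DHom A Y Z k\<rbrakk>
    \<Longrightarrow> linear_map_on (BScale M) (BScale M) (BHom M X Y n) (LAct M g)"
  using LAct_bilinear[of X Y Z k n] unfolding bilinear_map_on_def by blast

lemma LAct_linear_left:
  "\<lbrakk>X \<in> DObj A; Y \<in> DObj A; Z \<in> DObj A; m \<in> BHom M X Y n\<rbrakk>
    \<Longrightarrow> linear_map_on (DScale A) (BScale M) (DHom A Y Z k) (\<lambda>g. LAct M g m)"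
  using LAct_bilinear[of X Y Z k n] unfolding bilinear_map_on_def by blast

lemma RAct_linear_right:
  "\<lbrakk>W \<in> DObj A; X \<in> DObj A; Y \<in> DObj A; m \<in> BHom M X Y n\<rbrakk>
    \<Longrightarrow> linear_map_on (DScale A) (BScale M) (DHom A W X k) (RAct M m)"
  using RAct_bilinear[of W X Y n k] unfolding bilinear_map_on_def by blast

lemma RAct_linear_left:
  "\<lbrakk>W \<in> DObj A; X \<in> DObj A; Y \<in> DObj A; f \<in> DHom A W X k\<rbrakk>
    \<Longrightarrow> linear_map_on (BScale M) (BScale M) (BHom M X Y n) (\<lambda>m. RAct M m f)"
  using RAct_bilinear[of W X Y n k] unfolding bilinear_map_on_def by blast

lemma BHom_zero: "\<lbrakk>X \<in> DObj A; Y \<in> DObj A\<rbrakk> \<Longrightarrow> 0 \<in> BHom M X Y n"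
  using subspace_BHom bv.subspace_0 by blast

end

context dg_category
begin

lemma DHom_add: "\<lbrakk>X \<in> DObj A; Y \<in> DObj A; f \<in> DHom A X Y n; g \<in> DHom A X Y n\<rbrakk> \<Longrightarrow> f + g \<in> DHom A X Y n"
  using subspace_DHom dv.subspace_add by blast

lemma DHom_scale: "\<lbrakk>X \<in> DObj A; Y \<in> DObj A; f \<in> DHom A X Y n\<rbrakk> \<Longrightarrow> DScale A c f \<in> DHom A X Y n"
  using subspace_DHom dv.subspace_scale by blast

lemma DHom_koszul: "\<lbrakk>X \<in> DObj A; Y \<in> DObj A; f \<in> DHom A X Y n\<rbrakk> \<Longrightarrow> koszul k f \<in> DHom A X Y n"
  using subspace_DHom dv.subspace_neg unfolding koszul_def by auto

lemma independent_DHom_degree: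
  assumes "X \<in> DObj A" "Y \<in> DObj A"
  shows "independent_family UNIV (\<lambda>a. DHom A X Y a)"
  unfolding independent_family_def
proof (intro allI impI ballI)
  fix S :: "int set" and x i
  assume S: "finite S \<and> S \<subseteq> UNIV \<and> (\<forall>i\<in>S. x i \<in> DHom A X Y i) \<and> (\<Sum>i\<in>S. x i) = 0" and i: "i \<in> S"
  let ?e = "\<lambda>a. (X, Y, a)"
  have "(\<Sum>j\<in>?e ` S. x (snd (snd j))) = (\<Sum>a\<in>S. x a)"
    by (subst sum.reindex) (auto simp: inj_on_def)
  then have "finite (?e ` S) \<and> ?e ` S \<subseteq> DObj A \<times> DObj A \<times> UNIV \<and>
      (\<forall>j\<in>?e ` S. x (snd (snd j)) \<in> (case j of (X, Y, n) \<Rightarrow> DHom A X Y n)) \<and> (\<Sum>j\<in>?e ` S. x (snd (snd j))) = 0"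
    using S assms by auto
  from mp[OF spec[OF spec[OF independent_DHom[unfolded independent_family_def]]] this]
  have "\<forall>j\<in>?e ` S. x (snd (snd j)) = 0" .
  then show "x i = 0" using i by auto
qed

text \<open>Directness is applied to the vanishing sum of \<open>x\<close>, placed in degree
  \<open>a\<close>, and \<open>- x\<close>, placed in degree \<open>b\<close>.\<close>

lemma DHom_degree_unique:
  assumes "X \<in> DObj A" "Y \<in> DObj A" "x \<in> DHom A X Y a" "x \<in> DHom A X Y b" "a \<noteq> b"
  shows "x = 0"
proof -
  have "finite {a, b} \<and> {a, b} \<subseteq> UNIV \<and> (\<forall>i\<in>{a, b}. (if i = a then x else - x) \<in> DHom A X Y i) \<and>
      (\<Sum>i\<in>{a, b}. if i = a then x else - x) = 0"
    using assms subspace_DHom[of X Y b] dv.subspace_neg[of "DHom A X Y b" x] by auto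
  from mp[OF spec[OF spec[OF independent_DHom_degree[OF assms(1,2), unfolded independent_family_def]]] this]
  have "\<forall>i\<in>{a, b}. (if i = a then x else - x) = 0" .
  then show ?thesis by simp
qed

end

section \<open>Representable bimodules and the Kuenneth decomposition\<close>

locale representable_bimodule = dg_bimodule A P
  for A :: "('a, 'v::ab_group_add, 'k::field) dg_cat" (structure)
    and P :: "('a, 'v, 'w::ab_group_add, 'k) dg_bimod" +
  fixes X0 Y0 :: 'a and n :: int and e :: 'w
  assumes representable: "representable_bimod A P X0 Y0 n e"
begin

lemma base: "X0 \<in> DObj A" "Y0 \<in> DObj A" "e \<in> BHom P X0 Y0 n" "BDiff P e = 0"
  using representable unfolding representable_bimod_def cocycles_def by auto

text \<open>The element corresponding to the tensor \<open>g \<otimes> f\<close>.\<close>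

definition gen :: "'v \<Rightarrow> 'v \<Rightarrow> 'w" where
  "gen g f = LAct P g (RAct P e f)"

lemma RAct_e: "\<lbrakk>U \<in> DObj A; f \<in> DHom A U X0 b\<rbrakk> \<Longrightarrow> RAct P e f \<in> BHom P U Y0 (n + b)"
  using RAct_closed base by blast

lemma gen_closed:
  assumes "U \<in> DObj A" "V \<in> DObj A" "g \<in> DHom A Y0 V a" "f \<in> DHom A U X0 b" "a + n + b = k"
  shows "gen g f \<in> BHom P U V k"
  using LAct_closed[OF assms(1) base(2) assms(2,3) RAct_e[OF assms(1,4)]] assms(5)
  unfolding gen_def by (simp add: add.assoc)

lemma gen_linear_left:
  "\<lbrakk>U \<in> DObj A; V \<in> DObj A; f \<in> DHom A U X0 b\<rbrakk>
    \<Longrightarrow> linear_map_on (DScale A) (BScale P) (DHom A Y0 V a) (\<lambda>g. gen g f)"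
  using LAct_linear_left[OF _ base(2) _ RAct_e] unfolding gen_def by blast

lemma gen_linear_right:
  assumes "U \<in> DObj A" "V \<in> DObj A" "g \<in> DHom A Y0 V a"
  shows "linear_map_on (DScale A) (BScale P) (DHom A U X0 b) (gen g)"
  using LAct_linear_right[OF assms(1) base(2) assms(2,3), of "n + b"] RAct_linear_right[OF assms(1) base(1,2,3), of b]
    RAct_e[OF assms(1)]
  unfolding gen_def linear_map_on_def by auto

lemma gen_zero:
  assumes "U \<in> DObj A" "V \<in> DObj A"
  shows "g \<in> DHom A Y0 V a \<Longrightarrow> gen g 0 = 0" and "f \<in> DHom A U X0 b \<Longrightarrow> gen 0 f = 0"
  using linear_map_on_0[OF gen_linear_right[OF assms, of g a]] linear_map_on_0[OF gen_linear_left[OF assms, of f b]]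
    DHom_zero assms base by blast+

lemma gen_koszul:
  assumes o: "U \<in> DObj A" "V \<in> DObj A" and g: "g \<in> DHom A Y0 V a" and f: "f \<in> DHom A U X0 b"
  shows "gen g (koszul k f) = koszul k (gen g f)"
proof -
  have "0 - f \<in> DHom A U X0 b" using DHom_koszul[OF o(1) base(1) f, of 1] by (simp add: koszul_def)
  from linear_map_on_diff[OF gen_linear_right[OF o g] this f]
  have "gen g (0 - f) = gen g 0 - gen g f" .
  then show ?thesis using gen_zero(1)[OF o g] by (simp add: koszul_def)
qed

text \<open>The differential of a tensor product. The sign of the second term also counts the degree
  \<open>n\<close> of the closed generator \<open>e\<close>, which stands between \<open>g\<close>
  and \<open>f\<close>.\<close>

lemma BDiff_gen:
  assumes o: "U \<in> DObj A" "V \<in> DObj A" and g: "g \<in> DHom A Y0 V a" and f: "f \<in> DHom A U X0 b"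
  shows "BDiff P (gen g f) = gen (DDiff A g) f + koszul (a + n) (gen g (DDiff A f))"
proof -
  have df: "DDiff A f \<in> DHom A U X0 (b + 1)" using DDiff_closed[OF o(1) base(1) f] .
  have "RAct P 0 f = 0"
    using linear_map_on_0[OF RAct_linear_left[OF o(1) base(1,2) f, of "n + 1"]] BHom_zero base by blast
  then have 1: "BDiff P (RAct P e f) = koszul n (RAct P e (DDiff A f))"
    using BDiff_RAct[OF o(1) base(1,2,3) f] base(4) by simp
  note lin = LAct_linear_right[OF o(1) base(2) o(2) g]
  note Ob = BHom_zero[OF o(1) base(2)]
  have "LAct P g (0 - RAct P e (DDiff A f)) = - LAct P g (RAct P e (DDiff A f))"
    unfolding linear_map_on_diff[OF lin BHom_diff[OF o(1) base(2) Ob RAct_e[OF o(1) df]] RAct_e[OF o(1) df]]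
    using linear_map_on_0[OF lin Ob] by simp
  then have "LAct P g (koszul n (RAct P e (DDiff A f))) = koszul n (gen g (DDiff A f))"
    by (simp add: koszul_def gen_def)
  then show ?thesis
    using BDiff_LAct[OF o(1) base(2) o(2) g RAct_e[OF o(1) f]] 1
    by (simp add: gen_def add.commute)
qed

lemma gen_injective:
  assumes o: "U \<in> DObj A" "V \<in> DObj A" and S: "finite S" "S \<subseteq> (\<Union>a. DHom A Y0 V a)" "dv.independent S"
    and f: "\<And>g. g \<in> S \<Longrightarrow> f g \<in> (\<Union>b. DHom A U X0 b)" and 0: "(\<Sum>g\<in>S. gen g (f g)) = 0"
  shows "\<And>g. g \<in> S \<Longrightarrow> f g = 0"
  using representable o S f 0 unfolding representable_bimod_def gen_def by blast

lemma gen_span: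
  assumes o: "U \<in> DObj A" "V \<in> DObj A"
  shows "BHom P U V k \<subseteq> bv.span {gen g f | g f a b. g \<in> DHom A Y0 V a \<and> f \<in> DHom A U X0 b \<and> a + n + b = k}"
  using representable o unfolding representable_bimod_def gen_def by blast

text \<open>Kuenneth: writing a cocycle of \<open>A(Y0, V) \<otimes> A(U, X0)\<close> in terms of an adapted basis of \<open>A(Y0, V)\<close> shows
  that it is cohomologous to a sum of tensors \<open>h \<otimes> f\<close> of cocycles.\<close>

lemma cocycle_decomposition:
  assumes o: "U \<in> DObj A" "V \<in> DObj A" and z: "z \<in> BZ P U V k"
  obtains Hf \<phi> y a where "finite Hf" "y \<in> BHom P U V (k - 1)"
    "\<And>h. h \<in> Hf \<Longrightarrow> h \<in> DZ A Y0 V (a h)" "\<And>h. h \<in> Hf \<Longrightarrow> \<phi> h \<in> DZ A U X0 (k - n - a h)"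
    "z = (\<Sum>h\<in>Hf. gen h (\<phi> h)) + BDiff P y"
proof -
  let ?C = "\<lambda>a. DHom A Y0 V a"
  have oY: "Y0 \<in> DObj A" "V \<in> DObj A" using base o by auto
  obtain K H where KH: "\<And>a. K a \<subseteq> ?C a" "\<And>a. H a \<subseteq> ?C a" "\<And>a x. x \<in> H a \<Longrightarrow> DDiff A x = 0"
    "\<And>a. inj_on (DDiff A) (K a)" "\<And>a. H a \<inter> K a = {}" "\<And>a. DDiff A ` K (a - 1) \<inter> (H a \<union> K a) = {}"
    "\<And>a. dv.independent (K a \<union> H a \<union> DDiff A ` K (a - 1))"
    "\<And>a. ?C a \<subseteq> dv.span (K a \<union> H a \<union> DDiff A ` K (a - 1))"
  proof (rule dv.adapted_basis[of ?C "DDiff A"])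
    show "dv.subspace (?C a)" for a using subspace_DHom oY by blast
    show "linear_map_on (DScale A) (DScale A) (?C a) (DDiff A)" for a using DDiff_linear oY by blast
    show "DDiff A x \<in> ?C (a + 1)" if "x \<in> ?C a" for a x using DDiff_closed oY that by blast
    show "DDiff A (DDiff A x) = 0" if "x \<in> ?C a" for a x using DDiff_DDiff oY that by blast
  qed blast
  define T where "T a = K a \<union> H a \<union> DDiff A ` K (a - 1)" for a
  have dKC: "DDiff A ` K (a - 1) \<subseteq> ?C a" for a
    using KH(1)[of "a - 1"] DDiff_closed[OF oY, of _ "a - 1"] by auto
  have TC: "T a \<subseteq> ?C a" for a using KH(1,2) dKC unfolding T_def by blast
  have Ti: "dv.independent (T a)" for a using KH(7) unfolding T_def .
  have T0: "0 \<notin> T a" for a using Ti dv.dependent_zero by blast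
  \<comment> \<open>Coefficients are compared along a single independent family, so the bases of all
    degrees are united.\<close>
  have indT: "dv.independent (\<Union>a. T a)"
    using dv.independent_Union_family[OF independent_DHom_degree[OF oY], of T] subspace_DHom oY TC Ti by simp
  have Tdeg: "a = b" if "x \<in> T a" "x \<in> T b" for x a b
    using DHom_degree_unique[OF oY] TC that T0 by blast
  \<comment> \<open>The degree of a basis element, unique because basis elements are
    nonzero.\<close>
  define dg where "dg x = (SOME a. x \<in> T a)" for x
  have dg: "dg x = a" if "x \<in> T a" for x a
    unfolding dg_def using that Tdeg by (intro some_equality) auto
  let ?K = "\<Union>a. K a" and ?H = "\<Union>a. H a"
  have dgK: "c \<in> K (dg c)" if "c \<in> ?K" for c using that dg unfolding T_def by blast
  have dgH: "h \<in> H (dg h)" if "h \<in> ?H" for h using that dg unfolding T_def by blast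
  let ?T = "\<Union>a. T a"
  \<comment> \<open>A normal form: a finite sum of tensors along the basis. The coefficients are
    defined on the whole basis and vanish off \<open>S\<close>, so that supports can be enlarged
    freely.\<close>
  define good where "good z \<longleftrightarrow> (\<exists>S \<phi>. finite S \<and> S \<subseteq> ?T \<and> (\<forall>g\<in>?T. \<phi> g \<in> DHom A U X0 (k - n - dg g)) \<and>
      (\<forall>g\<in>?T - S. \<phi> g = 0) \<and> z = (\<Sum>g\<in>S. gen g (\<phi> g)))" for z
  have goodI: "good z" if "finite S" "S \<subseteq> ?T" "\<forall>g\<in>?T. \<phi> g \<in> DHom A U X0 (k - n - dg g)"
      "\<forall>g\<in>?T - S. \<phi> g = 0" "z = (\<Sum>g\<in>S. gen g (\<phi> g))" for z S \<phi>
    unfolding good_def by (intro exI[of _ S] exI[of _ \<phi>] conjI that)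
  have TdC: "g \<in> DHom A Y0 V (dg g)" if "g \<in> ?T" for g using that TC dg by blast
  have oX: "U \<in> DObj A" "X0 \<in> DObj A" using base o by auto
  have good_sub: "bv.subspace {z. good z}"
    unfolding bv.subspace_def
  proof (intro conjI ballI allI)
    show "0 \<in> {z. good z}"
      unfolding mem_Collect_eq by (rule goodI[of "{}" "\<lambda>_. 0"]) (simp_all add: DHom_zero[OF oX])
    fix x assume "x \<in> {z. good z}"
    then obtain S \<phi> where 1: "finite S" "S \<subseteq> ?T" "\<And>g. g \<in> ?T \<Longrightarrow> \<phi> g \<in> DHom A U X0 (k - n - dg g)"
        "\<And>g. g \<in> ?T - S \<Longrightarrow> \<phi> g = 0" "x = (\<Sum>g\<in>S. gen g (\<phi> g))"
      unfolding good_def mem_Collect_eq by blast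
    show "BScale P c x \<in> {z. good z}" for c
    proof -
      have "BScale P c x = (\<Sum>g\<in>S. BScale P c (gen g (\<phi> g)))" unfolding 1(5) by (rule bv.scale_sum_right)
      also have "\<dots> = (\<Sum>g\<in>S. gen g (DScale A c (\<phi> g)))"
      proof (rule sum.cong[OF refl])
        fix g assume "g \<in> S"
        then have g: "g \<in> ?T" using 1(2) by blast
        show "BScale P c (gen g (\<phi> g)) = gen g (DScale A c (\<phi> g))"
          using gen_linear_right[OF o TdC[OF g], of "k - n - dg g"] 1(3)[OF g] unfolding linear_map_on_def by simp
      qed
      finally have "BScale P c x = (\<Sum>g\<in>S. gen g (DScale A c (\<phi> g)))" .
      moreover have "\<forall>g\<in>?T. DScale A c (\<phi> g) \<in> DHom A U X0 (k - n - dg g)" using 1(3) DHom_scale[OF oX] by blast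
      moreover have "\<forall>g\<in>?T - S. DScale A c (\<phi> g) = 0" using 1(4) by simp
      ultimately show ?thesis
        unfolding mem_Collect_eq by (intro goodI[OF 1(1,2), of "\<lambda>g. DScale A c (\<phi> g)"])
    qed
    fix y assume "y \<in> {z. good z}"
    then obtain S' \<phi>' where 2: "finite S'" "S' \<subseteq> ?T" "\<And>g. g \<in> ?T \<Longrightarrow> \<phi>' g \<in> DHom A U X0 (k - n - dg g)"
        "\<And>g. g \<in> ?T - S' \<Longrightarrow> \<phi>' g = 0" "y = (\<Sum>g\<in>S'. gen g (\<phi>' g))"
      unfolding good_def mem_Collect_eq by blast
    have n1: "\<forall>g\<in>S \<union> S' - S. gen g (\<phi> g) = 0" and n2: "\<forall>g\<in>S \<union> S' - S'. gen g (\<phi>' g) = 0"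
      using 1(2,4) 2(2,4) gen_zero(1)[OF o TdC] by (metis DiffD1 DiffD2 DiffI Un_iff subsetD)+
    have xs: "x = (\<Sum>g\<in>S \<union> S'. gen g (\<phi> g))"
      unfolding 1(5) using 1(1) 2(1) n1 by (intro sum.mono_neutral_left) auto
    have ys: "y = (\<Sum>g\<in>S \<union> S'. gen g (\<phi>' g))"
      unfolding 2(5) using 1(1) 2(1) n2 by (intro sum.mono_neutral_left) auto
    have "x + y = (\<Sum>g\<in>S \<union> S'. gen g (\<phi> g) + gen g (\<phi>' g))" unfolding xs ys by (rule sum.distrib[symmetric])
    also have "\<dots> = (\<Sum>g\<in>S \<union> S'. gen g (\<phi> g + \<phi>' g))"
    proof (rule sum.cong[OF refl])
      fix g assume "g \<in> S \<union> S'"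
      then have g: "g \<in> ?T" using 1(2) 2(2) by blast
      show "gen g (\<phi> g) + gen g (\<phi>' g) = gen g (\<phi> g + \<phi>' g)"
        using gen_linear_right[OF o TdC[OF g], of "k - n - dg g"] 1(3)[OF g] 2(3)[OF g] unfolding linear_map_on_def by simp
    qed
    finally have s: "x + y = (\<Sum>g\<in>S \<union> S'. gen g (\<phi> g + \<phi>' g))" .
    have "finite (S \<union> S')" "S \<union> S' \<subseteq> ?T" using 1(1,2) 2(1,2) by auto
    moreover have "\<forall>g\<in>?T. \<phi> g + \<phi>' g \<in> DHom A U X0 (k - n - dg g)" using 1(3) 2(3) DHom_add[OF oX] by blast
    moreover have "\<forall>g\<in>?T - (S \<union> S'). \<phi> g + \<phi>' g = 0" using 1(4) 2(4) by simp
    ultimately show "x + y \<in> {z. good z}"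
      unfolding mem_Collect_eq using s by (intro goodI[of "S \<union> S'" "\<lambda>g. \<phi> g + \<phi>' g"])
  qed
  have good_T: "good (gen g f)" if g: "g \<in> T a" and f: "f \<in> DHom A U X0 b" and ab: "a + n + b = k" for g f a b
  proof (rule goodI)
    have "b = k - n - dg g" using ab dg[OF g] by simp
    then show "\<forall>x\<in>?T. (if x = g then f else 0) \<in> DHom A U X0 (k - n - dg x)" using f DHom_zero[OF oX] by simp
    show "{g} \<subseteq> ?T" using g by blast
  qed auto
  have good_gen: "good (gen g f)" if g: "g \<in> ?C a" and f: "f \<in> DHom A U X0 b" and ab: "a + n + b = k" for g f a b
  proof -
    note lin = gen_linear_left[OF o f, of a]
    have "g \<in> dv.span (T a)" using KH(8) g unfolding T_def by blast
    then have "g \<in> ?C a \<and> good (gen g f)"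
    proof (induct rule: dv.span_induct_alt)
      case base
      show ?case using gen_zero(2)[OF o f] bv.subspace_0[OF good_sub] DHom_zero[OF oY] by simp
    next
      case (step c x y)
      have x: "x \<in> ?C a" using step(1) TC by blast
      have y: "y \<in> ?C a" "good (gen y f)" using step(2) by blast+
      have cx: "DScale A c x \<in> ?C a" using DHom_scale[OF oY x] .
      have "gen (DScale A c x + y) f = gen (DScale A c x) f + gen y f"
        using lin y(1) cx unfolding linear_map_on_def by blast
      also have "gen (DScale A c x) f = BScale P c (gen x f)"
        using lin x unfolding linear_map_on_def by blast
      finally have "gen (DScale A c x + y) f = BScale P c (gen x f) + gen y f" .
      then show ?case
        using bv.subspace_add[OF good_sub bv.subspace_scale[OF good_sub]] good_T[OF step(1) f ab] y(2)
          DHom_add[OF oY cx y(1)] by simp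
    qed
    then show ?thesis by blast
  qed
  have "BHom P U V k \<subseteq> {z. good z}"
    by (rule order_trans[OF gen_span[OF o]], rule bv.span_minimal[OF _ good_sub]) (use good_gen in blast)
  then have "good z" using z unfolding cocycles_def by blast
  then obtain S \<phi> where S: "finite S" "S \<subseteq> ?T" and \<phi>: "\<And>g. g \<in> ?T \<Longrightarrow> \<phi> g \<in> DHom A U X0 (k - n - dg g)"
      and \<phi>0: "\<And>g. g \<in> ?T - S \<Longrightarrow> \<phi> g = 0" and zS: "z = (\<Sum>g\<in>S. gen g (\<phi> g))"
    unfolding good_def by blast
  let ?d = "DDiff A"
  have KT: "?K \<subseteq> ?T" unfolding T_def by blast
  have dKT: "?d c \<in> T (dg c + 1)" if "c \<in> ?K" for c
    using dgK[OF that] unfolding T_def by simp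
  have dgd: "dg (?d c) = dg c + 1" if "c \<in> ?K" for c using dg[OF dKT[OF that]] .
  have injd: "inj_on ?d ?K"
  proof (rule inj_onI)
    fix c c' assume c: "c \<in> ?K" "c' \<in> ?K" "?d c = ?d c'"
    then have "dg c = dg c'" using dgd[of c] dgd[of c'] by simp
    then show "c = c'" using KH(4)[of "dg c"] dgK[OF c(1)] dgK[OF c(2)] c(3) unfolding inj_on_def by simp
  qed
  define HS where "HS = S \<inter> ?H"
  \<comment> \<open>Those elements of \<open>K\<close> that occur in \<open>z\<close> themselves or
    through their differential. With them the support can be enlarged to \<open>R\<close>, a
    disjoint union of \<open>HS\<close>, \<open>KS\<close> and the differentials of
    \<open>KS\<close>.\<close>
  define KS where "KS = (S \<inter> ?K) \<union> (?d -` S \<inter> ?K)"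
  have KSK: "KS \<subseteq> ?K" unfolding KS_def by blast
  have fKS: "finite KS" unfolding KS_def using S(1) finite_vimage_IntI[OF S(1) injd] by simp
  have fHS: "finite HS" unfolding HS_def using S(1) by simp
  define R where "R = HS \<union> KS \<union> ?d ` KS"
  have fR: "finite R" unfolding R_def using fKS fHS by simp
  have dKSR: "g \<in> ?T \<and> (\<exists>a. g \<in> ?d ` K (a - 1) \<and> g \<in> T a)" if gd: "g \<in> ?d ` KS" for g
  proof -
    obtain c where c: "c \<in> KS" "g = ?d c" using gd by blast
    have cK: "c \<in> ?K" using c(1) KSK by blast
    have "g \<in> ?d ` K (dg c + 1 - 1)" using dgK[OF cK] c(2) by simp
    moreover have "g \<in> T (dg c + 1)" using dKT[OF cK] c(2) by simp
    ultimately show ?thesis by blast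
  qed
  have HT: "HS \<subseteq> ?T" unfolding HS_def T_def by blast
  have RT: "R \<subseteq> ?T" unfolding R_def using HT KSK KT dKSR by blast
  have SR: "S \<subseteq> R"
  proof
    fix s assume s: "s \<in> S"
    then obtain a where "s \<in> T a" using S(2) by blast
    then consider "s \<in> K a" | "s \<in> H a" | c where "c \<in> K (a - 1)" "s = ?d c" unfolding T_def by blast
    then show "s \<in> R"
    proof cases
      case 1
      then show ?thesis using s unfolding R_def KS_def by blast
    next
      case 2
      then show ?thesis using s unfolding R_def HS_def by blast
    next
      case 3
      then have "c \<in> KS" using s unfolding KS_def by blast
      then show ?thesis using 3(2) unfolding R_def by blast
    qed
  qed
  have same: "a = b" if "x \<in> K a \<union> H a \<union> ?d ` K (a - 1)" "x \<in> K b \<union> H b \<union> ?d ` K (b - 1)" for x a b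
    using that Tdeg unfolding T_def by blast
  have disj: "HS \<inter> KS = {}" "(HS \<union> KS) \<inter> ?d ` KS = {}"
  proof -
    show "HS \<inter> KS = {}"
    proof (rule ccontr)
      assume "HS \<inter> KS \<noteq> {}"
      then obtain x a b where "x \<in> H a" "x \<in> K b" unfolding HS_def using KSK by blast
      then show False using same[of x a b] KH(5)[of a] by blast
    qed
    show "(HS \<union> KS) \<inter> ?d ` KS = {}"
    proof (rule ccontr)
      assume "(HS \<union> KS) \<inter> ?d ` KS \<noteq> {}"
      then obtain x where x: "x \<in> HS \<union> KS" "x \<in> ?d ` KS" by blast
      obtain a where a: "x \<in> H a \<union> K a" using x(1) KSK unfolding HS_def by blast
      obtain b where b: "x \<in> ?d ` K (b - 1)" using dKSR[OF x(2)] by blast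
      then show False using same[of x a b] KH(6)[of b] a by blast
    qed
  qed
  have sumR: "(\<Sum>g\<in>R. F g) = (\<Sum>h\<in>HS. F h) + (\<Sum>c\<in>KS. F c) + (\<Sum>c\<in>KS. F (?d c))" for F :: "'v \<Rightarrow> 'w"
  proof -
    have "(\<Sum>g\<in>R. F g) = (\<Sum>g\<in>HS \<union> KS. F g) + (\<Sum>g\<in>?d ` KS. F g)"
      unfolding R_def using fHS fKS disj by (intro sum.union_disjoint) auto
    also have "(\<Sum>g\<in>HS \<union> KS. F g) = (\<Sum>h\<in>HS. F h) + (\<Sum>c\<in>KS. F c)"
      using fHS fKS disj by (intro sum.union_disjoint) auto
    also have "(\<Sum>g\<in>?d ` KS. F g) = (\<Sum>c\<in>KS. F (?d c))"
      using inj_on_subset[OF injd KSK] by (simp add: sum.reindex)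
    finally show ?thesis .
  qed
  have zR: "z = (\<Sum>g\<in>R. gen g (\<phi> g))"
  proof -
    have "gen g (\<phi> g) = 0" if "g \<in> R - S" for g
    proof -
      have g: "g \<in> ?T" using that RT by blast
      then have "\<phi> g = 0" using that \<phi>0 by blast
      then show ?thesis using gen_zero(1)[OF o TdC[OF g]] by simp
    qed
    then show ?thesis unfolding zS using fR SR by (intro sum.mono_neutral_left) auto
  qed
  \<comment> \<open>\<open>\<xi>\<close> moves the coefficient of \<open>c\<close> to the basis
    element \<open>d c\<close>. This rewrites the part of the differential of \<open>z\<close> that
    comes from differentiating basis elements as a sum along the basis again.\<close>
  define \<xi> where "\<xi> g = (if g \<in> ?d ` KS then \<phi> (the_inv_into KS ?d g) else 0)" for g
  have \<xi>d: "\<xi> (?d c) = \<phi> c" if "c \<in> KS" for c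
    using the_inv_into_f_f[OF inj_on_subset[OF injd KSK] that] that unfolding \<xi>_def by simp
  have \<xi>0: "\<xi> g = 0" if "g \<in> HS \<union> KS" for g using that disj(2) unfolding \<xi>_def by auto
  have \<xi>T: "\<xi> g \<in> DHom A U X0 (k - n - dg g + 1)" for g
  proof (cases "g \<in> ?d ` KS")
    case True
    then obtain c where c: "c \<in> KS" "g = ?d c" by blast
    have cK: "c \<in> ?K" using c(1) KSK by blast
    have "\<phi> c \<in> DHom A U X0 (k - n - dg c)" using \<phi>[OF subsetD[OF KT cK]] .
    moreover have "k - n - dg g + 1 = k - n - dg c" using dgd[OF cK] c(2) by simp
    ultimately show ?thesis using \<xi>d[OF c(1)] c(2) by (simp only:)
  qed (simp add: \<xi>_def DHom_zero[OF oX])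
  have genR: "gen g (\<phi> g) \<in> BHom P U V k" if "g \<in> R" for g
    using gen_closed[OF o TdC[of g] \<phi>[of g]] subsetD[OF RT that] by simp
  have d\<phi>: "?d (\<phi> g) \<in> DHom A U X0 (k - n - dg g + 1)" if "g \<in> ?T" for g
    using DDiff_closed[OF oX \<phi>[OF that]] .
  have "0 = BDiff P z" using z unfolding cocycles_def by simp
  also have "\<dots> = (\<Sum>g\<in>R. BDiff P (gen g (\<phi> g)))"
    unfolding zR by (rule bv.linear_map_on_sum[OF BDiff_linear[OF o] subspace_BHom[OF o]]) (rule genR)
  also have "\<dots> = (\<Sum>g\<in>R. gen (?d g) (\<phi> g) + gen g (koszul (dg g + n) (?d (\<phi> g))))"
  proof (rule sum.cong[OF refl])
    fix g assume "g \<in> R"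
    then have g: "g \<in> ?T" using RT by blast
    show "BDiff P (gen g (\<phi> g)) = gen (?d g) (\<phi> g) + gen g (koszul (dg g + n) (?d (\<phi> g)))"
      using BDiff_gen[OF o TdC[OF g] \<phi>[OF g]] gen_koszul[OF o TdC[OF g] d\<phi>[OF g]] by simp
  qed
  also have "\<dots> = (\<Sum>g\<in>R. gen (?d g) (\<phi> g)) + (\<Sum>g\<in>R. gen g (koszul (dg g + n) (?d (\<phi> g))))"
    by (rule sum.distrib)
  also have "(\<Sum>g\<in>R. gen (?d g) (\<phi> g)) = (\<Sum>c\<in>KS. gen (?d c) (\<phi> c))"
  proof -
    have "gen (?d h) (\<phi> h) = 0" if "h \<in> HS" for h
    proof -
      have "DDiff A h = 0" using that KH(3) unfolding HS_def by blast
      then show ?thesis using gen_zero(2)[OF o \<phi>[OF subsetD[OF HT that]]] by simp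
    qed
    moreover have "gen (?d (?d c)) (\<phi> (?d c)) = 0" if "c \<in> KS" for c
    proof -
      have c: "c \<in> ?K" using that KSK by blast
      have "?d (?d c) = 0" using DDiff_DDiff[OF oY TdC[OF subsetD[OF KT c]]] .
      moreover have "?d c \<in> ?T" using dKT[OF c] by blast
      ultimately show ?thesis using gen_zero(2)[OF o \<phi>, of "?d c"] by simp
    qed
    ultimately show ?thesis unfolding sumR by simp
  qed
  also have "\<dots> = (\<Sum>g\<in>R. gen g (\<xi> g))"
  proof -
    have "gen h (\<xi> h) = 0" if "h \<in> HS \<union> KS" for h
    proof -
      have "h \<in> ?T" using that RT unfolding R_def by blast
      then show ?thesis using \<xi>0[OF that] gen_zero(1)[OF o TdC] by simp
    qed
    then show ?thesis unfolding sumR using \<xi>d by simp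
  qed
  also have "\<dots> + (\<Sum>g\<in>R. gen g (koszul (dg g + n) (?d (\<phi> g)))) = (\<Sum>g\<in>R. gen g (\<xi> g + koszul (dg g + n) (?d (\<phi> g))))"
    unfolding sum.distrib[symmetric]
  proof (rule sum.cong[OF refl])
    fix g assume gR: "g \<in> R"
    then have g: "g \<in> ?T" using RT by blast
    note \<xi>g = \<xi>T[of g]
    show "gen g (\<xi> g) + gen g (koszul (dg g + n) (?d (\<phi> g))) = gen g (\<xi> g + koszul (dg g + n) (?d (\<phi> g)))"
      using gen_linear_right[OF o TdC[OF g], of "k - n - dg g + 1"] \<xi>g DHom_koszul[OF oX d\<phi>[OF g]]
      unfolding linear_map_on_def by simp
  qed
  finally have sum0: "(\<Sum>g\<in>R. gen g (\<xi> g + koszul (dg g + n) (?d (\<phi> g)))) = 0" by simp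
  have typed: "\<xi> g + koszul (dg g + n) (?d (\<phi> g)) \<in> (\<Union>b. DHom A U X0 b)" if gR: "g \<in> R" for g
  proof -
    have g: "g \<in> ?T" using gR RT by blast
    note \<xi>g = \<xi>T[of g]
    show ?thesis using DHom_add[OF oX \<xi>g DHom_koszul[OF oX d\<phi>[OF g]]] by blast
  qed
  have RC: "R \<subseteq> (\<Union>a. ?C a)" using RT TC by blast
  \<comment> \<open>Comparison of coefficients in the vanishing differential of \<open>z\<close>: at
    \<open>h\<close> in \<open>HS\<close> it says that \<open>\<phi> h\<close> is closed, at
    \<open>d c\<close> it expresses \<open>\<phi> c\<close> through the differential of
    \<open>\<phi> (d c)\<close>.\<close>
  have zero: "\<xi> g + koszul (dg g + n) (?d (\<phi> g)) = 0" if "g \<in> R" for g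
    by (rule gen_injective[OF o fR RC dv.independent_mono[OF indT RT] typed sum0 that])
  have hZ: "?d (\<phi> h) = 0" if "h \<in> HS" for h
  proof -
    have "h \<in> R" using that unfolding R_def by blast
    then show ?thesis using zero[of h] \<xi>0[of h] that by simp
  qed
  \<comment> \<open>\<open>d c\<close> has degree one more than \<open>c\<close>, and the resulting
    change of sign absorbs the minus sign from solving for \<open>\<phi> c\<close>.\<close>
  have cK: "\<phi> c = koszul (dg c + n) (?d (\<phi> (?d c)))" if "c \<in> KS" for c
  proof -
    have "\<phi> c + koszul (dg c + 1 + n) (?d (\<phi> (?d c))) = 0"
    proof -
      have "?d c \<in> R" "c \<in> ?K" using that KSK unfolding R_def by blast+
      then show ?thesis using zero[of "?d c"] \<xi>d[OF that] dgd[of c] by simp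
    qed
    then show ?thesis unfolding koszul_def by (auto simp: add_eq_0_iff split: if_splits)
  qed
  \<comment> \<open>By the previous identity the differential of \<open>y\<close> consists exactly
    of the terms of \<open>z\<close> at \<open>c\<close> and at \<open>d c\<close>, so only those
    along \<open>HS\<close> are left.\<close>
  define y where "y = (\<Sum>c\<in>KS. gen c (\<phi> (?d c)))"
  have yc: "gen c (\<phi> (?d c)) \<in> BHom P U V (k - 1)" "BDiff P (gen c (\<phi> (?d c))) = gen c (\<phi> c) + gen (?d c) (\<phi> (?d c))"
    if "c \<in> KS" for c
  proof -
    have c: "c \<in> ?T" "c \<in> ?K" using that KSK KT by blast+
    have dc: "?d c \<in> ?T" using dKT[OF c(2)] by blast
    note \<phi>d = \<phi>[OF dc]
    show "gen c (\<phi> (?d c)) \<in> BHom P U V (k - 1)"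
      by (rule gen_closed[OF o TdC[OF c(1)] \<phi>d]) (simp add: dgd[OF c(2)])
    show "BDiff P (gen c (\<phi> (?d c))) = gen c (\<phi> c) + gen (?d c) (\<phi> (?d c))"
      using BDiff_gen[OF o TdC[OF c(1)] \<phi>d] gen_koszul[OF o TdC[OF c(1)] d\<phi>[OF dc], of "dg c + n"] cK[OF that] by simp
  qed
  have y: "y \<in> BHom P U V (k - 1)"
    unfolding y_def by (rule bv.subspace_sum[OF subspace_BHom[OF o] yc(1)])
  have dy: "BDiff P y = (\<Sum>c\<in>KS. gen c (\<phi> c) + gen (?d c) (\<phi> (?d c)))"
  proof -
    have "BDiff P y = (\<Sum>c\<in>KS. BDiff P (gen c (\<phi> (?d c))))"
      unfolding y_def by (rule bv.linear_map_on_sum[OF BDiff_linear[OF o] subspace_BHom[OF o] yc(1)])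
    also have "\<dots> = (\<Sum>c\<in>KS. gen c (\<phi> c) + gen (?d c) (\<phi> (?d c)))"
      by (rule sum.cong[OF refl yc(2)])
    finally show ?thesis .
  qed
  have zy: "z = (\<Sum>h\<in>HS. gen h (\<phi> h)) + BDiff P y"
    unfolding zR sumR dy by (simp add: sum.distrib add.assoc)
  have hh: "h \<in> DZ A Y0 V (dg h)" "\<phi> h \<in> DZ A U X0 (k - n - dg h)" if "h \<in> HS" for h
  proof -
    have "h \<in> ?T" "DDiff A h = 0" using that HT KH(3) unfolding HS_def by blast+
    then show "h \<in> DZ A Y0 V (dg h)" "\<phi> h \<in> DZ A U X0 (k - n - dg h)"
      using TdC \<phi> hZ[OF that] unfolding cocycles_def by simp_all
  qed
  show thesis by (rule that[OF fHS y hh zy])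
qed

text \<open>By the decomposition it suffices to treat tensors \<open>h \<otimes> \<phi>\<close> of
  cocycles. If \<open>f h = d w\<close>, then the image of such a tensor is the differential of
  \<open>w \<otimes> \<phi>\<close>. So only morphisms out of the fixed object \<open>Y0\<close>
  matter.\<close>

lemma cocycle_killed:
  assumes o: "U \<in> DObj A" "V \<in> DObj A" "V' \<in> DObj A" and f: "cocyc f V V'"
    and kill: "\<And>a x. x \<in> DZ A Y0 V a \<Longrightarrow> f \<odot> x \<in> DB A Y0 V' a"
    and z: "z \<in> BZ P U V k"
  shows "LAct P f z \<in> BB P U V' k"
proof -
  obtain Hf \<phi> y a where fin: "finite Hf" and y: "y \<in> BHom P U V (k - 1)"
    and h: "\<And>h. h \<in> Hf \<Longrightarrow> h \<in> DZ A Y0 V (a h)" and \<phi>: "\<And>h. h \<in> Hf \<Longrightarrow> \<phi> h \<in> DZ A U X0 (k - n - a h)"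
    and zd: "z = (\<Sum>h\<in>Hf. gen h (\<phi> h)) + BDiff P y"
    by (rule cocycle_decomposition[OF o(1,2) z]) (rule that; assumption)
  have hC: "h \<in> DHom A Y0 V (a h)" "\<phi> h \<in> DHom A U X0 (k - n - a h)" "DDiff A (\<phi> h) = 0" if "h \<in> Hf" for h
    using h[OF that] \<phi>[OF that] unfolding cocycles_def by auto
  have "\<exists>w. w \<in> DHom A Y0 V' (a h - 1) \<and> f \<odot> h = DDiff A w" if "h \<in> Hf" for h
    using kill[OF h[OF that]] unfolding coboundaries_def by blast
  then obtain w where w: "\<And>h. h \<in> Hf \<Longrightarrow> w h \<in> DHom A Y0 V' (a h - 1)" "\<And>h. h \<in> Hf \<Longrightarrow> f \<odot> h = DDiff A (w h)"
    by metis
  have g1: "gen h (\<phi> h) \<in> BHom P U V k" if "h \<in> Hf" for h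
    by (rule gen_closed[OF o(1,2) hC(1,2)[OF that]]) simp
  have g2: "gen (w h) (\<phi> h) \<in> BHom P U V' (k - 1)" if "h \<in> Hf" for h
    by (rule gen_closed[OF o(1,3) w(1)[OF that] hC(2)[OF that]]) simp
  have f0: "f \<in> DHom A V V' 0" using f unfolding cocyc_def cocycles_def by blast
  have step: "LAct P f (gen h (\<phi> h)) = BDiff P (gen (w h) (\<phi> h))" if "h \<in> Hf" for h
  proof -
    have "LAct P f (gen h (\<phi> h)) = gen (f \<odot> h) (\<phi> h)"
      using LAct_DComp[OF o(1) base(2) o(2,3) f0 hC(1)[OF that] RAct_e[OF o(1) hC(2)[OF that]]]
      unfolding gen_def by simp
    then show ?thesis
      using BDiff_gen[OF o(1,3) w(1)[OF that] hC(2)[OF that]] w(2)[OF that] hC(3)[OF that]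
        gen_zero(1)[OF o(1,3) w(1)[OF that]] by simp
  qed
  have dy: "BDiff P y \<in> BHom P U V k" using BDiff_closed[OF o(1,2) y] by simp
  have s: "(\<Sum>h\<in>Hf. gen h (\<phi> h)) \<in> BHom P U V k"
    by (rule bv.subspace_sum[OF subspace_BHom[OF o(1,2)] g1])
  have s2: "(\<Sum>h\<in>Hf. gen (w h) (\<phi> h)) \<in> BHom P U V' (k - 1)"
    by (rule bv.subspace_sum[OF subspace_BHom[OF o(1,3)] g2])
  have fy: "LAct P f y \<in> BHom P U V' (k - 1)" using LAct_cocyc(1)[OF o(1) f y] .
  note lin = LAct_linear[OF o(1) f, of k]
  have "LAct P f z = LAct P f (\<Sum>h\<in>Hf. gen h (\<phi> h)) + LAct P f (BDiff P y)"
    using lin s dy unfolding zd linear_map_on_def by blast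
  also have "LAct P f (\<Sum>h\<in>Hf. gen h (\<phi> h)) = (\<Sum>h\<in>Hf. BDiff P (gen (w h) (\<phi> h)))"
  proof -
    have "LAct P f (\<Sum>h\<in>Hf. gen h (\<phi> h)) = (\<Sum>h\<in>Hf. LAct P f (gen h (\<phi> h)))"
      by (rule bv.linear_map_on_sum[OF lin subspace_BHom[OF o(1,2)] g1])
    also have "\<dots> = (\<Sum>h\<in>Hf. BDiff P (gen (w h) (\<phi> h)))"
      by (rule sum.cong[OF refl step])
    finally show ?thesis .
  qed
  also have "\<dots> = BDiff P (\<Sum>h\<in>Hf. gen (w h) (\<phi> h))"
    by (rule bv.linear_map_on_sum[OF BDiff_linear[OF o(1,3)] subspace_BHom[OF o(1,3)] g2, symmetric])
  also have "LAct P f (BDiff P y) = BDiff P (LAct P f y)" using LAct_cocyc(2)[OF o(1) f y] by simp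
  finally have "LAct P f z = BDiff P ((\<Sum>h\<in>Hf. gen (w h) (\<phi> h)) + LAct P f y)"
    using BDiff_add[OF o(1,3) s2 fy] by simp
  then show ?thesis by (rule BB_I[OF BHom_add[OF o(1,3) s2 fy]])
qed

end

section \<open>From representable bimodules to the diagonal\<close>

context dg_category_with_class
begin

text \<open>The length may depend on \<open>Y0\<close>: a perfect bimodule is built from finitely
  many representable ones, and every way of combining them keeps a finite length.\<close>

lemma killed_perfect:
  assumes kill: "\<And>Y0. Y0 \<in> DObj A \<Longrightarrow> \<exists>J. \<forall>Y Z f a x. S_chain J Y Z f \<longrightarrow> x \<in> DZ A Y0 Y a \<longrightarrow> f \<odot> x \<in> DB A Y0 Z a"
    and M: "perfect_bimod A M"
  shows "\<exists>J. killed J M"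
  using M
proof (induct rule: perfect_bimod.induct)
  case (representable P X0 Y0 n e)
  interpret representable_bimodule A P X0 Y0 n e
    using representable by (intro representable_bimodule.intro representable_bimodule_axioms.intro)
      (auto simp: representable_bimod_def)
  obtain J where J: "\<And>Y Z f a x. \<lbrakk>S_chain J Y Z f; x \<in> DZ A Y0 Y a\<rbrakk> \<Longrightarrow> f \<odot> x \<in> DB A Y0 Z a"
    using kill[OF base(2)] by blast
  have "killed J P"
    by (rule killedI) (blast intro: cocycle_killed J)
  then show ?case by blast
next
  case (qiso_right M N \<psi>)
  then show ?case using killed_quasi_iso_right by blast
next
  case (qiso_left N M \<psi>)
  then show ?case using killed_quasi_iso_left by blast
next
  case (exact_left L M N)
  then show ?case using killed_short_exact(1) by blast
next
  case (exact_middle L M N)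
  then show ?case using killed_short_exact(2) by blast
next
  case (exact_right L M N)
  then show ?case using killed_short_exact(3) by blast
next
  case (retract M L)
  then show ?case using killed_retract by blast
qed

text \<open>In the diagonal bimodule a chain acting on the identity of its source returns the chain
  itself, so acting as zero on cohomology makes it a coboundary.\<close>

lemma smooth_kills:
  assumes kill: "\<And>Y0. Y0 \<in> DObj A \<Longrightarrow> \<exists>J. \<forall>Y Z f a x. S_chain J Y Z f \<longrightarrow> x \<in> DZ A Y0 Y a \<longrightarrow> f \<odot> x \<in> DB A Y0 Z a"
    and smooth: "smooth_dg TYPE('w::ab_group_add) A"
  shows "\<exists>J. \<forall>X Y f. S_chain J X Y f \<longrightarrow> f \<in> DB A X Y 0"
proof -
  obtain M :: "('a, 'v, 'w, 'k) dg_bimod" and \<psi> where M: "perfect_bimod A M" "quasi_iso A M (diagonal_bimod A) \<psi>"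
    using smooth unfolding smooth_dg_def by blast
  obtain J where "killed J M" using killed_perfect[OF kill M(1)] by blast
  then have k: "killed J (diagonal_bimod A)" using killed_quasi_iso_right[OF M(2)] by blast
  have "f \<in> DB A X Y 0" if f: "S_chain J X Y f" for X Y f
  proof -
    have c: "cocyc f X Y" using S_chain_cocyc[OF f] .
    then have X: "X \<in> DObj A" "Y \<in> DObj A" "f \<in> DHom A X Y 0" unfolding cocyc_def cocycles_def by auto
    have "DIdent A X \<in> BZ (diagonal_bimod A) X X 0"
      using cocyc_DIdent[OF X(1)] unfolding cocyc_def diagonal_bimod_def by simp
    from killedD[OF k X(1) f this] show ?thesis
      using DIdent_right[OF X] unfolding diagonal_bimod_def by simp
  qed
  then show ?thesis by blast
qed

end

section \<open>Composites of ghosts vanish\<close>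

text \<open>Composition with a closed \<open>u\<close> that has a closed right inverse is undone by
  that inverse. This trades the degree \<open>b\<close> for \<open>b + p\<close> and the source
  \<open>X\<close> for \<open>X'\<close>.\<close>

lemma (in dg_category) coboundary_transport:
  assumes o: "X \<in> DObj A" "X' \<in> DObj A" "Y \<in> DObj A" "Z \<in> DObj A"
    and u: "u \<in> DZ A X' X p" "v \<in> DZ A X X' (- p)" "u \<odot> v = DIdent A X"
    and f: "f \<in> DHom A Y Z 0" and x: "x \<in> DHom A X Y b" and xu: "f \<odot> (x \<odot> u) \<in> DB A X' Z (b + p)"
  shows "f \<odot> x \<in> DB A X Z b"
proof -
  have u': "u \<in> DHom A X' X p" "v \<in> DHom A X X' (- p)" "DDiff A v = 0"
    using u unfolding cocycles_def by auto
  obtain w where w: "w \<in> DHom A X' Z (b + p - 1)" "f \<odot> (x \<odot> u) = DDiff A w"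
    using xu unfolding coboundaries_def by blast
  have fx: "f \<odot> x \<in> DHom A X Z b" using DComp_closed[OF o(1,3,4) f x] by simp
  have "f \<odot> x = (f \<odot> x) \<odot> (u \<odot> v)" using DIdent_right[OF o(1,4) fx] u(3) by simp
  also have "\<dots> = ((f \<odot> x) \<odot> u) \<odot> v" using DComp_assoc[OF o(1,2,1,4) fx u'(1,2)] by simp
  also have "(f \<odot> x) \<odot> u = DDiff A w" using DComp_assoc[OF o(2,1,3,4) f x u'(1)] w(2) by simp
  also have "DDiff A w \<odot> v = DDiff A (w \<odot> v)"
    using DDiff_DComp[OF o(1,2,4) w(1) u'(2)] u'(3) DComp_zero(1)[OF o(1,2,4) w(1)] by simp
  finally have eq: "f \<odot> x = DDiff A (w \<odot> v)" .
  have "w \<odot> v \<in> DHom A X Z (b - 1)" using DComp_closed[OF o(1,2,4) w(1) u'(2)] by simp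
  then show ?thesis unfolding eq coboundaries_def by blast
qed

lemma (in dg_category) DZ_DComp:
  assumes o: "X \<in> DObj A" "Y \<in> DObj A" "Z \<in> DObj A" and g: "g \<in> DZ A Y Z m" and f: "f \<in> DZ A X Y n"
  shows "g \<odot> f \<in> DZ A X Z (m + n)"
proof -
  have g': "g \<in> DHom A Y Z m" "DDiff A g = 0" and f': "f \<in> DHom A X Y n" "DDiff A f = 0"
    using f g unfolding cocycles_def by auto
  show ?thesis
    using DComp_closed[OF o g'(1) f'(1)] DDiff_DComp[OF o g'(1) f'(1)] g' f'
      DComp_zero(1)[OF o g'(1)] DComp_zero(2)[OF o f'(1)]
    unfolding cocycles_def by simp
qed

context generated_category
begin

text \<open>Ghosts live in \<open>D\<close>, bimodules over its enhancement. Chains of closed lifts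
  of ghosts kill degree 0 morphisms out of \<open>Y0\<close> by the ghost lemma, and morphisms of
  other degrees after shifting the source. Smoothness then bounds the length, and chains in
  \<open>D\<close> lift to the enhancement up to isomorphism.\<close>

lemma ghosts_vanish:
  fixes A :: "('a, 'v::ab_group_add, 'k) dg_cat"
  assumes enh: "dg_enhancement D A \<phi> \<pi>" and smooth: "smooth_dg TYPE('w::ab_group_add) A"
  shows "\<exists>J. \<forall>X Y f. ghosts G J X Y f \<longrightarrow> f = 0"
proof -
  interpret A: dg_category A using enh unfolding dg_enhancement_def by blast
  define S where "S X Y f \<longleftrightarrow> A.cocyc f X Y \<and> ghost G (\<phi> X) (\<phi> Y) (\<pi> f)" for X Y f
  interpret A: dg_category_with_class A S
    by unfold_locales (auto simp: S_def)
  have e: "strongly_pretriangulated A"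
     "\<forall>X\<in>DObj A. \<phi> X \<in> Obj D"
     "\<forall>E\<in>Obj D. \<exists>X\<in>DObj A. \<exists>u. is_iso D (\<phi> X) E u"
     "\<forall>X\<in>DObj A. \<forall>Y\<in>DObj A. linear_map_on (DScale A) (Scale D) (DZ A X Y 0) \<pi> \<and>
        \<pi> ` DZ A X Y 0 = Hom D (\<phi> X) (\<phi> Y) \<and> (\<forall>f\<in>DZ A X Y 0. \<pi> f = 0 \<longleftrightarrow> f \<in> DB A X Y 0)"
     "\<forall>X\<in>DObj A. \<pi> (DIdent A X) = Ident D (\<phi> X)"
     "\<forall>X\<in>DObj A. \<forall>Y\<in>DObj A. \<forall>Z\<in>DObj A. \<forall>g\<in>DZ A Y Z 0. \<forall>f\<in>DZ A X Y 0.
        \<pi> (DComp A g f) = Comp D (\<pi> g) (\<pi> f)"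
    using enh unfolding dg_enhancement_def by - (elim conjE, assumption)+
  have pre: "strongly_pretriangulated A" by (rule e)
  have \<phi>: "\<phi> X \<in> Obj D" if "X \<in> DObj A" for X using e(2) that by blast
  have ess: "\<exists>X\<in>DObj A. \<exists>u. is_iso D (\<phi> X) E u" if "E \<in> Obj D" for E using e(3) that by blast
  have \<pi>_im: "\<pi> ` DZ A X Y 0 = Hom D (\<phi> X) (\<phi> Y)" if "X \<in> DObj A" "Y \<in> DObj A" for X Y
    using e(4) that by simp
  have \<pi>0: "\<pi> f = 0 \<longleftrightarrow> f \<in> DB A X Y 0" if "A.cocyc f X Y" for f X Y
    using e(4) that unfolding A.cocyc_def by simp
  have \<pi>I: "\<pi> (DIdent A X) = Ident D (\<phi> X)" if "X \<in> DObj A" for X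
    using e(5) that by blast
  have \<pi>C: "\<pi> (DComp A g f) = \<pi> g \<cdot> \<pi> f" if "A.cocyc g Y Z" "A.cocyc f X Y" for f g X Y Z
    using e(6) that unfolding A.cocyc_def by blast
  have \<pi>a: "arr (\<pi> f) (\<phi> X) (\<phi> Y)" if "A.cocyc f X Y" for f X Y
    using \<pi>_im[of X Y] \<phi> that unfolding A.cocyc_def arr_def by blast
  have \<pi>s: "\<exists>f. A.cocyc f X Y \<and> \<pi> f = g" if "arr g (\<phi> X) (\<phi> Y)" and o: "X \<in> DObj A" "Y \<in> DObj A" for g X Y
  proof -
    have "g \<in> \<pi> ` DZ A X Y 0" unfolding \<pi>_im[OF o] using that unfolding arr_def by blast
    then show ?thesis unfolding A.cocyc_def using o by blast
  qed
  have "\<exists>\<theta>. \<forall>X Y s t. dg_shift A X Y s t \<longrightarrow> is_iso D (\<phi> Y) (Sh D 1 (\<phi> X)) (\<theta> X Y s)"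
    using enh unfolding dg_enhancement_def by - (elim conjE exE, rule exI, assumption)
  then have shift_iso: "isomorphic (\<phi> Y) (Sh D 1 (\<phi> X))" if "dg_shift A X Y s t" for X Y s t
    using that \<phi> Sh_closed unfolding isomorphic_def dg_shift_def by blast
  have chain_ghosts: "ghosts G j (\<phi> X) (\<phi> Y) (\<pi> f)" if "A.S_chain j X Y f" for j X Y f
    using that
  proof (induct rule: chain.induct)
    case (chain_0 X)
    then show ?case using chain.chain_0[OF \<phi>] \<pi>I by metis
  next
    case (chain_Suc n X Y f Z g)
    have "\<pi> (DComp A g f) = \<pi> g \<cdot> \<pi> f"
      using \<pi>C A.S_chain_cocyc[OF chain_Suc(1)] chain_Suc(3) unfolding S_def by blast
    moreover have "ghost G (\<phi> Y) (\<phi> Z) (\<pi> g)" using chain_Suc(3) unfolding S_def by blast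
    ultimately show ?case using chain.chain_Suc[OF chain_Suc(2)] by simp
  qed
  have kill: "\<exists>J. \<forall>Y Z f a x. A.S_chain J Y Z f \<longrightarrow> x \<in> DZ A Y0 Y a \<longrightarrow> DComp A f x \<in> DB A Y0 Z a"
    if Y0: "Y0 \<in> DObj A" for Y0
  proof -
    obtain ns B where B: "filt G ns B" "is_retract (\<phi> Y0) B" using generates[OF \<phi>[OF Y0]] by blast
    let ?J = "length ns"
    \<comment> \<open>A dg shift matches the shift in \<open>D\<close> only up to isomorphism, so
      the induction over degrees runs over all dg objects that are retracts of shifts of
      \<open>\<phi> Y0\<close>. Shifting keeps the number of filtration steps, so one length serves
      them all.\<close>
    define near where "near Y \<longleftrightarrow> Y \<in> DObj A \<and> (\<exists>k. is_retract (\<phi> Y) (Sh D k (\<phi> Y0)))" for Y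
    have killD: "f \<cdot> x = 0" if U: "is_retract U (Sh D k (\<phi> Y0))" and f: "ghosts G ?J X Y f" and x: "arr x U X"
      for U k X Y f x
    proof (rule ghosts_retract_zero[OF filt_shift[OF G B(1), of k] _ _ x])
      show "is_retract U (Sh D k B)" using is_retract_trans[OF U is_retract_Sh[OF B(2)]] .
      show "ghosts G (length (map (\<lambda>n. k + n) ns)) X Y f" using f by simp
    qed
    have "\<forall>Y1. near Y1 \<longrightarrow> (\<forall>Y Z f x. A.S_chain ?J Y Z f \<longrightarrow> x \<in> DZ A Y1 Y a \<longrightarrow> DComp A f x \<in> DB A Y1 Z a)" for a
    proof (induct a rule: int_induct[where k = 0])
      case base
      show ?case
      proof (intro allI impI)
        fix Y1 Y Z f x
        assume n: "near Y1" and f: "A.S_chain ?J Y Z f" and x: "x \<in> DZ A Y1 Y 0"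
        have c: "A.cocyc f Y Z" using A.S_chain_cocyc[OF f] .
        then have cx: "A.cocyc x Y1 Y" using n x unfolding near_def A.cocyc_def by blast
        obtain k where "is_retract (\<phi> Y1) (Sh D k (\<phi> Y0))" using n unfolding near_def by blast
        then have "\<pi> f \<cdot> \<pi> x = 0" using killD chain_ghosts[OF f] \<pi>a[OF cx] by blast
        then have "\<pi> (DComp A f x) = 0" using \<pi>C[OF c cx] by simp
        then show "DComp A f x \<in> DB A Y1 Z 0" using \<pi>0[OF A.cocyc_DComp[OF c cx]] by blast
      qed
    next
      case (step1 i)
      show ?case
      proof (intro allI impI)
        fix Y1 Y Z f x
        assume n: "near Y1" and f: "A.S_chain ?J Y Z f" and x: "x \<in> DZ A Y1 Y (i + 1)"
        have o: "Y1 \<in> DObj A" "Y \<in> DObj A" "Z \<in> DObj A" and f0: "f \<in> DHom A Y Z 0"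
          using n A.S_chain_cocyc[OF f] unfolding near_def A.cocyc_def cocycles_def by auto
        \<comment> \<open>\<open>Y1\<close> is written as \<open>Y2[1]\<close>; composing with
          \<open>s\<close>, of degree -1, lowers the degree of \<open>x\<close> to
          \<open>i\<close>.\<close>
        obtain Y2 s t where st: "dg_shift A Y2 Y1 s t"
          using pre o(1) unfolding strongly_pretriangulated_def by blast
        then have Y2: "Y2 \<in> DObj A" "s \<in> DZ A Y2 Y1 (-1)" "t \<in> DZ A Y1 Y2 1" "DComp A s t = DIdent A Y1"
          unfolding dg_shift_def by auto
        obtain k where k: "is_retract (\<phi> Y1) (Sh D k (\<phi> Y0))" using n unfolding near_def by blast
        have "is_retract (Sh D 1 (\<phi> Y2)) (Sh D k (\<phi> Y0))"
          using is_retract_trans[OF is_retract_isomorphic[OF isomorphic_sym[OF shift_iso[OF st]]] k] .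
        from is_retract_Sh[OF this, of "-1"] have "is_retract (\<phi> Y2) (Sh D (-1 + k) (\<phi> Y0))"
          using Sh_cancel(1)[OF \<phi>[OF Y2(1)], of 1] Sh_add[OF \<phi>[OF Y0], of "-1" k] by simp
        then have n2: "near Y2" using Y2(1) unfolding near_def by blast
        have "DComp A x s \<in> DZ A Y2 Y (i + 1 + -1)" using A.DZ_DComp[OF Y2(1) o(1,2) x Y2(2)] .
        then have xs: "DComp A x s \<in> DZ A Y2 Y i" by simp
        have "DComp A f (DComp A x s) \<in> DB A Y2 Z (i + 1 + -1)"
          using step1(2) n2 f xs by simp
        moreover have "t \<in> DZ A Y1 Y2 (- (-1))" using Y2(3) by simp
        ultimately show "DComp A f x \<in> DB A Y1 Z (i + 1)"
          using A.coboundary_transport[OF o(1) Y2(1) o(2,3) Y2(2) _ Y2(4) f0] x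
          unfolding cocycles_def by blast
      qed
    next
      case (step2 i)
      show ?case
      proof (intro allI impI)
        fix Y1 Y Z f x
        assume n: "near Y1" and f: "A.S_chain ?J Y Z f" and x: "x \<in> DZ A Y1 Y (i - 1)"
        have o: "Y1 \<in> DObj A" "Y \<in> DObj A" "Z \<in> DObj A" and f0: "f \<in> DHom A Y Z 0"
          using n A.S_chain_cocyc[OF f] unfolding near_def A.cocyc_def cocycles_def by auto
        \<comment> \<open>Now \<open>Y2\<close> is \<open>Y1[1]\<close>, and composing with
          \<open>t\<close>, of degree 1, raises the degree of \<open>x\<close> to
          \<open>i\<close>.\<close>
        obtain Y2 s t where st: "dg_shift A Y1 Y2 s t"
          using pre o(1) unfolding strongly_pretriangulated_def by blast
        then have Y2: "Y2 \<in> DObj A" "s \<in> DZ A Y1 Y2 (-1)" "t \<in> DZ A Y2 Y1 1" "DComp A t s = DIdent A Y1"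
          unfolding dg_shift_def by auto
        obtain k where k: "is_retract (\<phi> Y1) (Sh D k (\<phi> Y0))" using n unfolding near_def by blast
        have "is_retract (\<phi> Y2) (Sh D 1 (Sh D k (\<phi> Y0)))"
          using is_retract_trans[OF is_retract_isomorphic[OF shift_iso[OF st]] is_retract_Sh[OF k]] .
        then have "is_retract (\<phi> Y2) (Sh D (1 + k) (\<phi> Y0))"
          using Sh_add[OF \<phi>[OF Y0], of 1 k] by simp
        then have n2: "near Y2" using Y2(1) unfolding near_def by blast
        have "DComp A x t \<in> DZ A Y2 Y (i - 1 + 1)" using A.DZ_DComp[OF Y2(1) o(1,2) x Y2(3)] .
        then have xs: "DComp A x t \<in> DZ A Y2 Y i" by simp
        have "DComp A f (DComp A x t) \<in> DB A Y2 Z (i - 1 + 1)"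
          using step2(2) n2 f xs by simp
        then show "DComp A f x \<in> DB A Y1 Z (i - 1)"
          using A.coboundary_transport[OF o(1) Y2(1) o(2,3) Y2(3) Y2(2) Y2(4) f0] x
          unfolding cocycles_def by blast
      qed
    qed
    moreover have "near Y0"
    proof -
      have "is_retract (\<phi> Y0) (Sh D 0 (\<phi> Y0))"
        using is_retract_isomorphic[OF isomorphic_refl[OF \<phi>[OF Y0]]] Sh_0[OF \<phi>[OF Y0]] by simp
      then show ?thesis unfolding near_def using Y0 by blast
    qed
    ultimately show ?thesis by blast
  qed
  obtain J where J: "\<And>X Y f. A.S_chain J X Y f \<Longrightarrow> f \<in> DB A X Y 0"
    using A.smooth_kills[OF kill smooth] by blast
  \<comment> \<open>Objects of \<open>D\<close> are merely isomorphic to images of dg objects, so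
    the chain is lifted one ghost at a time and conjugated by the comparison maps.\<close>
  have lift: "\<exists>X' v v' f'. X' \<in> DObj A \<and> arr v (\<phi> X') E' \<and> arr v' E' (\<phi> X') \<and> v \<cdot> v' = Ident D E'
      \<and> A.S_chain j X X' f' \<and> \<pi> f' = v' \<cdot> (f \<cdot> u)"
    if "ghosts G j E E' f" and X: "X \<in> DObj A" and u: "arr u (\<phi> X) E" "arr u' E (\<phi> X)"
      "u' \<cdot> u = Ident D (\<phi> X)" "u \<cdot> u' = Ident D E" for j E E' f X u u'
    using that(1) u
  proof (induct rule: chain.induct)
    case (chain_0 E)
    have "\<pi> (DIdent A X) = u' \<cdot> (Ident D E \<cdot> u)"
      using \<pi>I[OF X] chain_0 id_left by simp
    then show ?case using X chain_0 chain.chain_0[OF X] by blast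
  next
    case (chain_Suc j E E1 f E2 g)
    obtain X1 v v' f1 where 1: "X1 \<in> DObj A" "arr v (\<phi> X1) E1" "arr v' E1 (\<phi> X1)" "v \<cdot> v' = Ident D E1"
        "A.S_chain j X X1 f1" "\<pi> f1 = v' \<cdot> (f \<cdot> u)"
      using chain_Suc by blast
    have g: "arr g E1 E2" "\<And>n x. arr x (Sh D n G) E1 \<Longrightarrow> g \<cdot> x = 0" using chain_Suc(3) unfolding ghost_def by blast+
    have f: "arr f E E1" using ghosts_arr[OF chain_Suc(1)] .
    obtain X2 w0 where X2: "X2 \<in> DObj A" "is_iso D (\<phi> X2) E2 w0" using ess arr_Obj[OF g(1)] by blast
    then obtain w w' where w: "arr w (\<phi> X2) E2" "arr w' E2 (\<phi> X2)" "w \<cdot> w' = Ident D E2"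
      using is_isoE[OF X2(2) \<phi>[OF X2(1)]] arr_Obj[OF g(1)] by metis
    have gv: "arr (g \<cdot> v) (\<phi> X1) E2" using arr_Comp g(1) 1(2) by blast
    have "arr (w' \<cdot> (g \<cdot> v)) (\<phi> X1) (\<phi> X2)" using arr_Comp[OF w(2) gv] .
    then obtain g' where g': "A.cocyc g' X1 X2" "\<pi> g' = w' \<cdot> (g \<cdot> v)" using \<pi>s 1(1) X2(1) by blast
    have "ghost G (\<phi> X1) (\<phi> X2) (\<pi> g')"
      unfolding ghost_def
    proof (intro conjI allI impI)
      show "arr (\<pi> g') (\<phi> X1) (\<phi> X2)" using \<pi>a[OF g'(1)] .
      fix n x assume x: "arr x (Sh D n G) (\<phi> X1)"
      have "\<pi> g' \<cdot> x = w' \<cdot> (g \<cdot> (v \<cdot> x))"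
        unfolding g'(2) assoc[OF w(2) gv x] assoc[OF g(1) 1(2) x] ..
      also have "g \<cdot> (v \<cdot> x) = 0" using g(2) arr_Comp[OF 1(2) x] by blast
      finally show "\<pi> g' \<cdot> x = 0" using Comp_0_right[OF w(2) Sh_G] by simp
    qed
    then have S: "S X1 X2 g'" unfolding S_def using g'(1) by blast
    have fu: "arr (f \<cdot> u) (\<phi> X) E1" using arr_Comp f chain_Suc(4) by blast
    have "\<pi> (DComp A g' f1) = (w' \<cdot> (g \<cdot> v)) \<cdot> (v' \<cdot> (f \<cdot> u))"
      using \<pi>C[OF g'(1) A.S_chain_cocyc[OF 1(5)]] g'(2) 1(6) by simp
    also have "\<dots> = w' \<cdot> ((g \<cdot> v) \<cdot> (v' \<cdot> (f \<cdot> u)))"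
      using assoc[OF w(2) gv arr_Comp[OF 1(3) fu]] .
    also have "(g \<cdot> v) \<cdot> (v' \<cdot> (f \<cdot> u)) = g \<cdot> (v \<cdot> (v' \<cdot> (f \<cdot> u)))"
      using assoc[OF g(1) 1(2) arr_Comp[OF 1(3) fu]] .
    also have "v \<cdot> (v' \<cdot> (f \<cdot> u)) = f \<cdot> u"
      using assoc[OF 1(2,3) fu] 1(4) id_left[OF fu] by simp
    also have "g \<cdot> (f \<cdot> u) = (g \<cdot> f) \<cdot> u" using assoc[OF g(1) f chain_Suc(4)] by simp
    finally have "\<pi> (DComp A g' f1) = w' \<cdot> ((g \<cdot> f) \<cdot> u)" .
    then show ?case using X2(1) w chain.chain_Suc[OF 1(5), OF S] by blast
  qed
  have "f = 0" if f: "ghosts G J E E' f" for E E' f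
  proof -
    have fa: "arr f E E'" using ghosts_arr[OF f] .
    obtain X u0 where X: "X \<in> DObj A" "is_iso D (\<phi> X) E u0" using ess arr_Obj[OF fa] by blast
    then obtain u u' where u: "arr u (\<phi> X) E" "arr u' E (\<phi> X)" "u' \<cdot> u = Ident D (\<phi> X)" "u \<cdot> u' = Ident D E"
      using is_isoE[OF X(2) \<phi>[OF X(1)]] arr_Obj[OF fa] by metis
    obtain X' v v' f' where 1: "X' \<in> DObj A" "arr v (\<phi> X') E'" "arr v' E' (\<phi> X')" "v \<cdot> v' = Ident D E'"
        "A.S_chain J X X' f'" "\<pi> f' = v' \<cdot> (f \<cdot> u)"
      using lift[OF f X(1) u] by blast
    have "\<pi> f' = 0" using \<pi>0[OF A.S_chain_cocyc[OF 1(5)]] J[OF 1(5)] by blast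
    then have z: "v' \<cdot> (f \<cdot> u) = 0" using 1(6) by simp
    have fu: "arr (f \<cdot> u) (\<phi> X) E'" using arr_Comp fa u(1) by blast
    have "f \<cdot> u = v \<cdot> (v' \<cdot> (f \<cdot> u))" using assoc[OF 1(2,3) fu] 1(4) id_left[OF fu] by simp
    then have fu0: "f \<cdot> u = 0" using z Comp_0_right[OF 1(2) \<phi>[OF X(1)]] by simp
    have "f = (f \<cdot> u) \<cdot> u'" using assoc[OF fa u(1,2)] u(4) id_right[OF fa] by simp
    then show "f = 0" using fu0 Comp_0_left[OF u(2)] arr_Obj[OF fa] by simp
  qed
  then show ?thesis by blast
qed

end

section \<open>Subadditive sequences and exponential growth\<close>

lemma subadditive_mult:
  fixes v :: "nat \<Rightarrow> real"
  assumes sub: "\<And>m n. v (m + n) \<le> v m + v n"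
  shows "v (q * m + r) \<le> real q * v m + v r"
proof (induct q)
  case (Suc q)
  have "v (Suc q * m + r) \<le> v m + v (q * m + r)"
    using sub[of m "q * m + r"] by (simp add: add.assoc)
  then show ?case using Suc by (simp add: algebra_simps)
qed simp

text \<open>\<open>u + C\<close> is subadditive without error, so Fekete's argument applies to it;
  the linear lower bound makes the infimum of the quotients finite.\<close>

lemma fekete_bounded_error:
  fixes u :: "nat \<Rightarrow> real"
  assumes sub: "\<And>m n. u (m + n) \<le> u m + u n + C" and lower: "\<And>n. 1 \<le> n \<Longrightarrow> - B * real n \<le> u n"
  shows "convergent (\<lambda>n. u n / real n)"
proof -
  define v where "v n = u n + C" for n
  have vsub: "v (m + n) \<le> v m + v n" for m n using sub[of m n] by (simp add: v_def)
  define L where "L = Inf ((\<lambda>n. v n / real n) ` {1..})"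
  have vlow: "- B - \<bar>C\<bar> \<le> v n / real n" if "1 \<le> n" for n
  proof -
    have "\<bar>C\<bar> * 1 \<le> \<bar>C\<bar> * real n" using that by (intro mult_left_mono) auto
    then have "(- B - \<bar>C\<bar>) * real n \<le> v n"
      using lower[OF that] unfolding v_def left_diff_distrib by linarith
    then show ?thesis using that by (simp add: pos_le_divide_eq)
  qed
  have bdd: "bdd_below ((\<lambda>n. v n / real n) ` {1..})"
    using vlow by (intro bdd_belowI2[of _ "- B - \<bar>C\<bar>"]) auto
  have Lle: "L \<le> v n / real n" if "1 \<le> n" for n
    unfolding L_def using bdd that by (intro cInf_lower) auto
  have "(\<lambda>n. v n / real n) \<longlonglongrightarrow> L"
  proof (rule LIMSEQ_I)
    fix r :: real assume r: "0 < r"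
    have "\<exists>x\<in>(\<lambda>n. v n / real n) ` {1..}. x < L + r / 2"
      using r cInf_lessD[of "(\<lambda>n. v n / real n) ` {1..}" "L + r / 2"] unfolding L_def by auto
    then obtain m where m: "1 \<le> m" "v m / real m < L + r / 2" by auto
    \<comment> \<open>For \<open>n = q m + s\<close> with \<open>s < m\<close>, \<open>W\<close>
      covers both the remainder \<open>v s\<close> and the discrepancy \<open>s * (v m / m)\<close>
      between \<open>q * v m\<close> and \<open>n * (v m / m)\<close>, independently of
      \<open>n\<close>.\<close>
    define W where "W = \<bar>v m\<bar> + Max ((\<lambda>i. \<bar>v i\<bar>) ` {..<m})"
    have up: "v n / real n \<le> v m / real m + W / real n" if n: "1 \<le> n" for n
    proof -
      define q s where "q = n div m" and "s = n mod m"
      have nqs: "n = q * m + s" "s < m" using m by (auto simp: q_def s_def)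
      have "\<bar>v s\<bar> \<le> Max ((\<lambda>i. \<bar>v i\<bar>) ` {..<m})" using nqs by (intro Max_ge) auto
      then have vs: "v s \<le> W - \<bar>v m\<bar>" by (simp add: W_def)
      have "real n * (v m / real m) = real q * v m + real s * (v m / real m)"
        using m(1) nqs(1) by (simp add: field_simps)
      moreover have "- \<bar>v m\<bar> \<le> real s * (v m / real m)"
      proof -
        have "\<bar>real s * (v m / real m)\<bar> = \<bar>v m\<bar> * (real s / real m)" by (simp add: abs_mult)
        also have "\<dots> \<le> \<bar>v m\<bar> * 1" using nqs(2) by (intro mult_left_mono) auto
        finally show ?thesis by linarith
      qed
      moreover have "v n \<le> real q * v m + v s" using subadditive_mult[of v, OF vsub, of q m s] nqs(1) by simp
      ultimately have "v n \<le> real n * (v m / real m) + W" using vs by linarith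
      then have "v n / real n \<le> (real n * (v m / real m) + W) / real n" by (intro divide_right_mono) auto
      also have "\<dots> = v m / real m + W / real n" using n by (simp add: add_divide_distrib)
      finally show ?thesis .
    qed
    obtain N :: nat where N: "2 * \<bar>W\<bar> / r < real N" using reals_Archimedean2 by blast
    show "\<exists>no. \<forall>n\<ge>no. norm (v n / real n - L) < r"
    proof (intro exI allI impI)
      fix n assume "max 1 N \<le> n"
      then have n: "1 \<le> n" "N \<le> n" by auto
      have "2 * \<bar>W\<bar> / r < real n" using N n(2) by simp
      then have "W / real n < r / 2"
        using r n(1) by (simp add: field_simps)
      then have "v n / real n < L + r" using up[OF n(1)] m(2) by linarith
      then show "norm (v n / real n - L) < r" using Lle[OF n(1)] by simp
    qed
  qed
  then have "(\<lambda>n. v n / real n - C / real n) \<longlonglongrightarrow> L - 0"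
    by (intro tendsto_diff lim_const_over_n)
  moreover have "(\<lambda>n. v n / real n - C / real n) = (\<lambda>n. u n / real n)"
    by (auto simp: v_def add_divide_distrib)
  ultimately show ?thesis unfolding convergent_def by metis
qed

section \<open>Growth of sequences of exponential sums\<close>

text \<open>The numerical shadow of a functor: \<open>s n\<close> and \<open>d n\<close> stand for
  the degrees and dimensions of the nonzero spaces \<open>Hom(G[k], -)\<close> on its n-th iterate,
  \<open>p\<close> for the Poincare sum and \<open>\<delta>\<close> for the complexity.\<close>

locale exponential_growth =
  fixes s :: "nat \<Rightarrow> int set" and d :: "nat \<Rightarrow> int \<Rightarrow> nat" and p :: "real \<Rightarrow> nat \<Rightarrow> real"
    and c b :: "real \<Rightarrow> real" and \<delta> :: "real \<Rightarrow> nat \<Rightarrow> real" and K :: int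
  assumes finite_s: "finite (s n)" and s_nonempty: "s n \<noteq> {}"
    and d_pos: "k \<in> s n \<Longrightarrow> 1 \<le> d n k"
    and p_def: "p t n = (\<Sum>k\<in>s n. real (d n k) * exp (real_of_int k * t))"
    and c_pos: "0 < c t" and b_pos: "0 < b t"
    and p_add: "p t (m + n) \<le> c t * p t m * p t n"
    and s_add: "k \<in> s (m + n) \<Longrightarrow> \<exists>i\<in>s m. \<exists>j\<in>s n. \<bar>k - (i + j)\<bar> \<le> K"
    and \<delta>_lower: "p t n \<le> b t * \<delta> t n" and \<delta>_upper: "\<delta> t n \<le> c t * p t n"
begin

lemma p_ge:
  assumes "k \<in> s n" shows "exp (real_of_int k * t) \<le> p t n"
proof -
  have "1 * exp (real_of_int k * t) \<le> real (d n k) * exp (real_of_int k * t)"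
    using d_pos[OF assms] by (intro mult_right_mono) auto
  also have "\<dots> \<le> p t n"
    unfolding p_def using finite_s assms by (intro member_le_sum) auto
  finally show ?thesis by simp
qed

lemma p_pos: "0 < p t n"
  using s_nonempty p_ge exp_gt_zero by (metis all_not_in_conv less_le_trans)

definition a :: "real \<Rightarrow> nat \<Rightarrow> real" where "a t n = ln (p t n)"

lemma exp_a: "exp (a t n) = p t n"
  unfolding a_def using p_pos by simp

lemma p_le_exp_iff: "p t n \<le> exp e \<longleftrightarrow> a t n \<le> e" and exp_le_p_iff: "exp e \<le> p t n \<longleftrightarrow> e \<le> a t n"
  using exp_le_cancel_iff[of "a t n" e] exp_le_cancel_iff[of e "a t n"] by (simp_all only: exp_a)

lemma a_ge: "k \<in> s n \<Longrightarrow> real_of_int k * t \<le> a t n"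
  using p_ge exp_le_p_iff by blast

lemma a_add: "a t (m + n) \<le> a t m + a t n + ln (c t)"
proof -
  have "p t (m + n) \<le> exp (ln (c t) + a t m + a t n)"
    using p_add[of t m n] c_pos[of t] by (simp add: exp_a exp_add)
  then show ?thesis unfolding p_le_exp_iff by simp
qed

lemma a_linear: "\<exists>B. \<forall>n\<ge>1. a t n \<le> B * real n"
proof -
  let ?e = "a t 1 + ln (c t)"
  have le: "a t n \<le> a t 0 + ?e * real n" for n
  proof (induct n)
    case (Suc n)
    then show ?case using a_add[of t n 1] by (simp add: algebra_simps)
  qed simp
  have "a t n \<le> (\<bar>a t 0\<bar> + ?e) * real n" if "1 \<le> n" for n
  proof -
    have "a t 0 \<le> \<bar>a t 0\<bar> * real n" using that mult_left_mono[of 1 "real n" "\<bar>a t 0\<bar>"] by simp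
    then show ?thesis using le[of n] by (simp add: distrib_right)
  qed
  then show ?thesis by blast
qed

text \<open>Each exponential is dominated by the whole sum; \<open>t = 1\<close> bounds the
  exponents from above and \<open>t = -1\<close> from below.\<close>

lemma s_linear: "\<exists>B. \<forall>n\<ge>1. \<forall>k\<in>s n. \<bar>real_of_int k\<bar> \<le> B * real n"
proof -
  obtain B1 where B1: "\<And>n. 1 \<le> n \<Longrightarrow> a 1 n \<le> B1 * real n" using a_linear by blast
  obtain B2 where B2: "\<And>n. 1 \<le> n \<Longrightarrow> a (-1) n \<le> B2 * real n" using a_linear by blast
  have "\<bar>real_of_int k\<bar> \<le> max B1 B2 * real n" if "1 \<le> n" "k \<in> s n" for n k
  proof -
    have "real_of_int k \<le> B1 * real n" "- real_of_int k \<le> B2 * real n"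
      using a_ge[OF that(2), of 1] a_ge[OF that(2), of "-1"] B1[OF that(1)] B2[OF that(1)] by simp_all
    moreover have "B1 * real n \<le> max B1 B2 * real n" "B2 * real n \<le> max B1 B2 * real n"
      by (intro mult_right_mono; simp)+
    ultimately show ?thesis by linarith
  qed
  then show ?thesis by blast
qed

lemma Max_in: "Max (s n) \<in> s n" and Min_in: "Min (s n) \<in> s n"
  using finite_s s_nonempty by auto

definition h :: "real \<Rightarrow> real" where "h t = lim (\<lambda>n. a t n / real n)"
definition \<tau>p :: real where "\<tau>p = lim (\<lambda>n. real_of_int (Max (s n)) / real n)"
definition \<tau>m :: real where "\<tau>m = lim (\<lambda>n. real_of_int (Min (s n)) / real n)"

text \<open>\<open>a\<close> is subadditive up to \<open>ln (c t)\<close>, and the single term with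
  the largest exponent provides the linear lower bound.\<close>

lemma a_tendsto: "(\<lambda>n. a t n / real n) \<longlonglongrightarrow> h t"
proof -
  obtain B where B: "\<And>n k. \<lbrakk>1 \<le> n; k \<in> s n\<rbrakk> \<Longrightarrow> \<bar>real_of_int k\<bar> \<le> B * real n" using s_linear by blast
  have "- (B * \<bar>t\<bar>) * real n \<le> a t n" if n: "1 \<le> n" for n
  proof -
    have "\<bar>real_of_int (Max (s n)) * t\<bar> \<le> B * real n * \<bar>t\<bar>"
      unfolding abs_mult using B[OF n Max_in] by (intro mult_right_mono) auto
    then show ?thesis using a_ge[OF Max_in, of n t] by (simp add: algebra_simps)
  qed
  then have "convergent (\<lambda>n. a t n / real n)" by (rule fekete_bounded_error[OF a_add])
  then show ?thesis unfolding h_def by (simp add: convergent_LIMSEQ_iff)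
qed

lemma Max_tendsto: "(\<lambda>n. real_of_int (Max (s n)) / real n) \<longlonglongrightarrow> \<tau>p"
proof -
  obtain B where B: "\<And>n k. \<lbrakk>1 \<le> n; k \<in> s n\<rbrakk> \<Longrightarrow> \<bar>real_of_int k\<bar> \<le> B * real n" using s_linear by blast
  have "convergent (\<lambda>n. real_of_int (Max (s n)) / real n)"
  proof (rule fekete_bounded_error)
    fix m n
    obtain i j where ij: "i \<in> s m" "j \<in> s n" "\<bar>Max (s (m + n)) - (i + j)\<bar> \<le> K" using s_add Max_in by blast
    have "i \<le> Max (s m)" "j \<le> Max (s n)" using ij finite_s by auto
    then have "Max (s (m + n)) \<le> Max (s m) + Max (s n) + K" using ij(3) by linarith
    then show "real_of_int (Max (s (m + n))) \<le> real_of_int (Max (s m)) + real_of_int (Max (s n)) + real_of_int K"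
      by linarith
  next
    fix n :: nat assume "1 \<le> n"
    then show "- B * real n \<le> real_of_int (Max (s n))" using B[OF _ Max_in, of n] by simp
  qed
  then show ?thesis unfolding \<tau>p_def by (simp add: convergent_LIMSEQ_iff)
qed

text \<open>Minima are superadditive up to \<open>K\<close>, so Fekete's lemma is applied to their
  negatives.\<close>

lemma Min_tendsto: "(\<lambda>n. real_of_int (Min (s n)) / real n) \<longlonglongrightarrow> \<tau>m"
proof -
  obtain B where B: "\<And>n k. \<lbrakk>1 \<le> n; k \<in> s n\<rbrakk> \<Longrightarrow> \<bar>real_of_int k\<bar> \<le> B * real n" using s_linear by blast
  have "convergent (\<lambda>n. (- real_of_int (Min (s n))) / real n)"
  proof (rule fekete_bounded_error)
    fix m n
    obtain i j where ij: "i \<in> s m" "j \<in> s n" "\<bar>Min (s (m + n)) - (i + j)\<bar> \<le> K" using s_add Min_in by blast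
    have "Min (s m) \<le> i" "Min (s n) \<le> j" using ij finite_s by auto
    then have "- Min (s (m + n)) \<le> - Min (s m) + - Min (s n) + K" using ij(3) by linarith
    then show "- real_of_int (Min (s (m + n))) \<le> - real_of_int (Min (s m)) + - real_of_int (Min (s n)) + real_of_int K"
      by linarith
  next
    fix n :: nat assume "1 \<le> n"
    then show "- B * real n \<le> - real_of_int (Min (s n))" using B[OF _ Min_in, of n] by simp
  qed
  then have "convergent (\<lambda>n. real_of_int (Min (s n)) / real n)"
    using convergent_minus_iff[of "\<lambda>n. real_of_int (Min (s n)) / real n"] by simp
  then show ?thesis unfolding \<tau>m_def by (simp add: convergent_LIMSEQ_iff)
qed

lemma \<delta>_pos: "0 < \<delta> t n"
  using \<delta>_lower[of t n] p_pos[of t n] b_pos[of t] by (metis less_le_trans zero_less_mult_pos)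

lemma \<delta>_tendsto: "(\<lambda>n. ln (\<delta> t n) / real n) \<longlonglongrightarrow> h t"
proof (rule tendsto_sandwich)
  have "a t n - ln (b t) \<le> ln (\<delta> t n)" for n
  proof -
    have "p t n \<le> exp (ln (b t) + ln (\<delta> t n))" using \<delta>_lower[of t n] \<delta>_pos b_pos by (simp add: exp_add)
    then show ?thesis unfolding p_le_exp_iff by simp
  qed
  then show "\<forall>\<^sub>F n in sequentially. a t n / real n - ln (b t) / real n \<le> ln (\<delta> t n) / real n"
    by (intro always_eventually allI) (simp add: diff_divide_distrib[symmetric] divide_right_mono)
  have "ln (\<delta> t n) \<le> a t n + ln (c t)" for n
  proof -
    have "exp (ln (\<delta> t n)) \<le> exp (a t n + ln (c t))"
      using \<delta>_upper[of t n] \<delta>_pos c_pos by (simp add: exp_add exp_a mult.commute)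
    then show ?thesis by simp
  qed
  then show "\<forall>\<^sub>F n in sequentially. ln (\<delta> t n) / real n \<le> a t n / real n + ln (c t) / real n"
    by (intro always_eventually allI) (simp add: add_divide_distrib[symmetric] divide_right_mono)
  show "(\<lambda>n. a t n / real n - ln (b t) / real n) \<longlonglongrightarrow> h t"
    using tendsto_diff[OF a_tendsto lim_const_over_n] by simp
  show "(\<lambda>n. a t n / real n + ln (c t) / real n) \<longlonglongrightarrow> h t"
    using tendsto_add[OF a_tendsto lim_const_over_n] by simp
qed

lemma h_ge: "t * \<tau>p \<le> h t" "t * \<tau>m \<le> h t"
proof -
  have 1: "t * (real_of_int (Max (s n)) / real n) \<le> a t n / real n" for n
    using a_ge[OF Max_in, of n t] by (simp add: mult.commute divide_right_mono)
  have 2: "t * (real_of_int (Min (s n)) / real n) \<le> a t n / real n" for n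
    using a_ge[OF Min_in, of n t] by (simp add: mult.commute divide_right_mono)
  show "t * \<tau>p \<le> h t"
    by (rule LIMSEQ_le[OF tendsto_mult_left[OF Max_tendsto] a_tendsto]) (use 1 in auto)
  show "t * \<tau>m \<le> h t"
    by (rule LIMSEQ_le[OF tendsto_mult_left[OF Min_tendsto] a_tendsto]) (use 2 in auto)
qed

text \<open>Bounding all exponentials by one value leaves the sum of the dimensions,
  \<open>p 0 n\<close>. This is where \<open>h 0\<close> in the upper bounds for \<open>h\<close>
  comes from.\<close>

lemma a_le:
  assumes "\<And>k. k \<in> s n \<Longrightarrow> real_of_int k * t \<le> e" shows "a t n \<le> a 0 n + e"
proof -
  have "p t n \<le> (\<Sum>k\<in>s n. real (d n k) * exp e)"
    unfolding p_def using assms by (intro sum_mono mult_left_mono) auto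
  also have "\<dots> = p 0 n * exp e" unfolding p_def by (simp add: sum_distrib_right)
  also have "\<dots> = exp (a 0 n + e)" by (simp add: exp_add exp_a)
  finally show ?thesis unfolding p_le_exp_iff .
qed

lemma h_le_pos: assumes "0 \<le> t" shows "h t \<le> h 0 + t * \<tau>p"
proof (rule LIMSEQ_le[OF a_tendsto tendsto_add[OF a_tendsto tendsto_mult_left[OF Max_tendsto]]])
  have "a t n \<le> a 0 n + real_of_int (Max (s n)) * t" for n
    using assms finite_s by (intro a_le mult_right_mono) auto
  then have "a t n / real n \<le> a 0 n / real n + t * (real_of_int (Max (s n)) / real n)" for n
    using divide_right_mono[of "a t n" "a 0 n + real_of_int (Max (s n)) * t" "real n"]
    by (simp add: add_divide_distrib mult.commute)
  then show "\<exists>N. \<forall>n\<ge>N. a t n / real n \<le> a 0 n / real n + t * (real_of_int (Max (s n)) / real n)" by blast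
qed

lemma h_le_neg: assumes "t \<le> 0" shows "h t \<le> h 0 + t * \<tau>m"
proof (rule LIMSEQ_le[OF a_tendsto tendsto_add[OF a_tendsto tendsto_mult_left[OF Min_tendsto]]])
  have "a t n \<le> a 0 n + real_of_int (Min (s n)) * t" for n
    using assms finite_s by (intro a_le mult_right_mono_neg) auto
  then have "a t n / real n \<le> a 0 n / real n + t * (real_of_int (Min (s n)) / real n)" for n
    using divide_right_mono[of "a t n" "a 0 n + real_of_int (Min (s n)) * t" "real n"]
    by (simp add: add_divide_distrib mult.commute)
  then show "\<exists>N. \<forall>n\<ge>N. a t n / real n \<le> a 0 n / real n + t * (real_of_int (Min (s n)) / real n)" by blast
qed

text \<open>Hoelder's inequality in normalised form: after dividing by the sums at \<open>x\<close>
  and \<open>y\<close> both total masses are 1, and convexity of the exponential function is applied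
  term by term.\<close>

lemma a_convex:
  assumes uv: "0 \<le> u" "0 \<le> v" "u + v = 1"
  shows "a (u * x + v * y) n \<le> u * a x n + v * a y n"
proof -
  let ?e = "u * a x n + v * a y n"
  have ex: "exp (real_of_int k * (u * x + v * y) - ?e)
      \<le> u * exp (real_of_int k * x - a x n) + v * exp (real_of_int k * y - a y n)" for k
  proof -
    have "exp (u *\<^sub>R (real_of_int k * x - a x n) + v *\<^sub>R (real_of_int k * y - a y n))
      \<le> u * exp (real_of_int k * x - a x n) + v * exp (real_of_int k * y - a y n)"
      using exp_convex uv unfolding convex_on_def by simp
    then show ?thesis by (simp add: algebra_simps)
  qed
  have one: "(\<Sum>k\<in>s n. real (d n k) * exp (real_of_int k * t - a t n)) = 1" for t
  proof -
    have "(\<Sum>k\<in>s n. real (d n k) * exp (real_of_int k * t - a t n)) = p t n / p t n"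
      unfolding exp_diff exp_a by (subst (2) p_def) (simp add: sum_divide_distrib)
    then show ?thesis using p_pos[of t n] by simp
  qed
  have "p (u * x + v * y) n / exp ?e = (\<Sum>k\<in>s n. real (d n k) * exp (real_of_int k * (u * x + v * y) - ?e))"
    unfolding p_def by (simp add: sum_divide_distrib exp_diff)
  also have "\<dots> \<le> (\<Sum>k\<in>s n. real (d n k) * (u * exp (real_of_int k * x - a x n) + v * exp (real_of_int k * y - a y n)))"
    by (intro sum_mono mult_left_mono ex) auto
  also have "\<dots> = u * (\<Sum>k\<in>s n. real (d n k) * exp (real_of_int k * x - a x n))
      + v * (\<Sum>k\<in>s n. real (d n k) * exp (real_of_int k * y - a y n))"
    by (simp add: sum_distrib_left sum.distrib[symmetric] algebra_simps)
  also have "\<dots> = 1" using one uv by simp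
  finally have "p (u * x + v * y) n \<le> exp ?e" by (simp add: divide_le_eq)
  then show ?thesis unfolding p_le_exp_iff .
qed

lemma h_convex: "convex_on UNIV h"
proof (rule convex_onI)
  fix t x y :: real assume t: "0 < t" "t < 1"
  show "h ((1 - t) *\<^sub>R x + t *\<^sub>R y) \<le> (1 - t) * h x + t * h y"
  proof (rule LIMSEQ_le[OF a_tendsto tendsto_add[OF tendsto_mult_left[OF a_tendsto] tendsto_mult_left[OF a_tendsto]]])
    have "a ((1 - t) *\<^sub>R x + t *\<^sub>R y) n / real n \<le> (1 - t) * (a x n / real n) + t * (a y n / real n)" for n
      using divide_right_mono[OF a_convex[of "1 - t" t x y n], of "real n"] t by (simp add: add_divide_distrib)
    then show "\<exists>N. \<forall>n\<ge>N. a ((1 - t) *\<^sub>R x + t *\<^sub>R y) n / real n \<le> (1 - t) * (a x n / real n) + t * (a y n / real n)"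
      by blast
  qed
qed simp

lemma h_asymptotics: "((\<lambda>t. h t / t) \<longlongrightarrow> \<tau>p) at_top" "((\<lambda>t. h t / t) \<longlongrightarrow> \<tau>m) at_bot"
proof -
  have z: "((\<lambda>t. h 0 / t) \<longlongrightarrow> 0) at_top" "((\<lambda>t. h 0 / t) \<longlongrightarrow> 0) at_bot"
    by (intro real_tendsto_divide_at_top[OF tendsto_const filterlim_ident],
        intro tendsto_divide_0[OF tendsto_const] filterlim_at_bot_imp_at_infinity filterlim_ident)
  show "((\<lambda>t. h t / t) \<longlongrightarrow> \<tau>p) at_top"
  proof (rule tendsto_sandwich)
    show "\<forall>\<^sub>F t in at_top. \<tau>p \<le> h t / t"
      using eventually_gt_at_top[of 0] by eventually_elim (use h_ge(1) in \<open>simp add: pos_le_divide_eq mult.commute\<close>)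
    show "\<forall>\<^sub>F t in at_top. h t / t \<le> h 0 / t + \<tau>p"
      using eventually_gt_at_top[of 0]
    proof eventually_elim
      case (elim t)
      then show ?case using h_le_pos[of t] by (simp add: field_simps)
    qed
    show "((\<lambda>t. h 0 / t + \<tau>p) \<longlongrightarrow> \<tau>p) at_top" using tendsto_add[OF z(1) tendsto_const[of \<tau>p]] by simp
  qed simp
  \<comment> \<open>Division by a negative \<open>t\<close> reverses the bounds: the lower bound for
    \<open>h\<close> now limits the quotient from above.\<close>
  show "((\<lambda>t. h t / t) \<longlongrightarrow> \<tau>m) at_bot"
  proof (rule tendsto_sandwich)
    show "\<forall>\<^sub>F t in at_bot. h t / t \<le> \<tau>m"
      using eventually_gt_at_bot[of 0] by eventually_elim (use h_ge(2) in \<open>simp add: neg_divide_le_eq mult.commute\<close>)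
    show "\<forall>\<^sub>F t in at_bot. h 0 / t + \<tau>m \<le> h t / t"
      using eventually_gt_at_bot[of 0]
    proof eventually_elim
      case (elim t)
      have "(h 0 + t * \<tau>m) / t \<le> h t / t"
        using elim h_le_neg[of t] by (intro divide_right_mono_neg) auto
      then show ?case using elim by (simp add: add_divide_distrib)
    qed
    show "((\<lambda>t. h 0 / t + \<tau>m) \<longlongrightarrow> \<tau>m) at_bot" using tendsto_add[OF z(2) tendsto_const[of \<tau>m]] by simp
  qed simp
qed

end

section \<open>Functors, complexity and entropy\<close>

locale triangulated_functor = triangulated_category D
  for D :: "('o, 'm::ab_group_add, 'k::field) tri_cat" (structure) +
  fixes F :: "('o, 'm) endofunctor"
  assumes F: "triangulated_endofunctor D F"
begin

lemma FObj: "X \<in> Obj D \<Longrightarrow> FObj F X \<in> Obj D"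
  using F unfolding triangulated_endofunctor_def by (elim conjE) blast

lemma FMor_arr: "arr f X Y \<Longrightarrow> arr (FMor F f) (FObj F X) (FObj F Y)"
  using F FObj unfolding triangulated_endofunctor_def arr_def by (elim conjE) blast

lemma FMor_linear: "\<lbrakk>X \<in> Obj D; Y \<in> Obj D\<rbrakk> \<Longrightarrow> linear_map_on (Scale D) (Scale D) (Hom D X Y) (FMor F)"
  using F unfolding triangulated_endofunctor_def by (elim conjE) blast

lemma FMor_Ident: "X \<in> Obj D \<Longrightarrow> FMor F (Ident D X) = Ident D (FObj F X)"
  using F unfolding triangulated_endofunctor_def by (elim conjE) blast

lemma FMor_Comp: "\<lbrakk>arr g Y Z; arr f X Y\<rbrakk> \<Longrightarrow> FMor F (g \<cdot> f) = FMor F g \<cdot> FMor F f"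
  using F unfolding triangulated_endofunctor_def arr_def by (elim conjE) blast

lemma F_Sh_1: "X \<in> Obj D \<Longrightarrow> isomorphic (FObj F (Sh D 1 X)) (Sh D 1 (FObj F X))"
  using F FObj Sh_closed unfolding triangulated_endofunctor_def isomorphic_def by (elim conjE exE) blast

lemma F_tri:
  assumes "tri X Y Z" shows "tri (FObj F X) (FObj F Y) (FObj F Z)"
proof -
  obtain \<theta> where "\<forall>X Y Z f g h. Tri D X Y Z f g h \<longrightarrow>
           Tri D (FObj F X) (FObj F Y) (FObj F Z) (FMor F f) (FMor F g) (Comp D (\<theta> X) (FMor F h))"
    using F unfolding triangulated_endofunctor_def by (elim conjE exE)
  then show ?thesis using assms unfolding tri_def by blast
qed

lemma F_is_zero: "is_zero D X \<Longrightarrow> is_zero D (FObj F X)"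
  using FMor_Ident FObj linear_map_on_0[OF FMor_linear[of X X]] arr_zero[of X X]
  unfolding is_zero_iff arr_def by metis

lemma F_retract:
  assumes "is_retract X Y" shows "is_retract (FObj F X) (FObj F Y)"
proof -
  obtain i p where ip: "arr i X Y" "arr p Y X" "p \<cdot> i = Ident D X"
    using assms unfolding is_retract_def by blast
  have "FMor F p \<cdot> FMor F i = Ident D (FObj F X)"
    using FMor_Comp[OF ip(2,1)] ip(3) FMor_Ident[OF arr_Obj(1)[OF ip(1)]] by simp
  then show ?thesis unfolding is_retract_def using FMor_arr ip by blast
qed

lemma isomorphic_Sh:
  assumes "isomorphic X Y" shows "isomorphic (Sh D n X) (Sh D n Y)"
proof -
  obtain f g where fg: "arr f X Y" "arr g Y X" "g \<cdot> f = Ident D X" "f \<cdot> g = Ident D Y"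
    using assms is_isoE unfolding isomorphic_def by metis
  have "is_iso D (Sh D n X) (Sh D n Y) (ShM D n f)"
    using ShM_comp[OF fg(2,1)] ShM_comp[OF fg(1,2)] fg(3,4) ShM_Ident arr_Obj[OF fg(1)]
    by (intro is_isoI[OF arr_Sh[OF fg(1)] arr_Sh[OF fg(2)]]) simp_all
  then show ?thesis unfolding isomorphic_def using Sh_closed arr_Obj[OF fg(1)] by blast
qed

lemma F_Sh:
  assumes X: "X \<in> Obj D" shows "isomorphic (FObj F (Sh D n X)) (Sh D n (FObj F X))"
proof (induct n rule: int_induct[where k = 0])
  case base
  show ?case using X FObj[OF X] isomorphic_refl by (simp add: Sh_0)
next
  case (step1 i)
  have "isomorphic (FObj F (Sh D 1 (Sh D i X))) (Sh D 1 (FObj F (Sh D i X)))"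
    using F_Sh_1 Sh_closed[OF X] .
  moreover have "isomorphic (Sh D 1 (FObj F (Sh D i X))) (Sh D 1 (Sh D i (FObj F X)))"
    using isomorphic_Sh step1(2) .
  ultimately have "isomorphic (FObj F (Sh D 1 (Sh D i X))) (Sh D 1 (Sh D i (FObj F X)))"
    by (rule isomorphic_trans)
  then show ?case using X FObj[OF X] by (simp add: Sh_add[symmetric] add.commute)
next
  case (step2 i)
  \<comment> \<open>The functor supplies isomorphisms only for the shift by one. To go down, the one
    for \<open>X[i - 1]\<close> is compared with the case \<open>i\<close> and the result is shifted
    by \<open>-1\<close>.\<close>
  let ?W = "Sh D (i - 1) X"
  have "isomorphic (FObj F (Sh D 1 ?W)) (Sh D 1 (FObj F ?W))" using F_Sh_1 Sh_closed[OF X] .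
  moreover have "Sh D 1 ?W = Sh D i X" using X by (simp add: Sh_add[symmetric])
  ultimately have "isomorphic (Sh D 1 (FObj F ?W)) (Sh D i (FObj F X))"
    using isomorphic_trans[OF isomorphic_sym step2(2)] by simp
  from isomorphic_Sh[OF this, of "-1"] show ?case
    using Sh_cancel(1)[OF FObj[OF Sh_closed[OF X]], of 1 "i - 1"] FObj[OF X] by (simp add: Sh_add[symmetric])
qed

lemma F_filt:
  assumes E: "E \<in> Obj D" and B: "filt E ns B"
  shows "filt (FObj F E) ns (FObj F B)"
  using B
proof (induct rule: filt.induct)
  case (filt_zero Z)
  then show ?case using F_is_zero filt.filt_zero by blast
next
  case (filt_cone ns A B n)
  show ?case using filt.filt_cone[OF filt_cone(2) tri_isomorphic[OF F_tri[OF filt_cone(3)] F_Sh[OF E]]] .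
qed

lemma power_Obj: "X \<in> Obj D \<Longrightarrow> (FObj F ^^ n) X \<in> Obj D"
  by (induct n) (simp_all add: FObj)

lemma power_filt: "\<lbrakk>E \<in> Obj D; filt E ns B\<rbrakk> \<Longrightarrow> filt ((FObj F ^^ n) E) ns ((FObj F ^^ n) B)"
  by (induct n) (simp_all add: F_filt power_Obj)

lemma power_retract: "is_retract X Y \<Longrightarrow> is_retract ((FObj F ^^ n) X) ((FObj F ^^ n) Y)"
  by (induct n) (simp_all add: F_retract)

end

section \<open>Complexity in terms of filtrations\<close>

context triangulated_category
begin

lemma complexity_sums_filt:
  assumes "E2 \<in> Obj D" "x \<in> complexity_sums D t E1 E2"
  shows "\<exists>ns B. filt E1 ns B \<and> is_retract E2 B \<and> x = ereal (weight t ns)"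
proof -
  obtain m \<nu> A E' where x: "x = ereal (\<Sum>k<m. exp (real_of_int (\<nu> k) * t))" and A: "is_zero D (A 0)"
      "is_biproduct D E2 E' (A m)" "\<forall>k<m. \<exists>f g h. Tri D (A k) (A (Suc k)) (Sh D (\<nu> k) E1) f g h"
    using assms(2) unfolding complexity_sums_def by blast
  have "\<exists>ns. filt E1 ns (A j) \<and> weight t ns = (\<Sum>k<j. exp (real_of_int (\<nu> k) * t))" if "j \<le> m" for j
    using that
  proof (induct j)
    case 0
    show ?case using filt_zero[OF A(1)] by (intro exI[of _ "[]"]) simp
  next
    case (Suc j)
    then obtain ns where ns: "filt E1 ns (A j)"
      "weight t ns = (\<Sum>k<j. exp (real_of_int (\<nu> k) * t))" by auto
    have "tri (A j) (A (Suc j)) (Sh D (\<nu> j) E1)" using A(3) Suc(2) unfolding tri_def by simp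
    then show ?case using filt_cone[OF ns(1)] ns(2) by (intro exI[of _ "\<nu> j # ns"]) simp
  qed
  then obtain ns where "filt E1 ns (A m)"
    "weight t ns = (\<Sum>k<m. exp (real_of_int (\<nu> k) * t))" by blast
  then show ?thesis
    using x is_retract_biproduct[OF A(2) assms(1)] by (intro exI[of _ ns] exI[of _ "A m"]) simp
qed

text \<open>A filtration becomes an indexed sequence by appending each new cone at the end, and
  idempotent completeness provides the complement that turns the retract into a direct
  summand.\<close>

lemma filt_complexity_sums:
  assumes ic: "idempotent_complete D" and B: "filt E1 ns B" and r: "is_retract E2 B"
  shows "ereal (weight t ns) \<in> complexity_sums D t E1 E2"
proof -
  have "\<exists>m \<nu> A. is_zero D (A 0) \<and> A m = B \<and> (\<forall>k<m. tri (A k) (A (Suc k)) (Sh D (\<nu> k) E1)) \<and>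
     weight t ns = (\<Sum>k<m. exp (real_of_int (\<nu> k) * t))"
    using B
  proof (induct rule: filt.induct)
    case (filt_zero Z)
    then show ?case by (intro exI[of _ 0] exI[of _ "\<lambda>_. 0"] exI[of _ "\<lambda>_. Z"]) simp
  next
    case (filt_cone ns A0 B n)
    then obtain m \<nu> A where 1: "is_zero D (A 0)" "A m = A0" "\<forall>k<m. tri (A k) (A (Suc k)) (Sh D (\<nu> k) E1)"
     "weight t ns = (\<Sum>k<m. exp (real_of_int (\<nu> k) * t))" by blast
    have "\<forall>k<Suc m. tri ((A(Suc m := B)) k) ((A(Suc m := B)) (Suc k)) (Sh D ((\<nu>(m := n)) k) E1)"
      using 1(2,3) filt_cone(3) by (auto simp: less_Suc_eq)
    moreover have "weight t (n # ns) = (\<Sum>k<Suc m. exp (real_of_int ((\<nu>(m := n)) k) * t))"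
      using 1(4) by simp
    ultimately show ?case using 1(1)
      by (intro exI[of _ "Suc m"] exI[of _ "\<nu>(m := n)"] exI[of _ "A(Suc m := B)"]) simp
  qed
  then obtain m \<nu> A where A: "is_zero D (A 0)" "A m = B" "\<forall>k<m. tri (A k) (A (Suc k)) (Sh D (\<nu> k) E1)"
     "weight t ns = (\<Sum>k<m. exp (real_of_int (\<nu> k) * t))" by blast
  obtain E' where "E' \<in> Obj D" "is_biproduct D E2 E' B" using biproduct_of_retract[OF ic r] by blast
  then have "is_zero D (A 0) \<and> E' \<in> Obj D \<and> is_biproduct D E2 E' (A m) \<and>
      (\<forall>k<m. \<exists>f g h. Tri D (A k) (A (Suc k)) (Sh D (\<nu> k) E1) f g h)"
    using A unfolding tri_def by simp
  then show ?thesis unfolding complexity_sums_def A(4) by blast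
qed

end

lemma generated_categoryI:
  assumes "triangulated_category D" "finite_type D" "split_generator D G"
  shows "generated_category D G"
proof -
  interpret triangulated_category D by fact
  have G: "G \<in> Obj D" using assms(3) unfolding split_generator_def by blast
  have "\<exists>ns B. filt G ns B \<and> is_retract E B" if E: "E \<in> Obj D" for E
  proof (cases "is_zero D E")
    \<comment> \<open>A zero object has complexity \<open>0\<close> by convention, which says
      nothing about filtrations; the empty filtration serves directly.\<close>
    case True
    then show ?thesis using filt_zero is_retract_isomorphic isomorphic_refl E by blast
  next
    case False
    \<comment> \<open>A finite value at one \<open>t\<close> is enough to make the set of sums
      nonempty, and any member of it gives a filtration.\<close>
    have "complexity D 0 G E < \<infinity>" using assms(3) E unfolding split_generator_def by blast
    then have "complexity_sums D 0 G E \<noteq> {}" using False unfolding complexity_def by (auto simp: top_ereal_def)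
    then show ?thesis using complexity_sums_filt[OF E] by blast
  qed
  then show ?thesis
    by unfold_locales (use assms G in auto)
qed

context generated_category
begin

text \<open>If every \<open>Hom(G[k], E)\<close> vanished, the identity of \<open>E\<close> would be
  a ghost. By the ghost lemma some power of it, hence the identity itself, would be zero.\<close>

lemma supp_nonempty:
  assumes E: "E \<in> Obj D" "\<not> is_zero D E" shows "supp E \<noteq> {}"
proof
  assume s: "supp E = {}"
  have g: "ghost G E E (Ident D E)"
    unfolding ghost_def
  proof (intro conjI allI impI)
    show "arr (Ident D E) E E" using arr_Ident E by blast
    fix n x assume x: "arr x (Sh D n G) E"
    then have "x = 0" using s unfolding supp_def arr_def by blast
    then show "Ident D E \<cdot> x = 0" using id_left[OF x] by simp
  qed
  have ch: "ghosts G j E E (Ident D E)" for j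
  proof (induct j)
    case (Suc j)
    show ?case using chain_Suc[OF Suc, OF g] id_left[OF arr_Ident[OF E(1)]] by simp
  qed (rule chain_0[OF E(1)])
  obtain ns B where "filt G ns B" "is_retract E B" using generates[OF E(1)] by blast
  then have "Ident D E \<cdot> Ident D E = 0" using ghosts_retract_zero ch arr_Ident[OF E(1)] by blast
  then show False using id_left[OF arr_Ident[OF E(1)]] E unfolding is_zero_iff by simp
qed

lemma complexity_lower:
  assumes E: "E \<in> Obj D" "\<not> is_zero D E" and x: "x \<in> complexity_sums D t G E"
  shows "ereal (poinc t E) \<le> ereal (poinc t G) * x"
proof -
  obtain ns B where B: "filt G ns B" "is_retract E B" "x = ereal (weight t ns)"
    using complexity_sums_filt[OF E(1) x] by blast
  have "poinc t E \<le> poinc t B" using poinc_retract(1)[OF B(2)] .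
  also have "\<dots> \<le> weight t ns * poinc t G" using poinc_filt(1)[OF G B(1)] .
  finally show ?thesis using B(3) by (simp add: mult.commute)
qed

end

section \<open>Entropy and shifting numbers of a functor\<close>

locale categorical_entropy = generated_category D G + triangulated_functor D F
  for D :: "('o, 'm::ab_group_add, 'k::field) tri_cat" (structure) and G :: 'o and F :: "('o, 'm) endofunctor" +
  fixes c :: "real \<Rightarrow> real" and K :: int
  assumes idempotent_complete: "idempotent_complete D"
    and not_virtually_zero: "\<not> virtually_zero D F"
    and c_pos: "0 < c t"
    and filtration: "E \<in> Obj D \<Longrightarrow> \<exists>ns B. filt G ns B \<and> is_retract E B
     \<and> (\<forall>t. weight t ns \<le> c t * poinc t E)
     \<and> (\<forall>n\<in>set ns. \<exists>k\<in>supp E. \<bar>n - k\<bar> \<le> K)"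
begin

abbreviation X :: "nat \<Rightarrow> 'o" where "X n \<equiv> (FObj F ^^ n) G"

lemma X_Obj: "X n \<in> Obj D"
  using power_Obj[OF G] .

text \<open>A filtration of \<open>E\<close> by shifts of \<open>G\<close> becomes, under the n-th
  power of \<open>F\<close>, a filtration by shifts of \<open>X n\<close>. If \<open>X n\<close>
  were zero, that power would annihilate every object.\<close>

lemma X_nonzero: "\<not> is_zero D (X n)"
proof
  assume z: "is_zero D (X n)"
  have "is_zero D ((FObj F ^^ n) E)" if E: "E \<in> Obj D" for E
  proof -
    obtain ns B where B: "filt G ns B" "is_retract E B" using generates[OF E] by blast
    have f: "filt (X n) ns ((FObj F ^^ n) B)" using power_filt[OF G B(1)] .
    have r: "is_retract ((FObj F ^^ n) E) ((FObj F ^^ n) B)" using power_retract[OF B(2)] .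
    have "supp (X n) = {}" using z unfolding supp_def is_zero_def by simp
    then have "supp ((FObj F ^^ n) B) = {}" using poinc_filt(2)[OF X_Obj f] by blast
    then have "supp ((FObj F ^^ n) E) = {}" using poinc_retract(2)[OF r] by blast
    then show ?thesis using supp_nonempty[OF power_Obj[OF E]] by blast
  qed
  then show False using not_virtually_zero unfolding virtually_zero_def by blast
qed

lemma poinc_pos: "0 < poinc t (X n)"
proof -
  obtain k where "k \<in> supp (X n)" using supp_nonempty[OF X_Obj X_nonzero] by blast
  then show ?thesis using poinc_ge[OF X_Obj, of k n t] exp_gt_zero less_le_trans by blast
qed

text \<open>The n-th power of \<open>F\<close> carries the controlled filtration of
  \<open>X m\<close> by shifts of \<open>G\<close> to one of \<open>X (m + n)\<close> by the same
  shifts of \<open>X n\<close>, up to retracts. The weight controls the first estimate, the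
  positions of the shifts the second.\<close>

lemma X_add:
  shows "poinc t (X (m + n)) \<le> c t * poinc t (X m) * poinc t (X n)"
    and "k \<in> supp (X (m + n)) \<Longrightarrow> \<exists>i\<in>supp (X m). \<exists>j\<in>supp (X n). \<bar>k - (i + j)\<bar> \<le> K"
proof -
  have X: "X (m + n) = (FObj F ^^ n) (X m)" by (simp add: add.commute[of m n] funpow_add)
  obtain ns B where B: "filt G ns B" "is_retract (X m) B"
     "\<And>t. weight t ns \<le> c t * poinc t (X m)"
     "\<And>n. n\<in>set ns \<Longrightarrow> \<exists>k\<in>supp (X m). \<bar>n - k\<bar> \<le> K"
    using filtration[OF X_Obj] by blast
  have f: "filt (X n) ns ((FObj F ^^ n) B)" using power_filt[OF G B(1)] .
  have r: "is_retract (X (m + n)) ((FObj F ^^ n) B)" unfolding X using power_retract[OF B(2)] .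
  have "poinc t (X (m + n)) \<le> poinc t ((FObj F ^^ n) B)" using poinc_retract(1)[OF r] .
  also have "\<dots> \<le> weight t ns * poinc t (X n)" using poinc_filt(1)[OF X_Obj f] .
  also have "\<dots> \<le> c t * poinc t (X m) * poinc t (X n)" using B(3) poinc_nonneg by (intro mult_right_mono) auto
  finally show "poinc t (X (m + n)) \<le> c t * poinc t (X m) * poinc t (X n)" .
  assume "k \<in> supp (X (m + n))"
  then have "k \<in> supp ((FObj F ^^ n) B)" using poinc_retract(2)[OF r] by blast
  then obtain l where l: "l \<in> set ns" "k - l \<in> supp (X n)" using poinc_filt(2)[OF X_Obj f] by blast
  obtain i where i: "i \<in> supp (X m)" "\<bar>l - i\<bar> \<le> K" using B(4)[OF l(1)] by blast
  have "\<bar>k - (i + (k - l))\<bar> \<le> K" using i(2) by simp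
  then show "\<exists>i\<in>supp (X m). \<exists>j\<in>supp (X n). \<bar>k - (i + j)\<bar> \<le> K" using i(1) l(2) by blast
qed

lemma complexity_bounds:
  shows "\<bar>complexity D t G (X n)\<bar> \<noteq> \<infinity>"
    and "poinc t (X n) \<le> poinc t G * real_of_ereal (complexity D t G (X n))"
    and "real_of_ereal (complexity D t G (X n)) \<le> c t * poinc t (X n)"
proof -
  let ?S = "complexity_sums D t G (X n)" and ?x = "complexity D t G (X n)"
  have x: "?x = Inf ?S" using X_nonzero unfolding complexity_def by simp
  \<comment> \<open>\<open>G\<close> is \<open>X 0\<close>, hence nonzero, so dividing by its
    Poincare sum is legitimate.\<close>
  have pG: "0 < poinc t G" using poinc_pos[of t 0] by simp
  obtain ns B where B: "filt G ns B" "is_retract (X n) B"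
     "\<And>t. weight t ns \<le> c t * poinc t (X n)"
    using filtration[OF X_Obj] by blast
  have "?x \<le> ereal (weight t ns)"
    unfolding x by (rule Inf_lower[OF filt_complexity_sums[OF idempotent_complete B(1,2)]])
  also have "\<dots> \<le> ereal (c t * poinc t (X n))" using B(3) by simp
  finally have up: "?x \<le> ereal (c t * poinc t (X n))" .
  have low: "ereal (poinc t (X n) / poinc t G) \<le> ?x"
    unfolding x
  proof (rule Inf_greatest)
    fix y assume y: "y \<in> ?S"
    obtain r where r: "y = ereal r" using complexity_sums_filt[OF X_Obj y] by blast
    have "poinc t (X n) \<le> poinc t G * r" using complexity_lower[OF X_Obj X_nonzero y] r by simp
    then show "ereal (poinc t (X n) / poinc t G) \<le> y" using r pG by (simp add: pos_divide_le_eq mult.commute)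
  qed
  show fin: "\<bar>?x\<bar> \<noteq> \<infinity>" using up low by auto
  then obtain r where r: "?x = ereal r" by (cases ?x) auto
  show "poinc t (X n) \<le> poinc t G * real_of_ereal ?x" using low r pG by (simp add: pos_divide_le_eq mult.commute)
  show "real_of_ereal ?x \<le> c t * poinc t (X n)" using up r by simp
qed

sublocale exponential_growth "\<lambda>n. supp (X n)" "\<lambda>n. hdim (X n)" "\<lambda>t n. poinc t (X n)" c "\<lambda>t. poinc t G"
  "\<lambda>t n. real_of_ereal (complexity D t G (X n))" K
proof
  show "finite (supp (X n))" for n using finite_supp X_Obj .
  show "supp (X n) \<noteq> {}" for n using supp_nonempty X_Obj X_nonzero .
  show "1 \<le> hdim (X n) k" if "k \<in> supp (X n)" for k n using hdim_pos[OF X_Obj that] by simp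
  show "poinc t (X n) = (\<Sum>k\<in>supp (X n). real (hdim (X n) k) * exp (real_of_int k * t))" for t n
    by (rule poinc_def)
  show "0 < c t" for t by (rule c_pos)
  show "0 < poinc t G" for t using poinc_pos[of t 0] by simp
qed (use X_add complexity_bounds in blast)+

lemma cat_entropy_eq: "cat_entropy D G F t = ereal (h t)"
proof -
  \<comment> \<open>Index \<open>0\<close> is excluded, because division by zero has different
    values in \<open>ereal\<close> and in \<open>real\<close>.\<close>
  have ev: "\<forall>\<^sub>F n in sequentially. ereal_log (complexity D t G (X n)) / ereal (real n)
      = ereal (ln (real_of_ereal (complexity D t G (X n))) / real n)"
    using eventually_ge_at_top[of 1]
  proof eventually_elim
    case (elim n)
    obtain r where r: "complexity D t G (X n) = ereal r"
      using complexity_bounds(1)[of t n] by (cases "complexity D t G (X n)") auto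
    then have "0 < r" using \<delta>_pos[of t n] by simp
    then show ?case using r elim by (simp add: ereal_log_def)
  qed
  have "(\<lambda>n. ereal (ln (real_of_ereal (complexity D t G (X n))) / real n)) \<longlonglongrightarrow> ereal (h t)"
    using \<delta>_tendsto by simp
  then have "(\<lambda>n. ereal_log (complexity D t G (X n)) / ereal (real n)) \<longlonglongrightarrow> ereal (h t)"
    by (rule iffD2[OF tendsto_cong[OF ev]])
  then show ?thesis unfolding cat_entropy_def by (rule limI)
qed

lemma tau_eq: "tau_plus D G F = ereal \<tau>p" "tau_minus D G F = ereal \<tau>m"
proof -
  have "eps_plus D G (X n) = Max (supp (X n))" "eps_minus D G (X n) = Min (supp (X n))" for n
    unfolding eps_plus_def eps_minus_def supp_eq[OF X_Obj] by simp_all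
  then show "tau_plus D G F = ereal \<tau>p" "tau_minus D G F = ereal \<tau>m"
    unfolding tau_plus_def tau_minus_def
    using limI[of "\<lambda>n. ereal (real_of_int (Max (supp (X n))) / real n)" "ereal \<tau>p"]
      limI[of "\<lambda>n. ereal (real_of_int (Min (supp (X n))) / real n)" "ereal \<tau>m"] Max_tendsto Min_tendsto
    by simp_all
qed

end

theorem mainTheorem3:
  fixes D :: "('o, 'm::ab_group_add, 'k::field) tri_cat"
    and F :: "('o, 'm) endofunctor"
    and G :: 'o
  assumes "triangulated_category D"
    and "finite_type D"
    and "saturated TYPE('a) TYPE('v::ab_group_add) TYPE('w::ab_group_add) D"
    and "triangulated_endofunctor D F"
    and "\<not> virtually_zero D F"
    and "split_generator D G"
  defines "h \<equiv> cat_entropy D G F"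
    and "\<tau>p \<equiv> tau_plus D G F"
    and "\<tau>m \<equiv> tau_minus D G F"
  shows "(\<forall>t. \<bar>h t\<bar> \<noteq> \<infinity>)
    \<and> convex_on UNIV (\<lambda>t. real_of_ereal (h t))
    \<and> (\<forall>t\<ge>0. ereal t * \<tau>p \<le> h t \<and> h t \<le> h 0 + ereal t * \<tau>p)
    \<and> (\<forall>t\<le>0. ereal t * \<tau>m \<le> h t \<and> h t \<le> h 0 + ereal t * \<tau>m)
    \<and> ((\<lambda>t. h t / ereal t) \<longlongrightarrow> \<tau>p) at_top
    \<and> ((\<lambda>t. h t / ereal t) \<longlongrightarrow> \<tau>m) at_bot
    \<and> \<bar>\<tau>p\<bar> \<noteq> \<infinity> \<and> \<bar>\<tau>m\<bar> \<noteq> \<infinity>"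
proof -
  interpret gen: generated_category D G using assms(1,2,6) by (rule generated_categoryI)
  obtain A :: "('a, 'v, 'k) dg_cat" and \<phi> \<pi> where ic: "idempotent_complete D"
      and A: "dg_enhancement D A \<phi> \<pi>" "smooth_dg TYPE('w) A"
    using assms(3) unfolding saturated_def by blast
  \<comment> \<open>\<open>J\<close> depends on \<open>D\<close> and \<open>G\<close> alone, so the
    constants derived from it are fixed before any iterate of \<open>F\<close> is
    considered.\<close>
  obtain J where J: "\<And>X Y f. gen.ghosts G J X Y f \<Longrightarrow> f = 0"
    using gen.ghosts_vanish[OF A] by blast
  have "\<exists>c K. (\<forall>t. 0 < c t) \<and> (\<forall>E\<in>Obj D. \<exists>ns B. gen.filt G ns B \<and> gen.is_retract E B
     \<and> (\<forall>t. weight t ns \<le> c t * gen.poinc t E)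
     \<and> (\<forall>n\<in>set ns. \<exists>k\<in>gen.supp E. \<bar>n - k\<bar> \<le> K))"
    by (rule gen.uniform_filtration) (rule J)
  then obtain c K where cK: "\<And>t. 0 < c t" "\<And>E. E \<in> Obj D \<Longrightarrow> \<exists>ns B. gen.filt G ns B \<and> gen.is_retract E B
     \<and> (\<forall>t. weight t ns \<le> c t * gen.poinc t E)
     \<and> (\<forall>n\<in>set ns. \<exists>k\<in>gen.supp E. \<bar>n - k\<bar> \<le> K)"
    by blast
  interpret categorical_entropy D G F c K
    by unfold_locales (use assms(4,5) ic cK in auto)
  have h: "h t = ereal (local.h t)" for t unfolding assms(7) by (rule cat_entropy_eq)
  have \<tau>: "\<tau>p = ereal local.\<tau>p" "\<tau>m = ereal local.\<tau>m" unfolding assms(8,9) by (rule tau_eq)+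
  \<comment> \<open>The extended and the real quotient agree for \<open>t \<noteq> 0\<close>, which
    holds eventually in both directions.\<close>
  have quot: "\<forall>\<^sub>F t in at_top. ereal (local.h t / t) = h t / ereal t" "\<forall>\<^sub>F t in at_bot. ereal (local.h t / t) = h t / ereal t"
    by (rule eventually_mono[OF eventually_gt_at_top[of 0]], simp add: h,
        rule eventually_mono[OF eventually_gt_at_bot[of 0]], simp add: h)
  have l: "((\<lambda>t. ereal (local.h t / t)) \<longlongrightarrow> \<tau>p) at_top" "((\<lambda>t. ereal (local.h t / t)) \<longlongrightarrow> \<tau>m) at_bot"
    unfolding \<tau> using h_asymptotics by simp_all
  have "((\<lambda>t. h t / ereal t) \<longlongrightarrow> \<tau>p) at_top" "((\<lambda>t. h t / ereal t) \<longlongrightarrow> \<tau>m) at_bot"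
    by (rule iffD1[OF tendsto_cong[OF quot(1)] l(1)], rule iffD1[OF tendsto_cong[OF quot(2)] l(2)])
  then show ?thesis
    using h_convex h_ge h_le_pos h_le_neg by (auto simp: h \<tau>)
qed

end
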